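(* Let $n\ge2$, $\underline\nu=(\nu_1,\dots,\nu_n)\in\mathbb{C}^n$, $\kappa\in\mathbb{Z}_{\ge0}$, $\underline\kappa=(\kappa,0,\dots,0)$, and assume $\pi_{[\underline\nu,\underline\kappa]}$ is irreducible. Let $\underline\ell=(\ell_1,\dots,\ell_n)\in\mathbb{Z}_{\ge0}^n$ with $\ell_1+\cdots+\ell_n=\kappa$ and $\tilde\ell_j=\ell_1+\cdots+\ell_j$. Then for $a=(a_1,\dots,a_{n-1})\in\mathbb{R}_{>0}^{n-1}$, \begin{align*} f_{[\underline\nu,\underline\kappa],\underline\ell}(a)&=\int_{z_1,\dots,z_{n-2}}\frac{dz}{(2\pi\sqrt{-1})^{n-2}}(\mathcal{M}f_{\tilde{\underline\nu}})(z_1,\dots,z_{n-2})\int_{s_1,\dots,s_{n-1}}\frac{ds}{(2\pi\sqrt{-1})^{n-1}}\\ &\quad\prod_{j=1}^{n-2}a_j^{-s_j}\Gamma_\mathbb{C}\!\left(\tfrac{s_j+\kappa-\tilde\ell_j-z_{j-1}}{2}+j\nu_1\right)\Gamma_\mathbb{C}\!\left(\tfrac{s_j+\tilde\ell_j-z_j}{2}+j\nu_1\right)\\ &\quad\times a_{n-1}^{-s_{n-1}}\Gamma_\mathbb{C}\!\left(\tfrac{s_{n-1}+\kappa-\tilde\ell_{n-1}-z_{n-2}}{2}+(n-1)\nu_1\right)\Gamma_\mathbb{C}\!\left(\tfrac{s_{n-1}+\tilde\ell_{n-1}}{2}+|\tilde{\underline\nu}|+(n-1)\nu_1\right), \end{align*}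 with $z_0=0$; the contours are vertical lines with real parts large enough that all poles of the integrand lie to their left (for $n=2$ there is no $z$-integral and the factor $\mathcal{M}f_{\tilde{\underline\nu}}$ is omitted).
   Context: Setting $F=\mathbb{C}$, $|z|_\mathbb{C}=z\bar z$, $\psi(x)=e^{2\pi\sqrt{-1}(x+\bar x)}$, $\psi_m(u)=\psi(u_{12}+\cdots+u_{m-1,m})$ on upper unipotent $N_m(\mathbb{C})$, $K_m={\rm U}_m$, $T_m^+$ positive real diagonal matrices, $\delta_{B_m(\mathbb{C})}(t)=\prod_{i<j}|t_i/t_j|_\mathbb{C}$. $\Gamma_\mathbb{C}(s)=2(2\pi)^{-s}\Gamma(s)$. For $\nu\in\mathbb{C},k\in\mathbb{Z}$: $\chi_{[\nu,k]}(z)=|z|_\mathbb{C}^\nu(z/\sqrt{|z|_\mathbb{C}})^k$. For $\underline\nu\in\mathbb{C}^m,\underline k\in\mathbb{Z}^m$: $\pi_{[\underline\nu,\underline k]}=\chi_{[\nu_1,k_1]}\times\cdots\times\chi_{[\nu_m,k_m]}$ (normalized induction from the upper Borel), $\pi_{\underline\nu}=\pi_{[\underline\nu,0]}$, $|\underline\nu|=\sum\nu_i$, $\tilde{\underline\nu}=(\nu_2-\nu_1,\dots,\nu_m-\nu_1)$. For $a\in\mathbb{R}_{>0}^{m-1}$, $t(a)={\rm diag}(a_1\cdots a_{m-1},a_2\cdots a_{m-1},\dots,a_{m-1},1)$. Mellin transform: $(\mathcal{M}f)(z_1,\dots,z_{m-1})=\int_{\mathbb{R}_{>0}^{m-1}}f(a)\prod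 a_j^{z_j}\prod d^\times a_j$. Spherical Whittaker functions (Ishii–Stade normalization): for $\underline\mu\in\mathbb{C}^m$, $W_{\underline\mu}$ is the $K_m$-fixed element of $\mathscr{W}(\pi_{\underline\mu},\psi_m)$ with $f_{\underline\mu}(a):=\delta_{B_m(\mathbb{C})}(t(a))^{-1/2}W_{\underline\mu}(t(a))$ given by: $W_{\underline\mu}(g)=|\det g|_\mathbb{C}^{\mu_1}$ for $m=1$; $f_{\underline\mu}(a)=a^{\mu_1+\mu_2}K_{\mu_1-\mu_2}(4\pi a)$ for $m=2$; and for $m\ge3$ (with $z_0=0$) $f_{\underline\mu}(a)=\int_z\frac{dz}{(2\pi\sqrt{-1})^{m-2}}(\mathcal{M}f_{\tilde{\underline\mu}})(z)\int_s\frac{ds}{(2\pi\sqrt{-1})^{m-1}}\prod_{j=1}^{m-2}a_j^{-s_j}\Gamma_\mathbb{C}(\frac{s_j-z_{j-1}}{2}+j\mu_1)\Gamma_\mathbb{C}(\frac{s_j-z_j}{2}+j\mu_1)\cdot a_{m-1}^{-s_{m-1}}\Gamma_\mathbb{C}(\frac{s_{m-1}-z_{m-2}}{2}+(m-1)\mu_1)\Gamma_\mathbb{C}(\frac{s_{m-1}}{2}+|\tilde{\underline\mu}|+(m-1)\mu_1)$. Construction of $W_{[\underline\nu,\underline\kappa]}$: let $X=(X_1,\dots,X_n)$ be indeterminates; put $W_\pi(h)=W_{\tilde{\underline\nu}}(h)\chi_{[0,-\kappa]}(\det h)$ on ${\rm GL}_{n-1}(\mathbb{C})$, and for $x\in M_{n-1,n}(\mathbb{C})$,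 $\varphi(x)=(-1)^{\kappa(n-1)}2^{4(n-1)}\det\begin{pmatrix}X\\ \bar x\end{pmatrix}^\kappa e^{-2\pi{\rm tr}(x\,{}^t\bar x)}$ (a polynomial in $X$ with Schwartz coefficients). With $\omega(h,g)\varphi(x)=|\det h|_\mathbb{C}^{-n/2}|\det g|_\mathbb{C}^{(n-1)/2}\varphi(h^{-1}xg)$ and $\varepsilon_{n-1}=(I_{n-1},0)$, set $W_\Pi(g)=\int_{N_{n-1}(\mathbb{C})\backslash{\rm GL}_{n-1}(\mathbb{C})}\int_{N_n(\mathbb{C})}\omega(h,ug)\varphi(\varepsilon_{n-1})W_\pi(h)\psi_n^{-1}(u)\,du\,dh$ (coefficientwise in $X$) and $W_{[\underline\nu,\underline\kappa]}(g)=\chi_{[\nu_1,\kappa]}(\det g)W_\Pi(g)$, a homogeneous degree-$\kappa$ polynomial in $X$. Write $W_{[\underline\nu,\underline\kappa]}(g)=\sum_{\ell_1+\cdots+\ell_n=\kappa}\frac{\kappa!}{\ell_1!\cdots\ell_n!}(\sqrt{-1})^{\sum_{i=1}^{n-1}\tilde\ell_i}X_1^{\ell_1}\cdots X_n^{\ell_n}W_{[\underline\nu,\underline\kappa],\underline\ell}(g)$ and $f_{[\underline\nu,\underline\kappa],\underline\ell}(a)=\delta_{B_n(\mathbb{C})}(t(a))^{-1/2}W_{[\underline\nu,\underline\kappa],\underline\ell}(t(a))$. Measures: $du=\prod du_{ij}$ with each $du_{ij}=2\,dx\,dy$ (self-dual for $\psi$); $dh=\delta_{B_{n-1}(\mathbb{C})}(t)^{-1}dt\,dk$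 via $h=utk$, $dt=\prod dt_i/t_i$ on $T_{n-1}^+$, $dk$ the probability Haar measure on ${\rm U}_{n-1}$. *)

theory Defs
  imports
    "HOL-Analysis.Analysis"
    "HOL-Probability.Probability_Measure"
    "HOL-Library.Poly_Mapping"
    "Jordan_Normal_Form.Determinant"
    "Jordan_Normal_Form.Gauss_Jordan_Elimination"
    "Jordan_Normal_Form.Schur_Decomposition"
begin

text \<open>
  Vectors such as \<open>\<nu>\<close>, \<open>\<mu>\<close>, \<open>l\<close>, \<open>a\<close>, \<open>z\<close>, \<open>s\<close> are functions on \<open>nat\<close>
  indexed from 1, as on paper; values outside the index range are irrelevant.
  Entries of matrices (type \<open>complex mat\<close>) are indexed from 0.
\<close>


section \<open>Characters, matrix groups\<close>

text \<open>The normalized absolute value \<open>z * cnj z\<close> of the field of complex numbers.\<close>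

definition absC :: "complex \<Rightarrow> real" where
  "absC z = (cmod z)\<^sup>2"

definition psi :: "complex \<Rightarrow> complex" where
  "psi x = exp (2 * complex_of_real pi * \<i> * (x + cnj x))"

definition chi :: "complex \<Rightarrow> int \<Rightarrow> complex \<Rightarrow> complex" where
  "chi \<nu> k z = complex_of_real (absC z) powr \<nu> * (z / complex_of_real (sqrt (absC z))) powi k"

definition Gamma_C :: "complex \<Rightarrow> complex" where
  "Gamma_C s = 2 * complex_of_real (2 * pi) powr (- s) * Gamma s"

definition GL :: "nat \<Rightarrow> complex mat set" where
  "GL n = {g \<in> carrier_mat n n. Determinant.det g \<noteq> 0}"

definition Borel :: "nat \<Rightarrow> complex mat set" where
  "Borel n = {b \<in> GL n. upper_triangular b}"

definition Nunip :: "nat \<Rightarrow> complex mat set" where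
  "Nunip n = {u \<in> carrier_mat n n. upper_triangular u \<and> (\<forall>i<n. u $$ (i, i) = 1)}"

definition Ugrp :: "nat \<Rightarrow> complex mat set" where
  "Ugrp n = {k \<in> carrier_mat n n. k * mat_adjoint k = 1\<^sub>m n}"

definition psi_N :: "nat \<Rightarrow> complex mat \<Rightarrow> complex" where
  "psi_N n u = psi (\<Sum>i<n - 1. u $$ (i, i + 1))"

definition delta_B :: "nat \<Rightarrow> complex mat \<Rightarrow> real" where
  "delta_B n b = (\<Prod>j<n. \<Prod>i<j. absC (b $$ (i, i) / b $$ (j, j)))"

definition diag_real :: "nat \<Rightarrow> (nat \<Rightarrow> real) \<Rightarrow> complex mat" where
  "diag_real m t = mat_diag m (\<lambda>i. complex_of_real (t (i + 1)))"

text \<open>The matrix \<open>diag (a\<^sub>1 \<cdots> a\<^sub>m\<^sub>-\<^sub>1, a\<^sub>2 \<cdots> a\<^sub>m\<^sub>-\<^sub>1, \<dots>, a\<^sub>m\<^sub>-\<^sub>1, 1)\<close>.\<close>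

definition tmat :: "nat \<Rightarrow> (nat \<Rightarrow> real) \<Rightarrow> complex mat" where
  "tmat m a = diag_real m (\<lambda>i. \<Prod>j=i..<m. a j)"

definition torus_part :: "nat \<Rightarrow> (complex mat \<Rightarrow> complex) \<Rightarrow> (nat \<Rightarrow> real) \<Rightarrow> complex" where
  "torus_part m W a = complex_of_real (delta_B m (tmat m a) powr (- 1/2)) * W (tmat m a)"


section \<open>Smooth principal series and their Whittaker models\<close>

text \<open>The topology on \<open>GL n\<close> is induced by the embedding into the space of matrix entries.\<close>

definition GL_top :: "nat \<Rightarrow> complex mat topology" where
  "GL_top n = pullback_topology (GL n)
     (\<lambda>g (i, j). if i < n \<and> j < n then g $$ (i, j) else 0) euclidean"

text \<open>Coordinate directions of the real vector space of complex matrices.\<close>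

definition real_dirs :: "nat \<Rightarrow> complex mat set" where
  "real_dirs n = {Matrix.mat n n (\<lambda>p. if p = (i, j) then c else 0) | i j c.
     i < n \<and> j < n \<and> (c = 1 \<or> c = \<i>)}"

definition pderiv_mat ::
  "complex mat \<Rightarrow> (complex mat \<Rightarrow> complex) \<Rightarrow> complex mat \<Rightarrow> complex" where
  "pderiv_mat D f g =
     vector_derivative (\<lambda>t::real. f (g + complex_of_real t \<cdot>\<^sub>m D)) (at 0)"

definition iter_pderiv ::
  "complex mat list \<Rightarrow> (complex mat \<Rightarrow> complex) \<Rightarrow> complex mat \<Rightarrow> complex" where
  "iter_pderiv Ds f = foldr pderiv_mat Ds f"

text \<open>Smooth functions on \<open>GL n\<close>, extended by zero: all iterated real partial derivatives
  exist and are continuous.\<close>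

definition smooth_GL :: "nat \<Rightarrow> (complex mat \<Rightarrow> complex) set" where
  "smooth_GL n = {f. (\<forall>g. g \<notin> GL n \<longrightarrow> f g = 0) \<and>
     (\<forall>Ds \<in> lists (real_dirs n).
        continuous_map (GL_top n) euclidean (iter_pderiv Ds f) \<and>
        (\<forall>D \<in> real_dirs n. \<forall>g \<in> GL n.
           (\<lambda>t::real. iter_pderiv Ds f (g + complex_of_real t \<cdot>\<^sub>m D)) differentiable (at 0)))}"

text \<open>The Frechet topology: uniform convergence of all derivatives on compact subsets.\<close>

definition smooth_top :: "nat \<Rightarrow> (complex mat \<Rightarrow> complex) topology" where
  "smooth_top n = topology_generated_by
     {{h \<in> smooth_GL n. \<forall>Ds \<in> lists (real_dirs n). length Ds \<le> N \<longrightarrow>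
          (\<forall>g \<in> C. cmod (iter_pderiv Ds h g - iter_pderiv Ds f g) < \<epsilon>)} | C N \<epsilon> f.
        compactin (GL_top n) C \<and> \<epsilon> > 0 \<and> f \<in> smooth_GL n}"

text \<open>The space of the normalized induction of
  \<open>chi (\<nu> 1) (k 1) \<otimes> \<cdots> \<otimes> chi (\<nu> n) (k n)\<close> from the upper Borel subgroup,
  on which \<open>GL n\<close> acts by right translation.\<close>

definition principal_series ::
  "nat \<Rightarrow> (nat \<Rightarrow> complex) \<Rightarrow> (nat \<Rightarrow> int) \<Rightarrow> (complex mat \<Rightarrow> complex) set" where
  "principal_series n \<nu> k = {f \<in> smooth_GL n. \<forall>b \<in> Borel n. \<forall>g \<in> GL n.
     f (b * g) = (\<Prod>i=1..n. chi (\<nu> i) (k i) (b $$ (i - 1, i - 1)))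
                 * complex_of_real (sqrt (delta_B n b)) * f g}"

definition rtrans :: "nat \<Rightarrow> complex mat \<Rightarrow> (complex mat \<Rightarrow> complex) \<Rightarrow> complex mat \<Rightarrow> complex" where
  "rtrans n h f g = (if g \<in> GL n then f (g * h) else 0)"

text \<open>Topological irreducibility.\<close>

definition irreducible_rep :: "nat \<Rightarrow> (complex mat \<Rightarrow> complex) set \<Rightarrow> bool" where
  "irreducible_rep n V \<longleftrightarrow> V \<noteq> {\<lambda>_. 0} \<and>
     (\<forall>S. S \<subseteq> V \<and> (\<lambda>_. 0) \<in> S
        \<and> (\<forall>f \<in> S. \<forall>h \<in> S. \<forall>c. (\<lambda>g. c * f g + h g) \<in> S)
        \<and> (\<forall>h \<in> GL n. \<forall>f \<in> S. rtrans n h f \<in> S)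
        \<and> closedin (subtopology (smooth_top n) V) S
      \<longrightarrow> S = {\<lambda>_. 0} \<or> S = V)"

text \<open>Continuous linear functionals \<open>\<Lambda>\<close> on \<open>V\<close> transforming by \<open>psi_N n\<close> under \<open>Nunip n\<close>.\<close>

definition whittaker_functional ::
  "nat \<Rightarrow> (complex mat \<Rightarrow> complex) set \<Rightarrow> ((complex mat \<Rightarrow> complex) \<Rightarrow> complex) \<Rightarrow> bool" where
  "whittaker_functional n V \<Lambda> \<longleftrightarrow>
     (\<forall>f \<in> V. \<forall>h \<in> V. \<forall>c. \<Lambda> (\<lambda>g. c * f g + h g) = c * \<Lambda> f + \<Lambda> h) \<and>
     continuous_map (subtopology (smooth_top n) V) euclidean \<Lambda> \<and>
     (\<forall>u \<in> Nunip n. \<forall>f \<in> V. \<Lambda> (rtrans n u f) = psi_N n u * \<Lambda> f)"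

text \<open>For principal series the space of Whittaker functionals is one-dimensional, so
  letting \<open>\<Lambda>\<close> range over all of them gives the Whittaker model.\<close>

definition whittaker_model ::
  "nat \<Rightarrow> (complex mat \<Rightarrow> complex) set \<Rightarrow> (complex mat \<Rightarrow> complex) set" where
  "whittaker_model n V = {W. \<exists>\<Lambda> f. whittaker_functional n V \<Lambda> \<and> f \<in> V \<and>
     (\<forall>g \<in> GL n. W g = \<Lambda> (rtrans n g f))}"


section \<open>Mellin transforms and integrals over vertical lines\<close>

text \<open>The multiplicative Haar measure \<open>da / a\<close> on the positive reals, and its powers.\<close>

definition mult_haar :: "real measure" where
  "mult_haar = density lborel (\<lambda>x. ennreal (indicator {0<..} x / x))"

definition mult_haar_pow :: "nat \<Rightarrow> (nat \<Rightarrow> real) measure" where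
  "mult_haar_pow m = PiM {1..m} (\<lambda>_. mult_haar)"

definition mellin_integrand ::
  "nat \<Rightarrow> ((nat \<Rightarrow> real) \<Rightarrow> complex) \<Rightarrow> (nat \<Rightarrow> complex) \<Rightarrow> (nat \<Rightarrow> real) \<Rightarrow> complex" where
  "mellin_integrand m f z a = f a * (\<Prod>j=1..m. complex_of_real (a j) powr z j)"

definition mellin :: "nat \<Rightarrow> ((nat \<Rightarrow> real) \<Rightarrow> complex) \<Rightarrow> (nat \<Rightarrow> complex) \<Rightarrow> complex" where
  "mellin m f z = (LINT a|mult_haar_pow m. mellin_integrand m f z a)"

text \<open>The integral of \<open>F\<close> against \<open>dz / (2 \<pi> \<i>)\<^sup>m\<close> over the lines
  \<open>Re (z j) = c j\<close>, \<open>1 \<le> j \<le> m\<close>; with \<open>z j = c j + \<i> * y j\<close> this is \<open>dy / (2 \<pi>)\<^sup>m\<close>.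
  The points of integration carry the extra coordinate \<open>z 0 = 0\<close>.\<close>

definition vline_integral :: "nat \<Rightarrow> (nat \<Rightarrow> real) \<Rightarrow> ((nat \<Rightarrow> complex) \<Rightarrow> complex) \<Rightarrow> complex" where
  "vline_integral m c F =
     (LINT y|PiM {1..m} (\<lambda>_. lborel). F (\<lambda>j. if j = 0 then 0 else Complex (c j) (y j)))
       / complex_of_real ((2 * pi) ^ m)"

definition tilde :: "(nat \<Rightarrow> complex) \<Rightarrow> nat \<Rightarrow> complex" where
  "tilde \<mu> j = \<mu> (j + 1) - \<mu> 1"

text \<open>Real parts \<open>c\<close> (for \<open>z\<close>) and \<open>d\<close> (for \<open>s\<close>) of admissible lines for the integrals
  below, where \<open>F\<close> is the function whose Mellin transform occurs. The poles of \<open>mellin (n - 2) F\<close>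
  lie to the left of the lines when the Mellin integral converges absolutely on the lines and
  to their right; the poles in \<open>s\<close> lie to the left when the arguments of all Gamma factors have
  positive real part.\<close>

definition admissible_lines ::
  "nat \<Rightarrow> (nat \<Rightarrow> complex) \<Rightarrow> nat \<Rightarrow> (nat \<Rightarrow> nat) \<Rightarrow> ((nat \<Rightarrow> real) \<Rightarrow> complex)
     \<Rightarrow> (nat \<Rightarrow> real) \<Rightarrow> (nat \<Rightarrow> real) \<Rightarrow> bool" where
  "admissible_lines n \<nu> \<kappa> L F c d \<longleftrightarrow>
     (\<forall>z. (\<forall>j\<in>{1..n-2}. c j \<le> Re (z j)) \<longrightarrow>
        integrable (mult_haar_pow (n - 2)) (mellin_integrand (n - 2) F z)) \<and>
     (\<forall>j\<in>{1..n-1}.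
        0 < (d j + real \<kappa> - real (L j) - (if j = 1 then 0 else c (j - 1))) / 2 + real j * Re (\<nu> 1)) \<and>
     (\<forall>j\<in>{1..n-2}. 0 < (d j + real (L j) - c j) / 2 + real j * Re (\<nu> 1)) \<and>
     0 < (d (n - 1) + real (L (n - 1))) / 2 + Re (\<Sum>j=1..n-1. tilde \<nu> j) + real (n - 1) * Re (\<nu> 1)"


section \<open>Spherical Whittaker functions\<close>

definition besselK :: "complex \<Rightarrow> real \<Rightarrow> complex" where
  "besselK \<nu> x = (LINT t|mult_haar.
     complex_of_real (exp (- x * (t + 1 / t) / 2)) * complex_of_real t powr \<nu>) / 2"

text \<open>The normalized torus restriction of the spherical Whittaker function. In the case of
  rank at least 3 the integral does not depend on the admissible lines. The value for \<open>m = 1\<close>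
  is forced by \<open>W g = absC (det g) powr \<mu> 1\<close>.\<close>

fun spherical_torus :: "nat \<Rightarrow> (nat \<Rightarrow> complex) \<Rightarrow> (nat \<Rightarrow> real) \<Rightarrow> complex" where
  "spherical_torus 0 \<mu> = (\<lambda>a. 1)"
| "spherical_torus (Suc 0) \<mu> = (\<lambda>a. 1)"
| "spherical_torus (Suc (Suc 0)) \<mu> =
     (\<lambda>a. complex_of_real (a 1) powr (\<mu> 1 + \<mu> 2) * besselK (\<mu> 1 - \<mu> 2) (4 * pi * a 1))"
| "spherical_torus (Suc (Suc (Suc r))) \<mu> =
     (let m = r + 3;
          F = spherical_torus (Suc (Suc r)) (tilde \<mu>);
          (c, d) = (SOME (c, d). admissible_lines m \<mu> 0 (\<lambda>_. 0) F c d)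
      in (\<lambda>a. vline_integral (m - 2) c (\<lambda>z. mellin (m - 2) F z *
            vline_integral (m - 1) d (\<lambda>s.
              (\<Prod>j=1..m-2. complex_of_real (a j) powr (- s j)
                 * Gamma_C ((s j - z (j - 1)) / 2 + of_nat j * \<mu> 1)
                 * Gamma_C ((s j - z j) / 2 + of_nat j * \<mu> 1))
              * complex_of_real (a (m - 1)) powr (- s (m - 1))
              * Gamma_C ((s (m - 1) - z (m - 2)) / 2 + of_nat (m - 1) * \<mu> 1)
              * Gamma_C (s (m - 1) / 2 + (\<Sum>j=1..m-1. tilde \<mu> j) + of_nat (m - 1) * \<mu> 1)))))"

definition spherical_whittaker ::
  "nat \<Rightarrow> (nat \<Rightarrow> complex) \<Rightarrow> (complex mat \<Rightarrow> complex) \<Rightarrow> bool" where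
  "spherical_whittaker m \<mu> W \<longleftrightarrow>
     W \<in> whittaker_model m (principal_series m \<mu> (\<lambda>_. 0)) \<and>
     (\<forall>g \<in> GL m. \<forall>k \<in> Ugrp m. W (g * k) = W g) \<and>
     (if m = 1
      then \<forall>g \<in> GL 1. W g = complex_of_real (absC (Determinant.det g)) powr \<mu> 1
      else \<forall>a. (\<forall>j\<in>{1..m-1}. 0 < a j) \<longrightarrow> torus_part m W a = spherical_torus m \<mu> a)"


section \<open>The Whittaker functions with values in polynomials\<close>

text \<open>Polynomials in the indeterminates \<open>X\<^sub>1, X\<^sub>2, \<dots>\<close>, as finitely supported functions on
  exponent vectors.\<close>

type_synonym cpoly = "(nat \<Rightarrow>\<^sub>0 nat) \<Rightarrow>\<^sub>0 complex"

definition Cst :: "complex \<Rightarrow> cpoly" where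
  "Cst c = Poly_Mapping.single 0 c"

definition Var :: "nat \<Rightarrow> cpoly" where
  "Var i = Poly_Mapping.single (Poly_Mapping.single i 1) 1"

definition monomial_exp :: "nat \<Rightarrow> (nat \<Rightarrow> nat) \<Rightarrow> (nat \<Rightarrow>\<^sub>0 nat)" where
  "monomial_exp n l = (\<Sum>i=1..n. Poly_Mapping.single i (l i))"

definition phi :: "nat \<Rightarrow> nat \<Rightarrow> complex mat \<Rightarrow> cpoly" where
  "phi n \<kappa> x =
     Cst ((-1) ^ (\<kappa> * (n - 1)) * 2 ^ (4 * (n - 1)))
     * (Determinant.det (Matrix.mat n n (\<lambda>(i, j).
          if i = 0 then Var (j + 1) else Cst (cnj (x $$ (i - 1, j)))))) ^ \<kappa>
     * Cst (exp (- 2 * complex_of_real pi * (\<Sum>i<n-1. (x * mat_adjoint x) $$ (i, i))))"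

definition omega ::
  "nat \<Rightarrow> complex mat \<Rightarrow> complex mat \<Rightarrow> (complex mat \<Rightarrow> cpoly) \<Rightarrow> complex mat \<Rightarrow> cpoly" where
  "omega n h g \<phi> x =
     Cst (complex_of_real (absC (Determinant.det h) powr (- real n / 2)
          * absC (Determinant.det g) powr ((real n - 1) / 2)))
     * \<phi> (the (mat_inverse h) * x * g)"

text \<open>The matrix \<open>(I, 0)\<close> with \<open>n - 1\<close> rows and \<open>n\<close> columns.\<close>

definition eps_mat :: "nat \<Rightarrow> complex mat" where
  "eps_mat n = Matrix.mat (n - 1) n (\<lambda>(i, j). if i = j then 1 else 0)"

text \<open>The Haar measure on \<open>Nunip n\<close> in the coordinates \<open>u\<^sub>i\<^sub>j\<close>, \<open>i < j\<close>, each with the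
  measure \<open>2 dx dy\<close>.\<close>

definition unip_measure :: "nat \<Rightarrow> (nat \<times> nat \<Rightarrow> complex) measure" where
  "unip_measure n = PiM {(i, j). i < j \<and> j < n} (\<lambda>_. scale_measure 2 lborel)"

definition unip_mat :: "nat \<Rightarrow> (nat \<times> nat \<Rightarrow> complex) \<Rightarrow> complex mat" where
  "unip_mat n v = Matrix.mat n n (\<lambda>(i, j). if i = j then 1 else if i < j then v (i, j) else 0)"

definition haar_prob_U :: "nat \<Rightarrow> complex mat measure \<Rightarrow> bool" where
  "haar_prob_U m dk \<longleftrightarrow> prob_space dk \<and> space dk = Ugrp m \<and>
     sets dk = sigma_sets (Ugrp m) {S. openin (subtopology (GL_top m) (Ugrp m)) S} \<and>
     (\<forall>k \<in> Ugrp m. \<forall>A \<in> sets dk. emeasure dk ((\<lambda>x. k * x) ` A) = emeasure dk A)"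

text \<open>The integral of a left \<open>Nunip m\<close>-invariant function on \<open>GL m\<close> over the quotient, with
  \<open>h = u t k\<close> and \<open>dh = delta_B(t)\<^sup>-\<^sup>1 dt dk\<close>.\<close>

definition quot_integral :: "nat \<Rightarrow> complex mat measure \<Rightarrow> (complex mat \<Rightarrow> complex) \<Rightarrow> complex" where
  "quot_integral m dk G =
     (LINT (t, k)|(mult_haar_pow m \<Otimes>\<^sub>M dk).
        complex_of_real (1 / delta_B m (diag_real m t)) * G (diag_real m t * k))"

text \<open>Below \<open>W\<close> is the spherical Whittaker function with parameter \<open>tilde \<nu>\<close>, and \<open>e\<close> is the
  exponent of the monomial whose coefficient is taken: polynomials are integrated
  coefficientwise.\<close>

definition W_Pi ::
  "nat \<Rightarrow> nat \<Rightarrow> complex mat measure \<Rightarrow> (complex mat \<Rightarrow> complex) \<Rightarrow> complex mat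
     \<Rightarrow> (nat \<Rightarrow>\<^sub>0 nat) \<Rightarrow> complex" where
  "W_Pi n \<kappa> dk W g e =
     quot_integral (n - 1) dk (\<lambda>h. LINT v|unip_measure n.
       Poly_Mapping.lookup (omega n h (unip_mat n v * g) (phi n \<kappa>) (eps_mat n)) e
       * (W h * chi 0 (- int \<kappa>) (Determinant.det h))
       * inverse (psi_N n (unip_mat n v)))"

definition W_nu_kappa ::
  "nat \<Rightarrow> (nat \<Rightarrow> complex) \<Rightarrow> nat \<Rightarrow> complex mat measure \<Rightarrow> (complex mat \<Rightarrow> complex) \<Rightarrow> complex mat
     \<Rightarrow> (nat \<Rightarrow>\<^sub>0 nat) \<Rightarrow> complex" where
  "W_nu_kappa n \<nu> \<kappa> dk W g e = chi (\<nu> 1) (int \<kappa>) (Determinant.det g) * W_Pi n \<kappa> dk W g e"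

definition partial_sum :: "(nat \<Rightarrow> nat) \<Rightarrow> nat \<Rightarrow> nat" where
  "partial_sum l j = (\<Sum>i=1..j. l i)"

text \<open>The component at \<open>l\<close>: the coefficient of the monomial \<open>\<Prod>i=1..n. X\<^sub>i ^ l i\<close> in
  \<open>W_nu_kappa\<close> is \<open>\<kappa>! / (\<Prod>i=1..n. (l i)!) * \<i> ^ (\<Sum>i=1..n-1. partial_sum l i)\<close>
  times this component.\<close>

definition W_component ::
  "nat \<Rightarrow> (nat \<Rightarrow> complex) \<Rightarrow> nat \<Rightarrow> complex mat measure \<Rightarrow> (complex mat \<Rightarrow> complex)
     \<Rightarrow> (nat \<Rightarrow> nat) \<Rightarrow> complex mat \<Rightarrow> complex" where
  "W_component n \<nu> \<kappa> dk W l g =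
     W_nu_kappa n \<nu> \<kappa> dk W g (monomial_exp n l)
       / ((fact \<kappa> / (\<Prod>i=1..n. fact (l i))) * \<i> ^ (\<Sum>i=1..n-1. partial_sum l i))"

end

theory Submission
  imports Defs "HOL-Probability.Probability"
begin

text \<open>
  Both sides equal the integral over the positive torus of \<open>spherical_torus\<close> against a product of
  the functions \<open>gker \<alpha> x = 4 * x powr (2 * \<alpha>) * exp (- 2 * pi * x\<^sup>2)\<close>, whose Mellin transforms are
  the Gamma factors. On the side of the Mellin--Barnes integral this is Mellin inversion in one
  variable at a time, followed by Fubini. On the side of the Whittaker function, the unitary variable
  contributes \<open>det k ^ \<kappa>\<close>, which \<open>W_Pi\<close> cancels. The unipotent integral is Gaussian; its moments in the conjugate
  variables are multiplicative in the exponent, so it evaluates the determinant in \<open>phi\<close> at a point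
  where the matrix is bidiagonal below its first row.
\<close>

section \<open>Mellin inversion for the Gamma factors\<close>

text \<open>Nothing is known about the decay in z of the Mellin transform of
  \<open>spherical_torus\<close>, so that transform is unfolded and never inverted; inversion is
  applied to \<open>Gamma_C\<close> only, whose decay comes from the functional equation. Absolute
  convergence in z must then come from the Barnes factors alone, which is why
  \<open>barnes_bounded_L1\<close> is uniform in the preceding variable. \<open>phi\<close> contains
  only conjugates of matrix entries, so no variable is paired with its own conjugate, and every
  Gaussian moment is a power of one number. The character makes this number nonzero on the
  superdiagonal only. The coefficient of each X_j in the determinant is then a single product, and
  in the power kappa the exponents of its factors add up to partial sums of l. The constant
  2^(4(n-1)) in \<open>phi\<close> is the product of the leading factors 4 of the 2(n-1) functions
  \<open>gker\<close>. Measurability is supplied only for the Mellin integrand. Hence the positivity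
  guard in \<open>torus_integrand\<close>, and an identity valid at every real t in
  \<open>wpi_integrand_abs\<close>.\<close>

lemma measurable_of_real_powr [measurable (raw)]:
  fixes f :: "'a \<Rightarrow> real"
  assumes [measurable]: "f \<in> borel_measurable M" "g \<in> borel_measurable M"
  shows "(\<lambda>x. complex_of_real (f x) powr g x) \<in> borel_measurable M"
proof -
  have "complex_of_real (f x) powr g x = (if f x = 0 then 0 else
      exp (g x * (complex_of_real (ln \<bar>f x\<bar>) + complex_of_real (if f x < 0 then pi else 0) * \<i>)))" for x
    by (simp add: powr_def Ln_of_real')
  then show ?thesis by (simp only:) measurable
qed

lemma measurable_Complex [measurable (raw)]:
  assumes [measurable]: "f \<in> borel_measurable M" "g \<in> borel_measurable M"
  shows "(\<lambda>x. Complex (f x) (g x)) \<in> borel_measurable M"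
  unfolding Complex_eq by measurable

section \<open>The multiplicative Haar measure in the coordinate ln x\<close>

lemma space_mult_haar [simp]: "space mult_haar = UNIV"
  and sets_mult_haar [simp, measurable_cong]: "sets mult_haar = sets borel"
  by (simp_all add: mult_haar_def)

lemma AE_mult_haar_pos: "AE x in mult_haar. 0 < x"
  unfolding mult_haar_def
  by (subst AE_density) (auto simp: indicator_def zero_less_divide_iff split: if_splits)

text \<open>In the coordinate u = ln x a Mellin transform is a Fourier-Laplace transform on the
  line, and scaling becomes translation.\<close>

lemma mult_haar_eq_distr_exp: "mult_haar = distr lborel borel exp"
proof -
  have "lborel = distr mult_haar borel ln"
  proof (rule lborel_eqI)
    fix l u :: real
    assume "\<And>b. b \<in> Basis \<Longrightarrow> l \<bullet> b \<le> u \<bullet> b"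
    then have lu: "l \<le> u" by simp
    have "emeasure (distr mult_haar borel ln) (box l u) = emeasure mult_haar (ln -` box l u)"
      by (subst emeasure_distr) auto
    also have "\<dots> = (\<integral>\<^sup>+x. ennreal (indicator {0<..} x / x) * indicator (ln -` box l u) x \<partial>lborel)"
      unfolding mult_haar_def
      by (subst emeasure_density) (auto intro!: measurable_sets_borel[of ln borel])
    also have "\<dots> = (\<integral>\<^sup>+x. ennreal (1 / x) * indicator {exp l..exp u} x \<partial>lborel)"
    proof (rule nn_integral_cong_AE)
      \<comment> \<open>The fundamental theorem of calculus is applied on a closed interval; its two
        endpoints are null sets.\<close>
      have "AE x in lborel. x \<noteq> exp l" "AE x in lborel. x \<noteq> exp u"
        by (rule AE_lborel_singleton)+
      then show "AE x in lborel. ennreal (indicator {0<..} x / x) * indicator (ln -` box l u) x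
          = ennreal (1 / x) * indicator {exp l..exp u} x"
      proof eventually_elim
        case (elim x)
        show ?case
        proof (cases "x > 0")
          case True
          then have "l < ln x \<longleftrightarrow> exp l < x" "ln x < u \<longleftrightarrow> x < exp u"
            by (metis exp_less_cancel_iff exp_ln)+
          with elim True show ?thesis by (auto simp: indicator_def)
        next
          case False
          then have "\<not> exp l \<le> x" by (meson exp_gt_zero not_le order_less_le_trans)
          with False show ?thesis by (auto simp: indicator_def)
        qed
      qed
    qed
    also have "\<dots> = ennreal (ln (exp u) - ln (exp l))"
    proof (rule nn_integral_FTC_Icc)
      fix x assume "x \<in> {exp l..exp u}"
      then have "0 < x" by (meson atLeastAtMost_iff exp_gt_zero order_less_le_trans)
      then show "(ln has_real_derivative 1 / x) (at x)" "0 \<le> 1 / x"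
        by (auto intro!: derivative_eq_intros)
    qed (use lu in auto)
    finally show "emeasure (distr mult_haar borel ln) (box l u) = ennreal (prod ((\<bullet>) (u - l)) Basis)"
      by simp
  qed simp
  then have "distr lborel borel exp = distr (distr mult_haar borel ln) borel exp"
    by (rule arg_cong)
  also have "\<dots> = distr mult_haar borel (exp \<circ> ln)"
    by (subst distr_distr) auto
  also have "\<dots> = distr mult_haar borel (\<lambda>x. x)"
    by (rule distr_cong_AE) (use AE_mult_haar_pos in auto)
  also have "\<dots> = mult_haar" by (simp add: distr_id2)
  finally show ?thesis by simp
qed

interpretation mult_haar: sigma_finite_measure mult_haar
  unfolding mult_haar_def
  by (subst sigma_finite_measure.sigma_finite_iff_density_finite[OF sigma_finite_lborel]) auto

lemma integrable_mult_haar_iff: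
  fixes f :: "real \<Rightarrow> 'a::{banach, second_countable_topology}"
  assumes "f \<in> borel_measurable borel"
  shows "integrable mult_haar f \<longleftrightarrow> integrable lborel (\<lambda>u. f (exp u))"
  unfolding mult_haar_eq_distr_exp by (rule integrable_distr_eq) (use assms in auto)

lemma integral_mult_haar:
  fixes f :: "real \<Rightarrow> 'a::{banach, second_countable_topology}"
  assumes "f \<in> borel_measurable borel"
  shows "(LINT x|mult_haar. f x) = (LINT u|lborel. f (exp u))"
  unfolding mult_haar_eq_distr_exp by (rule integral_distr) (use assms in auto)

lemma powr_exp: "complex_of_real (exp u) powr z = exp (z * of_real u)"
  by (simp add: powr_def flip: exp_of_real)

text \<open>Euler's integral after t = exp u. The measure dt / t absorbs one power of t, so the
  exponent is z and not z - 1.\<close>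

lemma log_Gamma_integral:
  assumes "Re z > 0"
  shows "integrable lborel (\<lambda>u. exp (z * of_real u - of_real (exp u)))" (is ?A)
    and "(LINT u|lborel. exp (z * of_real u - of_real (exp u))) = Gamma z" (is ?B)
proof -
  let ?f = "\<lambda>t::real. complex_of_real t powr (z - 1) / complex_of_real (exp t)"
  let ?g = "\<lambda>t::real. complex_of_real t powr z / complex_of_real (exp t)"
  have [measurable]: "?f \<in> borel_measurable borel" "?g \<in> borel_measurable borel" by measurable
  have "set_integrable lebesgue {0<..} ?f"
    using absolutely_integrable_Gamma_integral'[OF assms] .
  then have int: "set_integrable lborel {0<..} ?f"
    unfolding set_integrable_def by (subst (asm) integrable_completion) auto
  then have "((?f) has_integral (set_lebesgue_integral lborel {0<..} ?f)) {0<..}"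
    by (metis has_integral_integrable_integral set_borel_integral_eq_integral)
  then have val: "set_lebesgue_integral lborel {0<..} ?f = Gamma z"
    using Gamma_integral_complex'[OF assms] has_integral_unique by blast
  have eq: "(indicator {0<..} x / x) *\<^sub>R ?g x = indicator {0<..} x *\<^sub>R ?f x" for x
    by (auto simp: indicator_def powr_diff scaleR_conv_of_real field_simps)
  have "integrable mult_haar ?g"
    using int unfolding mult_haar_def set_integrable_def
    by (subst integrable_density) (auto simp: eq, auto simp: indicator_def)
  moreover have "(LINT x|mult_haar. ?g x) = Gamma z"
    unfolding mult_haar_def val[symmetric] set_lebesgue_integral_def
    by (subst integral_density) (auto simp: eq, auto simp: indicator_def)
  moreover have "?g (exp u) = exp (z * of_real u - of_real (exp u))" for u
    by (simp add: powr_exp exp_diff exp_of_real)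
  ultimately show ?A ?B
    by (simp_all add: integrable_mult_haar_iff integral_mult_haar)
qed

text \<open>Normalized so that its Mellin transform at \<open>s\<close> is \<open>Gamma_C (\<alpha> + s / 2)\<close>.\<close>

definition gker :: "complex \<Rightarrow> real \<Rightarrow> complex" where
  "gker \<alpha> x = 4 * complex_of_real x powr (2 * \<alpha>) * complex_of_real (exp (- 2 * pi * x\<^sup>2))"

lemma gker_measurable [measurable]: "gker \<alpha> \<in> borel_measurable borel"
  unfolding gker_def by measurable

lemma gker_exp:
  "gker \<alpha> (exp u) * exp (s * of_real u) =
     4 * exp ((2 * \<alpha> + s) * of_real u - of_real (2 * pi * exp (2 * u)))"
proof -
  have "(exp u)\<^sup>2 = exp (2 * u)" by (simp add: power2_eq_square flip: exp_add)
  then have "gker \<alpha> (exp u) = 4 * exp (2 * \<alpha> * of_real u) * complex_of_real (exp (- 2 * pi * exp (2 * u)))"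
    by (simp only: gker_def powr_exp)
  also have "complex_of_real (exp (- 2 * pi * exp (2 * u))) = exp (- of_real (2 * pi * exp (2 * u)))"
    by (simp flip: exp_of_real)
  finally show ?thesis
    by (simp only: mult.assoc flip: exp_add) (simp add: algebra_simps)
qed

text \<open>The substitution u -> ln (2 pi) + 2 u turns exp (- exp u) into the Gaussian of
  \<open>gker\<close>. Its Jacobian 2, set against the 4 in \<open>gker\<close>, leaves the factor 2
  of \<open>Gamma_C\<close>.\<close>

lemma gker_log_integral:
  assumes "Re \<alpha> + Re s / 2 > 0"
  shows "integrable lborel (\<lambda>u. gker \<alpha> (exp u) * exp (s * of_real u))" (is ?A)
    and "(LINT u|lborel. gker \<alpha> (exp u) * exp (s * of_real u)) = Gamma_C (\<alpha> + s / 2)" (is ?B)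
proof -
  define z where "z = \<alpha> + s / 2"
  have z: "Re z > 0" using assms by (simp add: z_def)
  let ?f = "\<lambda>u::real. exp (z * of_real u - of_real (exp u))"
  have eq: "?f (ln (2 * pi) + 2 * u) = complex_of_real (2 * pi) powr z / 4 *
      (gker \<alpha> (exp u) * exp (s * of_real u))" for u
  proof -
    have "exp (ln (2 * pi) + 2 * u) = 2 * pi * exp (2 * u)" by (simp add: exp_add)
    moreover have "complex_of_real (2 * pi) powr z = exp (z * of_real (ln (2 * pi)))"
      by (simp add: powr_def flip: Ln_of_real)
    ultimately show ?thesis
      unfolding gker_exp by (simp add: z_def algebra_simps exp_add exp_diff)
  qed
  have nz: "complex_of_real (2 * pi) powr z \<noteq> 0" by simp
  have "integrable lborel (\<lambda>u. ?f (ln (2 * pi) + 2 * u))"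
    using log_Gamma_integral(1)[OF z] by (rule lborel_integrable_real_affine) simp
  then have "integrable lborel (\<lambda>u. 4 / complex_of_real (2 * pi) powr z *
      (complex_of_real (2 * pi) powr z / 4 * (gker \<alpha> (exp u) * exp (s * of_real u))))"
    unfolding eq by (rule integrable_mult_right)
  moreover have "4 / complex_of_real (2 * pi) powr z * (complex_of_real (2 * pi) powr z / 4 * w) = w" for w
    using nz by (simp add: field_simps)
  ultimately show ?A by simp
  have "Gamma z = 2 * (LINT u|lborel. ?f (ln (2 * pi) + 2 * u))"
    using lborel_integral_real_affine[of 2 ?f "ln (2 * pi)"] log_Gamma_integral(2)[OF z]
    by (simp add: scaleR_conv_of_real)
  also have "\<dots> = complex_of_real (2 * pi) powr z / 2 * (LINT u|lborel. gker \<alpha> (exp u) * exp (s * of_real u))"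
    unfolding eq by simp
  finally have "Gamma_C z = (LINT u|lborel. gker \<alpha> (exp u) * exp (s * of_real u))"
    using nz by (simp add: Gamma_C_def powr_minus field_simps)
  then show ?B by (simp add: z_def)
qed

lemma mellin_gker:
  assumes "Re \<alpha> + Re s / 2 > 0"
  shows "integrable mult_haar (\<lambda>x. gker \<alpha> x * complex_of_real x powr s)"
    and "(LINT x|mult_haar. gker \<alpha> x * complex_of_real x powr s) = Gamma_C (\<alpha> + s / 2)"
  by (simp_all add: integrable_mult_haar_iff integral_mult_haar powr_exp gker_log_integral[OF assms])

lemma Gamma_measurable [measurable]: "Gamma \<in> borel_measurable (borel :: complex measure)"
proof -
  have [measurable]: "rGamma \<in> borel_measurable (borel :: complex measure)"
    by (intro borel_measurable_continuous_onI continuous_on_rGamma)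
  have "(\<lambda>z::complex. inverse (rGamma z)) \<in> borel_measurable borel" by measurable
  then show ?thesis by (simp add: rGamma_inverse_Gamma)
qed

lemma Gamma_C_measurable [measurable]: "Gamma_C \<in> borel_measurable borel"
proof -
  have "Gamma_C = (\<lambda>s. 2 * complex_of_real (2 * pi) powr (- s) * Gamma s)"
    by (simp add: Gamma_C_def fun_eq_iff)
  then show ?thesis by (rule ssubst) measurable
qed

text \<open>Euler's integral bounds Gamma (s + 2) on the line by its value at the real part; using
  Gamma (s + 1) = s Gamma s twice then gives decay of order 1 / (1 + y^2) for Gamma s.\<close>

lemma integrable_Gamma_vertical:
  assumes "p > 0"
  shows "integrable lborel (\<lambda>y. Gamma (Complex p y))"
proof -
  define C where "C = (LINT u|lborel. exp ((p + 2) * u - exp u))"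
  have bd: "norm (Gamma (Complex p y)) \<le> C * max 1 (1 / p\<^sup>2) * inverse (1 + y\<^sup>2)" for y
  proof -
    let ?s = "Complex p y"
    have s0: "?s \<noteq> 0" "?s + 1 \<noteq> 0" using assms by (auto simp: complex_eq_iff)
    have nn: "?s \<notin> \<int>\<^sub>\<le>\<^sub>0" "?s + 1 \<notin> \<int>\<^sub>\<le>\<^sub>0" using assms by (auto elim!: nonpos_Ints_cases simp: complex_eq_iff)
    have "Gamma (?s + 1 + 1) = (?s + 1) * (?s * Gamma ?s)"
      by (simp only: Gamma_plus1[OF nn(1)] Gamma_plus1[OF nn(2)])
    then have G: "norm (Gamma (?s + 1 + 1)) = norm (?s + 1) * (norm ?s * norm (Gamma ?s))"
      by (simp add: norm_mult)
    have "norm (Gamma (?s + 1 + 1)) = norm (LINT u|lborel. exp ((?s + 1 + 1) * of_real u - of_real (exp u)))"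
      by (subst log_Gamma_integral(2)) (use assms in auto)
    also have "\<dots> \<le> (LINT u|lborel. norm (exp ((?s + 1 + 1) * of_real u - of_real (exp u))))"
      by (rule integral_norm_bound)
    also have "\<dots> = C" unfolding C_def by (simp add: algebra_simps)
    finally have le: "norm (?s + 1) * (norm ?s * norm (Gamma ?s)) \<le> C" using G by simp
    have n1: "(norm ?s)\<^sup>2 = p\<^sup>2 + y\<^sup>2" by (simp add: cmod_def)
    have "norm ?s \<le> norm (?s + 1)" using assms by (auto simp: cmod_def power2_eq_square algebra_simps)
    then have "(norm ?s)\<^sup>2 * norm (Gamma ?s) \<le> norm (?s + 1) * (norm ?s * norm (Gamma ?s))"
      unfolding power2_eq_square mult.assoc by (intro mult_right_mono) auto
    with le n1 have A: "(p\<^sup>2 + y\<^sup>2) * norm (Gamma ?s) \<le> C" by simp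
    have C0: "C \<ge> 0" using A by (smt (verit) mult_nonneg_nonneg norm_ge_zero zero_le_power2)
    have pp: "p\<^sup>2 + y\<^sup>2 > 0" using assms by (simp add: add_pos_nonneg)
    have "1 + y\<^sup>2 \<le> max 1 (1 / p\<^sup>2) * (p\<^sup>2 + y\<^sup>2)"
    proof -
      have "1 \<le> max 1 (1 / p\<^sup>2) * p\<^sup>2" using assms by (auto simp: max_def field_simps)
      moreover have "1 * y\<^sup>2 \<le> max 1 (1 / p\<^sup>2) * y\<^sup>2" by (rule mult_right_mono) auto
      ultimately show ?thesis by (simp add: distrib_left)
    qed
    then have "inverse (p\<^sup>2 + y\<^sup>2) \<le> max 1 (1 / p\<^sup>2) * inverse (1 + y\<^sup>2)"
      using pp by (simp add: field_simps add_pos_nonneg)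
    moreover have "norm (Gamma ?s) \<le> C * inverse (p\<^sup>2 + y\<^sup>2)" using A pp by (simp add: field_simps)
    ultimately show ?thesis
      using mult_left_mono[OF _ C0] by (smt (verit) mult.assoc)
  qed
  have "integrable lborel (\<lambda>y::real. inverse (1 + y\<^sup>2))"
    using integrable_inverse_1_plus_square by (simp add: set_integrable_def)
  then have "integrable lborel (\<lambda>y::real. C * max 1 (1 / p\<^sup>2) * inverse (1 + y\<^sup>2))" by simp
  then show ?thesis
    by (rule Bochner_Integration.integrable_bound) (use bd in \<open>auto intro!: AE_I2 order.trans[OF bd]\<close>)
qed

lemma Gamma_C_vertical_integrable:
  assumes "Re \<alpha> + \<sigma> / 2 > 0"
  shows "integrable lborel (\<lambda>y. Gamma_C (\<alpha> + Complex \<sigma> y / 2))"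
proof -
  let ?p = "Re \<alpha> + \<sigma> / 2"
  have "integrable lborel (\<lambda>y. Gamma (Complex ?p (Im \<alpha> + (1/2) * y)))"
    using integrable_Gamma_vertical[OF assms] by (rule lborel_integrable_real_affine) simp
  also have "(\<lambda>y. Complex ?p (Im \<alpha> + (1/2) * y)) = (\<lambda>y. \<alpha> + Complex \<sigma> y / 2)"
    by (auto simp: complex_eq_iff)
  finally have "integrable lborel (\<lambda>y. 2 * (2 * pi) powr (- ?p) * norm (Gamma (\<alpha> + Complex \<sigma> y / 2)))"
    by (intro integrable_mult_right integrable_norm) (simp add: fun_eq_iff o_def)
  then show ?thesis
  proof (rule Bochner_Integration.integrable_bound)
    show "(\<lambda>y. Gamma_C (\<alpha> + Complex \<sigma> y / 2)) \<in> borel_measurable lborel" by measurable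
  qed (auto simp: Gamma_C_def norm_mult norm_powr_real_powr)
qed

lemma (in pair_sigma_finite) integrable_prod_mult:
  fixes f :: "'a \<Rightarrow> 'c::{real_normed_field, banach, second_countable_topology}"
  assumes f: "integrable M1 f" and g: "integrable M2 g"
  shows "integrable (M1 \<Otimes>\<^sub>M M2) (\<lambda>(x, y). f x * g y)"
proof (rule Fubini_integrable)
  have [measurable]: "f \<in> borel_measurable M1" "g \<in> borel_measurable M2" using f g by auto
  show "(\<lambda>(x, y). f x * g y) \<in> borel_measurable (M1 \<Otimes>\<^sub>M M2)" by measurable
  have "integrable M1 (\<lambda>x. norm (f x) * (LINT y|M2. norm (g y)))" using f by auto
  then show "integrable M1 (\<lambda>x. LINT y|M2. norm (case (x, y) of (x, y) \<Rightarrow> f x * g y))"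
    by (simp add: norm_mult)
qed (use g in auto)

section \<open>Fourier inversion and Mellin inversion in one variable\<close>

lemma gaussian_fourier:
  assumes "\<epsilon> > (0::real)"
  shows "integrable lborel (\<lambda>y. complex_of_real (exp (- (\<epsilon> * y)\<^sup>2 / 2)))"
    and "(LINT y|lborel. complex_of_real (exp (- (\<epsilon> * y)\<^sup>2 / 2)) * cis (y * t)) =
      complex_of_real (sqrt (2 * pi) / \<epsilon> * exp (- (t / \<epsilon>)\<^sup>2 / 2))"
proof -
  have int: "integrable lborel (\<lambda>y. sqrt (2 * pi) * std_normal_density (0 + \<epsilon> * y))"
    using assms by (intro integrable_mult_right lborel_integrable_real_affine) auto
  have eq: "sqrt (2 * pi) * std_normal_density y = exp (- y\<^sup>2 / 2)" for y
    by (simp add: std_normal_density_def)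
  show "integrable lborel (\<lambda>y. complex_of_real (exp (- (\<epsilon> * y)\<^sup>2 / 2)))"
    using int unfolding eq by (simp add: eq)
  have "complex_of_real (exp (- (t / \<epsilon>)\<^sup>2 / 2)) = char std_normal_distribution (t / \<epsilon>)"
    by (simp add: char_std_normal_distribution)
  also have "\<dots> = (LINT y|lborel. of_real (std_normal_density y) * iexp (t / \<epsilon> * y))"
    unfolding char_def
    by (subst integral_density) (auto simp: scaleR_conv_of_real)
  also have "\<dots> = \<epsilon> * (LINT y|lborel. of_real (std_normal_density (0 + \<epsilon> * y)) * iexp (t / \<epsilon> * (0 + \<epsilon> * y)))"
    using lborel_integral_real_affine[of \<epsilon> "\<lambda>y. of_real (std_normal_density y) * iexp (t / \<epsilon> * y)" 0] assms
    by (simp add: scaleR_conv_of_real)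
  also have "(\<lambda>y. complex_of_real (std_normal_density (0 + \<epsilon> * y)) * iexp (t / \<epsilon> * (0 + \<epsilon> * y))) =
      (\<lambda>y. of_real (1 / sqrt (2 * pi)) * (complex_of_real (exp (- (\<epsilon> * y)\<^sup>2 / 2)) * cis (y * t)))"
    using assms by (auto simp: std_normal_density_def cis_conv_exp field_simps)
  finally show "(LINT y|lborel. complex_of_real (exp (- (\<epsilon> * y)\<^sup>2 / 2)) * cis (y * t)) =
      complex_of_real (sqrt (2 * pi) / \<epsilon> * exp (- (t / \<epsilon>)\<^sup>2 / 2))"
    using assms by (simp add: field_simps)
qed

text \<open>A Gaussian cutoff exp (- (epsilon y)^2 / 2) makes Fubini applicable and turns the left
  side into an average of \<open>h\<close> over a Gaussian of width epsilon around \<open>x\<close>;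
  then epsilon tends to 0. Integrability of \<open>F\<close> and the bound on \<open>h\<close>
  provide the two dominating functions.\<close>

lemma fourier_inversion:
  fixes h :: "real \<Rightarrow> complex"
  assumes int: "integrable lborel h"
    and bd: "\<And>u. norm (h u) \<le> B"
    and cont: "isCont h x"
    and F: "\<And>y. F y = (LINT u|lborel. h u * cis (y * u))"
    and intF: "integrable lborel F"
  shows "(LINT y|lborel. F y * cis (- (y * x))) = 2 * pi * h x"
proof -
  define \<epsilon> :: "nat \<Rightarrow> real" where "\<epsilon> k = 1 / real (Suc k)" for k
  have \<epsilon>: "\<epsilon> k > 0" for k by (simp add: \<epsilon>_def)
  have \<epsilon>0: "\<epsilon> \<longlonglongrightarrow> 0" unfolding \<epsilon>_def by (rule lim_1_over_n[THEN LIMSEQ_Suc])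
  have [measurable]: "h \<in> borel_measurable borel" "F \<in> borel_measurable borel"
    using int intF by auto
  have [measurable]: "cis \<in> borel_measurable borel"
    by (intro borel_measurable_continuous_onI) (simp add: continuous_intros)
  let ?G = "\<lambda>k y. complex_of_real (exp (- (\<epsilon> k * y)\<^sup>2 / 2))"
  have A: "(LINT y|lborel. F y * cis (- (y * x)) * ?G k y) =
      sqrt (2 * pi) * (LINT w|lborel. h (x + \<epsilon> k * w) * complex_of_real (exp (- w\<^sup>2 / 2)))" for k
  proof -
    have int2: "integrable (lborel \<Otimes>\<^sub>M lborel) (\<lambda>(y, u). ?G k y * cis (y * (u - x)) * h u)"
    proof -
      have "integrable (lborel \<Otimes>\<^sub>M lborel) (\<lambda>(y, u). ?G k y * h u)"
        using lborel_pair.integrable_prod_mult[OF gaussian_fourier(1)[OF \<epsilon>] int] by simp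
      then show ?thesis
        by (rule Bochner_Integration.integrable_bound) (auto simp: norm_mult)
    qed
    have "(LINT y|lborel. F y * cis (- (y * x)) * ?G k y) =
        (LINT y|lborel. (LINT u|lborel. ?G k y * cis (y * (u - x)) * h u))"
    proof (rule Bochner_Integration.integral_cong[OF refl])
      fix y :: real
      have "F y * cis (- (y * x)) * ?G k y = (LINT u|lborel. (h u * cis (y * u)) * (cis (- (y * x)) * ?G k y))"
        unfolding F integral_mult_left_zero by (simp only: mult.assoc)
      also have "\<dots> = (LINT u|lborel. ?G k y * cis (y * (u - x)) * h u)"
        by (rule Bochner_Integration.integral_cong[OF refl])
          (simp add: algebra_simps cis_mult)
      finally show "F y * cis (- (y * x)) * ?G k y = (LINT u|lborel. ?G k y * cis (y * (u - x)) * h u)" .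
    qed
    also have "\<dots> = (LINT u|lborel. (LINT y|lborel. ?G k y * cis (y * (u - x)) * h u))"
      using int2 by (rule lborel_pair.Fubini_integral[symmetric])
    also have "\<dots> = (LINT u|lborel. complex_of_real (sqrt (2 * pi) / \<epsilon> k * exp (- ((u - x) / \<epsilon> k)\<^sup>2 / 2)) * h u)"
      by (subst integral_mult_left_zero) (simp only: gaussian_fourier(2)[OF \<epsilon>])
    also have "\<dots> = \<epsilon> k * (LINT w|lborel. complex_of_real (sqrt (2 * pi) / \<epsilon> k *
        exp (- ((x + \<epsilon> k * w - x) / \<epsilon> k)\<^sup>2 / 2)) * h (x + \<epsilon> k * w))"
      by (subst lborel_integral_real_affine[of "\<epsilon> k" _ x]) (use \<epsilon>[of k] in \<open>auto simp: scaleR_conv_of_real\<close>)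
    also have "(\<lambda>w. complex_of_real (sqrt (2 * pi) / \<epsilon> k *
        exp (- ((x + \<epsilon> k * w - x) / \<epsilon> k)\<^sup>2 / 2)) * h (x + \<epsilon> k * w)) =
        (\<lambda>w. complex_of_real (sqrt (2 * pi) / \<epsilon> k) * (h (x + \<epsilon> k * w) * complex_of_real (exp (- w\<^sup>2 / 2))))"
      using \<epsilon>[of k] by (auto simp: fun_eq_iff)
    finally show ?thesis using \<epsilon>[of k] by simp
  qed
  have lim1: "(\<lambda>k. LINT y|lborel. F y * cis (- (y * x)) * ?G k y) \<longlonglongrightarrow> (LINT y|lborel. F y * cis (- (y * x)))"
  proof (rule integral_dominated_convergence[where w="\<lambda>y. norm (F y)"])
    have "(\<lambda>k. F y * cis (- (y * x)) * ?G k y) \<longlonglongrightarrow> F y * cis (- (y * x)) * complex_of_real (exp (- (0 * y)\<^sup>2 / 2))" for y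
      by (intro tendsto_intros \<epsilon>0) simp
    then show "AE y in lborel. (\<lambda>k. F y * cis (- (y * x)) * ?G k y) \<longlonglongrightarrow> F y * cis (- (y * x))"
      by simp
  qed (use intF in \<open>auto simp: norm_mult mult_left_le\<close>)
  have lim2: "(\<lambda>k. LINT w|lborel. h (x + \<epsilon> k * w) * complex_of_real (exp (- w\<^sup>2 / 2)))
      \<longlonglongrightarrow> (LINT w|lborel. h x * complex_of_real (exp (- w\<^sup>2 / 2)))"
  proof (rule integral_dominated_convergence[where w="\<lambda>w. B * exp (- w\<^sup>2 / 2)"])
    have "(\<lambda>k. h (x + \<epsilon> k * w)) \<longlonglongrightarrow> h x" for w
    proof (rule isCont_tendsto_compose[OF cont])
      have "(\<lambda>k. x + \<epsilon> k * w) \<longlonglongrightarrow> x + 0 * w" by (intro tendsto_intros \<epsilon>0)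
      then show "(\<lambda>k. x + \<epsilon> k * w) \<longlonglongrightarrow> x" by simp
    qed
    then show "AE w in lborel. (\<lambda>k. h (x + \<epsilon> k * w) * complex_of_real (exp (- w\<^sup>2 / 2)))
        \<longlonglongrightarrow> h x * complex_of_real (exp (- w\<^sup>2 / 2))"
      by (intro AE_I2 tendsto_intros)
    have "integrable lborel (\<lambda>w. complex_of_real (exp (- w\<^sup>2 / 2)))"
      using gaussian_fourier(1)[of 1] by simp
    then have "integrable lborel (\<lambda>w. Re (complex_of_real (exp (- w\<^sup>2 / 2))))"
      by (rule integrable_Re)
    then show "integrable lborel (\<lambda>w. B * exp (- w\<^sup>2 / 2))" by simp
  qed (auto simp: norm_mult intro!: mult_right_mono bd)
  have "(LINT w|lborel. complex_of_real (exp (- w\<^sup>2 / 2))) = sqrt (2 * pi)"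
    using gaussian_fourier(2)[of 1 0] by simp
  then have "(\<lambda>k. LINT y|lborel. F y * cis (- (y * x)) * ?G k y) \<longlonglongrightarrow> sqrt (2 * pi) * (h x * sqrt (2 * pi))"
    unfolding A using lim2 by (intro tendsto_intros) simp
  with lim1 have "(LINT y|lborel. F y * cis (- (y * x))) = sqrt (2 * pi) * (h x * sqrt (2 * pi))"
    by (rule LIMSEQ_unique)
  also have "\<dots> = 2 * pi * h x"
    by (simp add: mult_ac flip: of_real_mult)
  finally show ?thesis .
qed

text \<open>A shift in the argument of \<open>Gamma_C\<close> becomes a power of the variable. In
  this way a neighbouring contour variable survives an inversion as a phase.\<close>

lemma gker_shift: "gker (\<alpha> - z / 2) x = gker \<alpha> x * complex_of_real x powr (- z)"
proof -
  have "2 * (\<alpha> - z / 2) = 2 * \<alpha> + (- z)" by (simp add: right_diff_distrib)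
  then show ?thesis by (simp only: gker_def powr_add mult_ac)
qed

lemma of_real_powr_divide:
  assumes "x > 0" "y > 0"
  shows "complex_of_real (x / y) powr z = complex_of_real x powr z / complex_of_real y powr z"
proof -
  have "Ln (complex_of_real (x / y)) = of_real (ln x) - of_real (ln y)"
    using assms by (subst Ln_of_real) (auto simp: ln_div)
  then show ?thesis using assms by (simp add: powr_def Ln_of_real right_diff_distrib exp_diff)
qed

lemma of_real_powr_mult:
  assumes "x > 0" "y > 0"
  shows "complex_of_real (x * y) powr z = complex_of_real x powr z * complex_of_real y powr z"
proof -
  have "Ln (complex_of_real (x * y)) = of_real (ln x) + of_real (ln y)"
    using assms by (subst Ln_of_real) (auto simp: ln_mult)
  then show ?thesis using assms by (simp add: powr_def Ln_of_real distrib_left exp_add)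
qed

lemma norm_gker_exp:
  "norm (gker \<alpha> (exp u) * exp (s * of_real u)) = 4 * exp ((2 * Re \<alpha> + Re s) * u - 2 * pi * exp (2 * u))"
  unfolding gker_exp by (simp add: norm_mult algebra_simps)

lemma gker_bounded:
  assumes "Re \<alpha> + Re s / 2 > 0"
  obtains B where "\<And>u. norm (gker \<alpha> (exp u) * exp (s * of_real u)) \<le> B"
proof -
  define p where "p = 2 * Re \<alpha> + Re s"
  have p: "p > 0" using assms by (simp add: p_def)
  \<comment> \<open>The exponent p u - 2 pi exp (2 u) is maximal at 2 u = c; the tangent of exp at
    this point gives the bound.\<close>
  define c where "c = ln (p / (4 * pi))"
  have "p * u - 2 * pi * exp (2 * u) \<le> - (p / 2) * (1 - c)" for u
  proof -
    have "1 + (2 * u - c) \<le> exp (2 * u - c)" by (rule exp_ge_add_one_self)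
    then have "(p / 2) * (1 + (2 * u - c)) \<le> (p / 2) * exp (2 * u - c)" using p by simp
    also have "\<dots> = 2 * pi * exp (2 * u)"
      using p by (simp add: exp_diff c_def)
    finally show ?thesis by (simp add: field_simps)
  qed
  then have "norm (gker \<alpha> (exp u) * exp (s * of_real u)) \<le> 4 * exp (- (p / 2) * (1 - c))" for u
    unfolding norm_gker_exp p_def[symmetric] by simp
  then show ?thesis using that by blast
qed

text \<open>The weight exp (sigma u) moves the contour to Re s = sigma; what remains is Fourier
  inversion at u = ln x.\<close>

lemma mellin_inversion_gker:
  assumes x: "x > 0" and pos: "Re \<alpha> + \<sigma> / 2 > 0"
  shows "(LINT y|lborel. complex_of_real x powr (- Complex \<sigma> y) * Gamma_C (\<alpha> + Complex \<sigma> y / 2)) =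
    2 * pi * gker \<alpha> x"
proof -
  let ?h = "\<lambda>u. gker \<alpha> (exp u) * exp (of_real \<sigma> * of_real u)"
  let ?F = "\<lambda>y. Gamma_C (\<alpha> + Complex \<sigma> y / 2)"
  obtain B where B: "\<And>u. norm (?h u) \<le> B"
    using gker_bounded[of \<alpha> "of_real \<sigma>"] pos by auto
  have "(LINT y|lborel. ?F y * cis (- (y * ln x))) = 2 * pi * ?h (ln x)"
  proof (rule fourier_inversion)
    show "integrable lborel ?h" by (rule gker_log_integral(1)) (use pos in simp)
    show "norm (?h u) \<le> B" for u by (rule B)
    show "isCont ?h (ln x)"
      unfolding gker_exp by (intro continuous_intros)
    have eq: "?h u * cis (y * u) = gker \<alpha> (exp u) * exp (Complex \<sigma> y * of_real u)" for u y
    proof -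
      have "exp (of_real \<sigma> * of_real u) * cis (y * u) = exp (Complex \<sigma> y * of_real u)"
        by (simp add: cis_conv_exp Complex_eq algebra_simps flip: exp_add)
      then show ?thesis by simp
    qed
    show "?F y = (LINT u|lborel. ?h u * cis (y * u))" for y
      unfolding eq by (rule gker_log_integral(2)[symmetric]) (use pos in simp)
    show "integrable lborel ?F" by (rule Gamma_C_vertical_integrable[OF pos])
  qed
  moreover have "complex_of_real x powr (- Complex \<sigma> y) = exp (- of_real \<sigma> * of_real (ln x)) * cis (- (y * ln x))" for y
    using x by (simp add: powr_def Ln_of_real cis_conv_exp Complex_eq algebra_simps flip: exp_add)
  then have "(LINT y|lborel. complex_of_real x powr (- Complex \<sigma> y) * ?F y) =
      exp (- of_real \<sigma> * of_real (ln x)) * (LINT y|lborel. ?F y * cis (- (y * ln x)))"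
    by (simp only: mult.assoc integral_mult_right_zero) (simp only: mult.commute)
  ultimately show ?thesis using x by (simp add: exp_minus)
qed

text \<open>In the Mellin integral for \<open>Gamma_C w\<close> the absolute value of the integrand
  depends on Re w only.\<close>

lemma Gamma_C_bounded:
  assumes "p > 0"
  obtains B where "\<And>w. Re w = p \<Longrightarrow> norm (Gamma_C w) \<le> B"
proof -
  define B where "B = (LINT u|lborel. 4 * exp (2 * p * u - 2 * pi * exp (2 * u)))"
  have "norm (Gamma_C w) \<le> B" if "Re w = p" for w
  proof -
    have "norm (Gamma_C w) = norm (LINT u|lborel. gker w (exp u) * exp (0 * of_real u))"
      by (subst gker_log_integral(2)) (use that assms in auto)
    also have "\<dots> \<le> (LINT u|lborel. norm (gker w (exp u) * exp (0 * of_real u)))"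
      by (rule integral_norm_bound)
    also have "\<dots> = B" unfolding norm_gker_exp B_def using that by simp
    finally show ?thesis .
  qed
  then show ?thesis using that by blast
qed

section \<open>Barnes integrals in one variable\<close>

text \<open>The integral over a single s_j. Its Gamma factors couple it only to the neighbours z' =
  z_(j-1) and z = z_j, so the inner integral of the theorem is a product of such functions.\<close>

definition barnes :: "real \<Rightarrow> complex \<Rightarrow> complex \<Rightarrow> real \<Rightarrow> complex \<Rightarrow> complex \<Rightarrow> complex" where
  "barnes a \<alpha> \<beta> d z' z = (LINT y|lborel. complex_of_real a powr (- Complex d y) *
     Gamma_C (\<alpha> + (Complex d y - z') / 2) * Gamma_C (\<beta> + (Complex d y - z) / 2)) / (2 * pi)"

lemma norm_of_real_powr: "x > 0 \<Longrightarrow> norm (complex_of_real x powr z) = x powr Re z"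
  by (simp add: norm_powr_real_powr)

lemma Gamma_C_shift: "\<alpha> + (s - z') / 2 = (\<alpha> - z' / 2) + s / (2 :: complex)"
  by (simp add: field_simps)

lemma Gamma_C_shift_integrable:
  assumes "Re \<alpha> + (d - Re z') / 2 > 0"
  shows "integrable lborel (\<lambda>y. Gamma_C (\<alpha> + (Complex d y - z') / 2))"
  unfolding Gamma_C_shift by (rule Gamma_C_vertical_integrable) (use assms in \<open>simp add: field_simps\<close>)

context
  fixes a d :: real and \<alpha> \<beta> z' :: complex
  assumes a: "a > 0" and pos: "Re \<alpha> + (d - Re z') / 2 > 0"
begin

text \<open>On the line one Gamma factor is bounded and the other is integrable.\<close>

lemma barnes_integrand_integrable:
  assumes pos2: "Re \<beta> + (d - Re z) / 2 > 0"
  shows "integrable lborel (\<lambda>y. complex_of_real a powr (- Complex d y) *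
     Gamma_C (\<alpha> + (Complex d y - z') / 2) * Gamma_C (\<beta> + (Complex d y - z) / 2))"
proof -
  obtain B where B: "\<And>w. Re w = Re \<beta> + (d - Re z) / 2 \<Longrightarrow> norm (Gamma_C w) \<le> B"
    using Gamma_C_bounded[OF pos2] by blast
  have "integrable lborel (\<lambda>y. (a powr (- d) * B) * norm (Gamma_C (\<alpha> + (Complex d y - z') / 2)))"
    using Gamma_C_shift_integrable[OF pos] by auto
  then show ?thesis
  proof (rule Bochner_Integration.integrable_bound)
    show "AE y in lborel. norm (complex_of_real a powr (- Complex d y) *
        Gamma_C (\<alpha> + (Complex d y - z') / 2) * Gamma_C (\<beta> + (Complex d y - z) / 2))
       \<le> norm ((a powr (- d) * B) * norm (Gamma_C (\<alpha> + (Complex d y - z') / 2)))"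
    proof (intro AE_I2)
      fix y
      have "norm (Gamma_C (\<beta> + (Complex d y - z) / 2)) \<le> B" by (rule B) simp
      then have "norm (Gamma_C (\<beta> + (Complex d y - z) / 2)) \<le> \<bar>B\<bar>" by linarith
      then show "norm (complex_of_real a powr (- Complex d y) *
        Gamma_C (\<alpha> + (Complex d y - z') / 2) * Gamma_C (\<beta> + (Complex d y - z) / 2))
       \<le> norm ((a powr (- d) * B) * norm (Gamma_C (\<alpha> + (Complex d y - z') / 2)))"
        using a by (simp add: norm_mult norm_of_real_powr abs_mult) (subst mult.commute, rule mult_right_mono, auto)
    qed
  qed measurable
qed

text \<open>For fixed s, the difference s - z runs over a vertical line as z does. The z-integral
  therefore inverts the second Gamma factor, giving \<open>gker \<beta> x\<close> times x powr s,
  and the s-integral then inverts the first one at a / x. Exchanging the order for absolute values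
  gives the norm bound.\<close>

lemma barnes_step:
  fixes c x :: real
  assumes pos2: "Re \<beta> + (d - c) / 2 > 0" and x: "x > 0"
  shows "integrable lborel (\<lambda>y. barnes a \<alpha> \<beta> d z' (Complex c y))" (is ?A)
    and "(LINT y|lborel. norm (barnes a \<alpha> \<beta> d z' (Complex c y))) \<le>
      a powr (- d) / (2 * pi) * (LINT y|lborel. norm (Gamma_C (\<alpha> + (Complex d y - z') / 2))) *
      (LINT y|lborel. norm (Gamma_C (\<beta> + Complex (d - c) y / 2)))" (is ?B)
    and "(LINT y|lborel. complex_of_real x powr Complex c y * barnes a \<alpha> \<beta> d z' (Complex c y)) =
      2 * pi * (gker \<beta> x * gker \<alpha> (a / x) * complex_of_real (a / x) powr (- z'))" (is ?C)
proof -
  let ?G = "\<lambda>\<eta> y. complex_of_real a powr (- Complex d \<eta>) *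
     Gamma_C (\<alpha> + (Complex d \<eta> - z') / 2) * Gamma_C (\<beta> + (Complex d \<eta> - Complex c y) / 2)"
  have sub: "Complex d \<eta> - Complex c y = Complex (d - c) (\<eta> + (-1) * y)" for \<eta> y
    by (simp add: complex_eq_iff)
  have pos2': "Re \<beta> + (d - c) / 2 > 0" using pos2 by simp
  note int2 = Gamma_C_vertical_integrable[OF pos2']
  define N1 N2 where "N1 = (LINT y|lborel. norm (Gamma_C (\<alpha> + (Complex d y - z') / 2)))"
    and "N2 = (LINT y|lborel. norm (Gamma_C (\<beta> + Complex (d - c) y / 2)))"
  have intN2: "integrable lborel (\<lambda>y. norm (Gamma_C (\<beta> + (Complex d \<eta> - Complex c y) / 2)))" for \<eta>
    unfolding sub
    by (rule lborel_integrable_real_affine[where f="\<lambda>y. norm (Gamma_C (\<beta> + Complex (d - c) y / 2))"])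
      (use int2 in auto)
  have N2': "(LINT y|lborel. norm (Gamma_C (\<beta> + (Complex d \<eta> - Complex c y) / 2))) = N2" for \<eta>
    unfolding sub N2_def
    using lborel_integral_real_affine[of "-1" "\<lambda>y. norm (Gamma_C (\<beta> + Complex (d - c) y / 2))" \<eta>]
    by simp
  have normG: "norm (?G \<eta> y) = a powr (- d) * norm (Gamma_C (\<alpha> + (Complex d \<eta> - z') / 2)) *
      norm (Gamma_C (\<beta> + (Complex d \<eta> - Complex c y) / 2))" for \<eta> y
    using a by (simp add: norm_mult norm_of_real_powr)
  have innerN: "(LINT y|lborel. norm (?G \<eta> y)) =
      a powr (- d) * norm (Gamma_C (\<alpha> + (Complex d \<eta> - z') / 2)) * N2" for \<eta>
    unfolding normG integral_mult_right_zero N2' ..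
  have intG: "integrable (lborel \<Otimes>\<^sub>M lborel) (\<lambda>(\<eta>, y). ?G \<eta> y)"
  proof (rule lborel_pair.Fubini_integrable)
    show "(\<lambda>(\<eta>, y). ?G \<eta> y) \<in> borel_measurable (lborel \<Otimes>\<^sub>M lborel)" by measurable
    show "integrable lborel (\<lambda>\<eta>. LINT y|lborel. norm (case (\<eta>, y) of (\<eta>, y) \<Rightarrow> ?G \<eta> y))"
      unfolding prod.case innerN using Gamma_C_shift_integrable[OF pos] by auto
    have "integrable lborel (?G \<eta>)" for \<eta>
    proof (rule Bochner_Integration.integrable_bound)
      show "integrable lborel (\<lambda>y. norm (?G \<eta> y))" unfolding normG using intN2 by auto
    qed auto
    then show "AE \<eta> in lborel. integrable lborel (\<lambda>y. case (\<eta>, y) of (\<eta>, y) \<Rightarrow> ?G \<eta> y)" by simp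
  qed
  have "integrable lborel (\<lambda>y. LINT \<eta>|lborel. ?G \<eta> y)"
    using intG by (rule lborel_pair.integrable_snd)
  then show ?A unfolding barnes_def by simp
  have "integrable (lborel \<Otimes>\<^sub>M lborel) (\<lambda>(\<eta>, y). norm (?G \<eta> y))"
    using integrable_norm[OF intG] by (simp add: case_prod_unfold)
  note intnorm = this
  have "(LINT y|lborel. norm (barnes a \<alpha> \<beta> d z' (Complex c y))) \<le>
      (LINT y|lborel. (LINT \<eta>|lborel. norm (?G \<eta> y)) / (2 * pi))"
  proof (rule integral_mono)
    show "integrable lborel (\<lambda>y. norm (barnes a \<alpha> \<beta> d z' (Complex c y)))" using \<open>?A\<close> by auto
    have "integrable lborel (\<lambda>y. LINT \<eta>|lborel. norm (?G \<eta> y))"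
      using intnorm by (rule lborel_pair.integrable_snd)
    then show "integrable lborel (\<lambda>y. (LINT \<eta>|lborel. norm (?G \<eta> y)) / (2 * pi))" by simp
    show "norm (barnes a \<alpha> \<beta> d z' (Complex c y)) \<le> (LINT \<eta>|lborel. norm (?G \<eta> y)) / (2 * pi)" for y
      unfolding barnes_def norm_divide by (simp add: divide_right_mono integral_norm_bound)
  qed
  also have "\<dots> = (LINT y|lborel. (LINT \<eta>|lborel. norm (?G \<eta> y))) / (2 * pi)" by simp
  also have "(LINT y|lborel. (LINT \<eta>|lborel. norm (?G \<eta> y))) = (LINT \<eta>|lborel. (LINT y|lborel. norm (?G \<eta> y)))"
    using intnorm by (rule lborel_pair.Fubini_integral)
  also have "\<dots> = a powr (- d) * N1 * N2"
    unfolding innerN N1_def by simp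
  finally show ?B unfolding N1_def N2_def by simp

  have intG2: "integrable (lborel \<Otimes>\<^sub>M lborel) (\<lambda>(\<eta>, y). complex_of_real x powr Complex c y * ?G \<eta> y)"
  proof -
    have "integrable (lborel \<Otimes>\<^sub>M lborel) (\<lambda>p. x powr c *\<^sub>R (case p of (\<eta>, y) \<Rightarrow> ?G \<eta> y))"
      using intG by (rule integrable_scaleR_right)
    then show ?thesis
      by (rule Bochner_Integration.integrable_bound)
        (use x in \<open>auto simp: norm_mult norm_of_real_powr\<close>)
  qed
  have inner: "(LINT y|lborel. complex_of_real x powr Complex c y * ?G \<eta> y) =
      2 * pi * gker \<beta> x * (complex_of_real (a / x) powr (- Complex d \<eta>) * Gamma_C ((\<alpha> - z' / 2) + Complex d \<eta> / 2))" for \<eta>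
  proof -
    have "(LINT y|lborel. complex_of_real x powr (- Complex (d - c) (\<eta> + (-1) * y)) *
         Gamma_C (\<beta> + Complex (d - c) (\<eta> + (-1) * y) / 2)) = 2 * pi * gker \<beta> x"
      using lborel_integral_real_affine[of "-1" "\<lambda>y. complex_of_real x powr (- Complex (d - c) y) *
         Gamma_C (\<beta> + Complex (d - c) y / 2)" \<eta>]
      by (simp add: mellin_inversion_gker[OF x pos2'])
    moreover have "complex_of_real x powr Complex c y * ?G \<eta> y =
       (complex_of_real (a / x) powr (- Complex d \<eta>) * Gamma_C ((\<alpha> - z' / 2) + Complex d \<eta> / 2)) *
       (complex_of_real x powr (- Complex (d - c) (\<eta> + (-1) * y)) *
         Gamma_C (\<beta> + Complex (d - c) (\<eta> + (-1) * y) / 2))" for y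
    proof -
      have "Complex c y = Complex d \<eta> + (- Complex (d - c) (\<eta> + (-1) * y))"
        by (simp add: complex_eq_iff)
      then have "complex_of_real x powr Complex c y =
         complex_of_real x powr Complex d \<eta> * complex_of_real x powr (- Complex (d - c) (\<eta> + (-1) * y))"
        by (metis powr_add)
      moreover have "complex_of_real (a / x) powr (- Complex d \<eta>) =
         complex_of_real a powr (- Complex d \<eta>) * complex_of_real x powr Complex d \<eta>"
        using x a by (simp only: of_real_powr_divide) (simp add: powr_minus divide_inverse)
      ultimately show ?thesis by (simp only: Gamma_C_shift sub mult_ac)
    qed
    ultimately show ?thesis by (simp only: integral_mult_right_zero) (simp only: mult_ac)
  qed
  have "(LINT y|lborel. complex_of_real x powr Complex c y * barnes a \<alpha> \<beta> d z' (Complex c y)) =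
      (LINT y|lborel. (LINT \<eta>|lborel. complex_of_real x powr Complex c y * ?G \<eta> y)) / (2 * pi)"
    unfolding barnes_def by simp
  also have "(LINT y|lborel. (LINT \<eta>|lborel. complex_of_real x powr Complex c y * ?G \<eta> y)) =
     (LINT \<eta>|lborel. (LINT y|lborel. complex_of_real x powr Complex c y * ?G \<eta> y))"
    using intG2 by (rule lborel_pair.Fubini_integral)
  also have "\<dots> = 2 * pi * gker \<beta> x * (LINT \<eta>|lborel. complex_of_real (a / x) powr (- Complex d \<eta>) * Gamma_C ((\<alpha> - z' / 2) + Complex d \<eta> / 2))"
    unfolding inner by simp
  also have "\<dots> = 2 * pi * gker \<beta> x * (2 * pi * gker (\<alpha> - z' / 2) (a / x))"
    using a x pos by (subst mellin_inversion_gker) (auto simp: diff_divide_distrib)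
  finally show ?C by (simp add: gker_shift mult_ac)
qed

text \<open>Without z in its argument, the second Gamma factor is unfolded as the Mellin transform
  of \<open>gker \<beta>\<close>. Inverting the first factor gives a multiplicative convolution,
  whose variable \<open>v\<close> will become the last torus coordinate.\<close>

lemma barnes_end:
  assumes pos2: "Re \<beta> + d / 2 > 0"
  shows "integrable mult_haar (\<lambda>v. gker \<beta> v * gker \<alpha> (a / v) * complex_of_real (a / v) powr (- z'))" (is ?A)
    and "(LINT v|mult_haar. gker \<beta> v * gker \<alpha> (a / v) * complex_of_real (a / v) powr (- z')) =
      barnes a \<alpha> \<beta> d z' 0" (is ?B)
proof -
  interpret P: pair_sigma_finite mult_haar "lborel :: real measure" by standard
  let ?G = "\<lambda>v \<eta>. gker \<beta> v * complex_of_real v powr Complex d \<eta> *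
     (complex_of_real a powr (- Complex d \<eta>) * Gamma_C (\<alpha> + (Complex d \<eta> - z') / 2))"
  have int: "integrable (mult_haar \<Otimes>\<^sub>M lborel) (\<lambda>(v, \<eta>). ?G v \<eta>)"
  proof -
    have "integrable mult_haar (\<lambda>v. gker \<beta> v * complex_of_real v powr of_real d)"
      by (rule mellin_gker) (use pos2 in simp)
    then have "integrable (mult_haar \<Otimes>\<^sub>M lborel) (\<lambda>(v, \<eta>). (gker \<beta> v * complex_of_real v powr of_real d) *
        (complex_of_real (a powr - d) * Gamma_C (\<alpha> + (Complex d \<eta> - z') / 2)))"
      using Gamma_C_shift_integrable[OF pos] by (intro P.integrable_prod_mult integrable_mult_right)
    then show ?thesis
    proof (rule Bochner_Integration.integrable_bound)
      show "(\<lambda>(v, \<eta>). ?G v \<eta>) \<in> borel_measurable (mult_haar \<Otimes>\<^sub>M lborel)" by measurable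
      have "{p \<in> space (mult_haar \<Otimes>\<^sub>M (lborel :: real measure)). 0 < fst p} \<in> sets (mult_haar \<Otimes>\<^sub>M lborel)"
        by measurable
      moreover have "AE v in mult_haar. AE \<eta> in (lborel :: real measure). 0 < fst (v, \<eta>)"
        using AE_mult_haar_pos by eventually_elim simp
      ultimately have "AE p in mult_haar \<Otimes>\<^sub>M (lborel :: real measure). 0 < fst p"
        by (rule P.AE_pair_measure)
      then show "AE p in mult_haar \<Otimes>\<^sub>M lborel. norm (case p of (v, \<eta>) \<Rightarrow> ?G v \<eta>) \<le>
         norm (case p of (v, \<eta>) \<Rightarrow> (gker \<beta> v * complex_of_real v powr of_real d) *
        (complex_of_real (a powr - d) * Gamma_C (\<alpha> + (Complex d \<eta> - z') / 2)))"
      proof eventually_elim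
        case (elim p)
        obtain v \<eta> where p: "p = (v, \<eta>)" by (cases p)
        with elim have v: "v > 0" by simp
        have n: "norm (complex_of_real v powr Complex d \<eta>) = v powr d"
          "norm (complex_of_real v powr of_real d) = v powr d"
          "norm (complex_of_real a powr (- Complex d \<eta>)) = a powr (- d)"
          "norm (complex_of_real (a powr - d)) = a powr (- d)"
          using norm_of_real_powr[OF v] norm_of_real_powr[OF a] by simp_all
        show ?case unfolding p prod.case norm_mult n by (rule order_refl)
      qed
    qed
  qed
  have inner: "(LINT \<eta>|lborel. ?G v \<eta>) = 2 * pi * (gker \<beta> v * gker \<alpha> (a / v) * complex_of_real (a / v) powr (- z'))"
    if v: "v > 0" for v
  proof -
    have "?G v \<eta> = gker \<beta> v * (complex_of_real (a / v) powr (- Complex d \<eta>) * Gamma_C ((\<alpha> - z' / 2) + Complex d \<eta> / 2))" for \<eta>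
    proof -
      have "complex_of_real (a / v) powr (- Complex d \<eta>) =
          complex_of_real a powr (- Complex d \<eta>) * complex_of_real v powr Complex d \<eta>"
        using v a by (simp only: of_real_powr_divide) (simp add: powr_minus divide_inverse)
      then show ?thesis by (simp only: Gamma_C_shift mult_ac)
    qed
    then have "(LINT \<eta>|lborel. ?G v \<eta>) = gker \<beta> v * (2 * pi * gker (\<alpha> - z' / 2) (a / v))"
      using pos v a
      by (simp only: integral_mult_right_zero) (subst mellin_inversion_gker, auto simp: diff_divide_distrib)
    then show ?thesis by (simp add: gker_shift)
  qed
  have "integrable mult_haar (\<lambda>v. (LINT \<eta>|lborel. ?G v \<eta>) / (2 * pi))"
    using P.integrable_fst[OF int] by simp
  moreover have AE: "AE v in mult_haar. (LINT \<eta>|lborel. ?G v \<eta>) / (2 * pi) =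
      gker \<beta> v * gker \<alpha> (a / v) * complex_of_real (a / v) powr (- z')"
    using AE_mult_haar_pos by eventually_elim (simp add: inner)
  moreover have m1: "(\<lambda>v. (LINT \<eta>|lborel. ?G v \<eta>) / (2 * pi)) \<in> borel_measurable mult_haar" by measurable
  moreover have m2: "(\<lambda>v. gker \<beta> v * gker \<alpha> (a / v) * complex_of_real (a / v) powr (- z')) \<in> borel_measurable mult_haar"
    by measurable
  ultimately show ?A
    using integrable_cong_AE[OF m1 m2 AE] by blast
  have "(LINT v|mult_haar. gker \<beta> v * gker \<alpha> (a / v) * complex_of_real (a / v) powr (- z')) =
      (LINT v|mult_haar. (LINT \<eta>|lborel. ?G v \<eta>) / (2 * pi))"
    by (rule integral_cong_AE[OF m1 m2 AE, symmetric])
  also have "\<dots> = (LINT v|mult_haar. (LINT \<eta>|lborel. ?G v \<eta>)) / (2 * pi)" by simp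
  also have "(LINT v|mult_haar. (LINT \<eta>|lborel. ?G v \<eta>)) = (LINT \<eta>|lborel. (LINT v|mult_haar. ?G v \<eta>))"
    using int by (rule P.Fubini_integral[symmetric])
  also have "(\<lambda>\<eta>. LINT v|mult_haar. ?G v \<eta>) = (\<lambda>\<eta>. complex_of_real a powr (- Complex d \<eta>) *
      Gamma_C (\<alpha> + (Complex d \<eta> - z') / 2) * Gamma_C (\<beta> + (Complex d \<eta> - 0) / 2))"
    by (simp only: integral_mult_left_zero)
      (subst mellin_gker(2), use pos2 in \<open>auto simp: mult_ac\<close>)
  finally show ?B unfolding barnes_def by simp
qed

end

lemma barnes_measurable [measurable (raw)]:
  assumes [measurable]: "f \<in> borel_measurable M" "g \<in> borel_measurable M"
  shows "(\<lambda>x. barnes a \<alpha> \<beta> d (f x) (g x)) \<in> borel_measurable M"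
  unfolding barnes_def by measurable

text \<open>Changing Im z' only translates the first Gamma factor along its line, and changing the
  point of the s-line only translates the second; neither affects an L1 norm.\<close>

lemma barnes_bounded_L1:
  assumes "a > 0" "Re \<alpha> + (d - c') / 2 > 0" "Re \<beta> + (d - c) / 2 > 0"
  obtains C where "\<And>\<eta>. (\<integral>\<^sup>+y. ennreal (norm (barnes a \<alpha> \<beta> d (Complex c' \<eta>) (Complex c y))) \<partial>lborel) \<le> ennreal C"
proof -
  define N where "N = (LINT y|lborel. norm (Gamma_C (\<alpha> + Complex (d - c') y / 2)))"
  define N2 where "N2 = (LINT y|lborel. norm (Gamma_C (\<beta> + Complex (d - c) y / 2)))"
  have eq: "(LINT y|lborel. norm (Gamma_C (\<alpha> + (Complex d y - Complex c' \<eta>) / 2))) = N" for \<eta>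
  proof -
    have "Complex d y - Complex c' \<eta> = Complex (d - c') (- \<eta> + 1 * y)" for y
      by (simp add: complex_eq_iff)
    then show ?thesis
      unfolding N_def
      using lborel_integral_real_affine[of 1 "\<lambda>y. norm (Gamma_C (\<alpha> + Complex (d - c') y / 2))" "- \<eta>"]
      by simp
  qed
  have "(\<integral>\<^sup>+y. ennreal (norm (barnes a \<alpha> \<beta> d (Complex c' \<eta>) (Complex c y))) \<partial>lborel) \<le>
      ennreal (a powr (- d) / (2 * pi) * N * N2)" for \<eta>
  proof -
    have pos: "Re \<alpha> + (d - Re (Complex c' \<eta>)) / 2 > 0" using assms by simp
    show ?thesis
      using barnes_step(1,2)[OF assms(1) pos assms(3), of 1] unfolding eq N2_def
      by (subst nn_integral_eq_integral) (auto intro!: ennreal_leI)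
  qed
  then show ?thesis by (rule that)
qed

section \<open>Finite products of measures and changes of variables on the torus\<close>

context product_sigma_finite
begin

text \<open>As a pushforward of a binary product, adjoining a coordinate transports Bochner
  integrability as well as integrals.\<close>

lemma PiM_insert_eq_distr:
  assumes I: "finite I" "i \<notin> I"
  shows "PiM (insert i I) M = distr (PiM I M \<Otimes>\<^sub>M M i) (PiM (insert i I) M) (\<lambda>(x, y). x(i := y))"
proof (rule measure_eqI)
  fix A assume "A \<in> sets (PiM (insert i I) M)"
  then have [measurable]: "A \<in> sets (PiM (insert i I) M)" .
  have m: "(\<lambda>(x, y). x(i := y)) \<in> PiM I M \<Otimes>\<^sub>M M i \<rightarrow>\<^sub>M PiM (insert i I) M" by measurable
  have "emeasure (PiM (insert i I) M) A = (\<integral>\<^sup>+x. indicator A x \<partial>PiM (insert i I) M)" by simp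
  also have "\<dots> = (\<integral>\<^sup>+ x. (\<integral>\<^sup>+ y. indicator A (x(i := y)) \<partial>(M i)) \<partial>(PiM I M))"
    by (rule product_nn_integral_insert[OF I]) measurable
  also have "\<dots> = (\<integral>\<^sup>+ p. indicator A ((\<lambda>(x, y). x(i := y)) p) \<partial>(PiM I M \<Otimes>\<^sub>M M i))"
    by (subst sigma_finite_measure.nn_integral_fst[OF sigma_finite_measures, symmetric]) auto
  also have "\<dots> = (\<integral>\<^sup>+ p. indicator A p \<partial>distr (PiM I M \<Otimes>\<^sub>M M i) (PiM (insert i I) M) (\<lambda>(x, y). x(i := y)))"
    by (subst nn_integral_distr[OF m]) auto
  finally show "emeasure (PiM (insert i I) M) A =
      emeasure (distr (PiM I M \<Otimes>\<^sub>M M i) (PiM (insert i I) M) (\<lambda>(x, y). x(i := y))) A" by simp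
qed simp

text \<open>The box over a null set in one coordinate is null even if the other factors have
  infinite mass, since 0 times infinity is 0 in \<open>ennreal\<close>.\<close>

lemma AE_PiM_finite_component:
  assumes I: "finite I" "j \<in> I" and P: "AE x in M j. P x"
  shows "AE x in PiM I M. P (x j)"
proof -
  obtain N where N: "{x \<in> space (M j). \<not> P x} \<subseteq> N" "emeasure (M j) N = 0" "N \<in> sets (M j)"
    using P by (rule AE_E)
  let ?A = "PiE I (\<lambda>k. if k = j then N else space (M k))"
  have "emeasure (PiM I M) ?A = (\<Prod>k\<in>I. emeasure (M k) (if k = j then N else space (M k)))"
    using I N by (intro emeasure_PiM) auto
  also have "\<dots> = 0" using I N by (intro prod_zero) auto
  finally show ?thesis
    using N I by (intro AE_I[of _ _ ?A] sets_PiM_I_finite) (auto simp: space_PiM PiE_def Pi_def extensional_def)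
qed

end

lemma distr_mult_haar_scale:
  assumes "c > 0"
  shows "distr mult_haar borel (\<lambda>y. y * c) = mult_haar"
proof -
  have "distr mult_haar borel (\<lambda>y. y * c) = distr lborel borel (\<lambda>u. exp u * c)"
    unfolding mult_haar_eq_distr_exp by (subst distr_distr) (auto simp: o_def)
  also have "\<dots> = distr lborel borel (\<lambda>u. exp (ln c + u))"
    using assms by (simp add: exp_add mult.commute)
  also have "\<dots> = distr (distr lborel borel (\<lambda>u. ln c + u)) borel exp"
    by (subst distr_distr) (auto simp: o_def)
  also have "distr lborel borel (\<lambda>u. ln c + u) = lborel"
    by (rule lborel_distr_plus)
  finally show ?thesis by (simp add: mult_haar_eq_distr_exp)
qed

interpretation MH: product_sigma_finite "\<lambda>_::nat. mult_haar" by standard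
interpretation LB: product_sigma_finite "\<lambda>_::nat. lborel :: real measure" by standard

lemma mult_haar_component_measurable:
  "j \<in> I \<Longrightarrow> (\<lambda>t. t j) \<in> borel_measurable (PiM I (\<lambda>_. mult_haar))"
  by (subst measurable_cong_sets[OF refl sets_mult_haar[symmetric]]) (rule measurable_component_singleton)

text \<open>With the other coordinates fixed the map scales t_i by t_j, which is positive almost
  everywhere, so invariance in one variable and Tonelli suffice.\<close>

lemma mult_haar_shear:
  fixes I :: "nat set"
  assumes I: "finite I" "i \<in> I" "j \<in> I" "i \<noteq> j"
  shows "distr (PiM I (\<lambda>_. mult_haar)) (PiM I (\<lambda>_. mult_haar)) (\<lambda>t. t(i := t i * t j)) = PiM I (\<lambda>_. mult_haar)"
proof (rule measure_eqI)
  let ?M = "\<lambda>_::nat. mult_haar"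
  define J where "J = I - {i}"
  have J: "finite J" "i \<notin> J" "I = insert i J" "j \<in> J" using I by (auto simp: J_def)
  have m: "(\<lambda>t. t(i := t i * t j)) \<in> PiM I ?M \<rightarrow>\<^sub>M PiM I ?M"
  proof -
    have "(\<lambda>t. t(i := t i * t j)) \<in> PiM (insert i J) ?M \<rightarrow>\<^sub>M PiM (insert i J) ?M"
    proof (rule measurable_PiM_single')
      show "(\<lambda>t. (t(i := t i * t j)) k) \<in> PiM (insert i J) ?M \<rightarrow>\<^sub>M mult_haar" if "k \<in> insert i J" for k
      proof (cases "k = i")
        case True
        have "(\<lambda>t. t i * t j) \<in> borel_measurable (PiM (insert i J) ?M)"
          using J by (intro borel_measurable_times mult_haar_component_measurable) auto
        with True show ?thesis by (simp add: measurable_cong_sets[OF refl sets_mult_haar])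
      qed (use that in simp)
    qed (auto simp: space_PiM PiE_def extensional_def)
    then show ?thesis using J by simp
  qed
  fix A assume "A \<in> sets (distr (PiM I ?M) (PiM I ?M) (\<lambda>t. t(i := t i * t j)))"
  then have A[measurable]: "A \<in> sets (PiM I ?M)" by simp
  have ind: "(\<lambda>t. indicator A t :: ennreal) \<in> borel_measurable (PiM (insert i J) ?M)"
    using A J by simp
  have "emeasure (distr (PiM I ?M) (PiM I ?M) (\<lambda>t. t(i := t i * t j))) A =
     (\<integral>\<^sup>+t. indicator A (t(i := t i * t j)) \<partial>PiM (insert i J) ?M)"
    by (subst nn_integral_indicator[symmetric], (use A in simp), subst nn_integral_distr[OF m])
      (use J ind in auto)
  also have "\<dots> = (\<integral>\<^sup>+x. (\<integral>\<^sup>+y. indicator A ((x(i := y))(i := (x(i := y)) i * (x(i := y)) j)) \<partial>mult_haar) \<partial>PiM J ?M)"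
    using measurable_compose[OF m, of "indicator A"] ind J
    by (intro MH.product_nn_integral_insert[OF J(1,2)]) simp
  also have "\<dots> = (\<integral>\<^sup>+x. (\<integral>\<^sup>+y. indicator A (x(i := y)) \<partial>mult_haar) \<partial>PiM J ?M)"
  proof (rule nn_integral_cong_AE)
    have "AE x in PiM J ?M. 0 < x j"
      using J AE_mult_haar_pos by (intro MH.AE_PiM_finite_component) auto
    then show "AE x in PiM J ?M. (\<integral>\<^sup>+y. indicator A ((x(i := y))(i := (x(i := y)) i * (x(i := y)) j)) \<partial>mult_haar) =
        (\<integral>\<^sup>+y. indicator A (x(i := y)) \<partial>mult_haar)"
      using AE_space
    proof eventually_elim
      case (elim x)
      have [measurable]: "(\<lambda>y. indicator A (x(i := y)) :: ennreal) \<in> borel_measurable borel"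
        using measurable_compose[OF measurable_component_update[OF elim(2) J(2)] ind]
        by (simp add: measurable_cong_sets[OF sets_mult_haar refl])
      have "(\<integral>\<^sup>+y. indicator A (x(i := y)) \<partial>mult_haar) = (\<integral>\<^sup>+y. indicator A (x(i := y)) \<partial>distr mult_haar borel (\<lambda>y. y * x j))"
        using distr_mult_haar_scale[OF elim(1)] by simp
      also have "\<dots> = (\<integral>\<^sup>+y. indicator A (x(i := y * x j)) \<partial>mult_haar)"
        by (subst nn_integral_distr) (auto simp: measurable_cong_sets[OF sets_mult_haar refl])
      finally show ?case using J I by simp
    qed
  qed
  also have "\<dots> = (\<integral>\<^sup>+t. indicator A t \<partial>PiM (insert i J) ?M)"
    by (rule MH.product_nn_integral_insert[OF J(1,2) ind, symmetric])
  also have "\<dots> = emeasure (PiM (insert i J) ?M) A"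
    using A J by (intro nn_integral_indicator) simp
  finally show "emeasure (distr (PiM I ?M) (PiM I ?M) (\<lambda>t. t(i := t i * t j))) A = emeasure (PiM I ?M) A"
    using J by simp
qed simp

lemma AE_mult_haar_pow_pos: "AE t in mult_haar_pow m. \<forall>j\<in>{1..m}. 0 < t j"
  unfolding mult_haar_pow_def
  by (subst AE_finite_all) (auto intro!: MH.AE_PiM_finite_component AE_mult_haar_pos)

text \<open>Only coordinates from \<open>k\<close> on are replaced, so lowering \<open>k\<close> by
  one is a single shear. At \<open>k = 1\<close> it passes from the ratios b_j = t_j / t_(j+1), with
  b_m = t_m, to the torus coordinates t_j.\<close>

definition partial_prods :: "nat \<Rightarrow> nat \<Rightarrow> (nat \<Rightarrow> real) \<Rightarrow> nat \<Rightarrow> real" where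
  "partial_prods m k b = (\<lambda>j. if k \<le> j \<and> j \<in> {1..m} then \<Prod>i=j..m. b i else b j)"

lemma distr_partial_prods:
  assumes "1 \<le> k" "k \<le> m"
  shows "partial_prods m k \<in> mult_haar_pow m \<rightarrow>\<^sub>M mult_haar_pow m \<and>
    distr (mult_haar_pow m) (mult_haar_pow m) (partial_prods m k) = mult_haar_pow m"
  using assms(2,1)
proof (induction k rule: inc_induct)
  case base
  have "partial_prods m m = id" by (auto simp: partial_prods_def fun_eq_iff)
  then show ?case by (simp add: distr_id id_def)
next
  case (step k)
  then have k: "1 \<le> k" "k < m" and IH: "partial_prods m (Suc k) \<in> mult_haar_pow m \<rightarrow>\<^sub>M mult_haar_pow m"
    "distr (mult_haar_pow m) (mult_haar_pow m) (partial_prods m (Suc k)) = mult_haar_pow m" by auto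
  let ?S = "\<lambda>t. t(k := t k * t (Suc k)) :: nat \<Rightarrow> real"
  have eq: "partial_prods m k = ?S \<circ> partial_prods m (Suc k)"
  proof (intro ext)
    fix b :: "nat \<Rightarrow> real" and j
    have "(\<Prod>i=k..m. b i) = b k * (\<Prod>i=Suc k..m. b i)" using k by (simp add: prod.atLeast_Suc_atMost)
    then show "partial_prods m k b j = (?S \<circ> partial_prods m (Suc k)) b j"
      using k by (auto simp: partial_prods_def)
  qed
  have S: "distr (mult_haar_pow m) (mult_haar_pow m) ?S = mult_haar_pow m"
    unfolding mult_haar_pow_def using k by (intro mult_haar_shear) auto
  have Sm: "?S \<in> mult_haar_pow m \<rightarrow>\<^sub>M mult_haar_pow m"
    unfolding mult_haar_pow_def
  proof (rule measurable_PiM_single')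
    show "(\<lambda>t. (t(k := t k * t (Suc k))) i) \<in> PiM {1..m} (\<lambda>_. mult_haar) \<rightarrow>\<^sub>M mult_haar" if "i \<in> {1..m}" for i
    proof (cases "i = k")
      case True
      have "(\<lambda>t. t k * t (Suc k)) \<in> borel_measurable (PiM {1..m} (\<lambda>_. mult_haar))"
        using k by (intro borel_measurable_times mult_haar_component_measurable) auto
      with True show ?thesis by (simp add: measurable_cong_sets[OF refl sets_mult_haar])
    qed (use that in simp)
  qed (use k in \<open>auto simp: space_PiM PiE_def extensional_def\<close>)
  show ?case
  proof
    show "partial_prods m k \<in> mult_haar_pow m \<rightarrow>\<^sub>M mult_haar_pow m"
      unfolding eq using IH(1) Sm by (rule measurable_comp)
    have "distr (mult_haar_pow m) (mult_haar_pow m) (?S \<circ> partial_prods m (Suc k)) =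
        distr (distr (mult_haar_pow m) (mult_haar_pow m) (partial_prods m (Suc k))) (mult_haar_pow m) ?S"
      by (rule distr_distr[OF Sm IH(1), symmetric])
    then show "distr (mult_haar_pow m) (mult_haar_pow m) (partial_prods m k) = mult_haar_pow m"
      unfolding eq IH(2) S .
  qed
qed

lemma (in pair_sigma_finite) integral_prod_mult:
  fixes f :: "'a \<Rightarrow> 'c::{real_normed_field, banach, second_countable_topology}"
  assumes f: "integrable M1 f" and g: "integrable M2 g"
  shows "(LINT p|(M1 \<Otimes>\<^sub>M M2). f (fst p) * g (snd p)) = (LINT x|M1. f x) * (LINT y|M2. g y)"
proof -
  have "(LINT p|(M1 \<Otimes>\<^sub>M M2). f (fst p) * g (snd p)) = (LINT x|M1. (LINT y|M2. f x * g y))"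
    using integral_fst[OF integrable_prod_mult[OF f g]] by (simp add: case_prod_unfold)
  then show ?thesis by simp
qed

context product_sigma_finite
begin

text \<open>Adjoins the variable of \<open>barnes_end\<close> to those of a Mellin integral. The
  \<open>restrict\<close> is there because points of \<open>PiM I M\<close> are
  \<open>undefined\<close> outside \<open>I\<close>, and nothing is assumed about \<open>F\<close>
  elsewhere.\<close>

lemma product_mult_insert:
  fixes F :: "('i \<Rightarrow> 'a) \<Rightarrow> 'c::{real_normed_field, banach, second_countable_topology}"
  assumes I: "finite I" "i \<notin> I" and F: "integrable (PiM I M) F" and G: "integrable (M i) G"
  shows "integrable (PiM (insert i I) M) (\<lambda>x. F (restrict x I) * G (x i))"
    and "(LINT x|PiM (insert i I) M. F (restrict x I) * G (x i)) = (LINT x|PiM I M. F x) * (LINT y|M i. G y)"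
proof -
  interpret I: finite_product_sigma_finite M I by standard fact
  interpret P: pair_sigma_finite "PiM I M" "M i" by standard
  have [measurable]: "F \<in> borel_measurable (PiM I M)" "G \<in> borel_measurable (M i)" using F G by auto
  have m: "(\<lambda>(x, y). x(i := y)) \<in> PiM I M \<Otimes>\<^sub>M M i \<rightarrow>\<^sub>M PiM (insert i I) M" by measurable
  have r: "(\<lambda>x. restrict x I) \<in> PiM (insert i I) M \<rightarrow>\<^sub>M PiM I M"
    by (rule measurable_restrict_subset) auto
  have c: "(\<lambda>x. x i) \<in> PiM (insert i I) M \<rightarrow>\<^sub>M M i" by (rule measurable_component_singleton) simp
  have FG: "(\<lambda>x. F (restrict x I) * G (x i)) \<in> borel_measurable (PiM (insert i I) M)"
    using measurable_compose[OF r, of F borel] measurable_compose[OF c, of G borel] by simp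
  have eq: "(\<lambda>x. F (restrict x I) * G (x i)) ((\<lambda>(x, y). x(i := y)) p) = F (fst p) * G (snd p)"
    if "p \<in> space (PiM I M \<Otimes>\<^sub>M M i)" for p
  proof -
    obtain x y where p: "p = (x, y)" by (cases p)
    with that have "x \<in> extensional I" by (auto simp: space_pair_measure space_PiM PiE_def)
    then have "restrict (x(i := y)) I = x" using I by (auto simp: restrict_def extensional_def fun_eq_iff)
    then show ?thesis by (simp add: p)
  qed
  have "integrable (PiM I M \<Otimes>\<^sub>M M i) (\<lambda>p. F (fst p) * G (snd p))"
    using P.integrable_prod_mult[OF F G] by (simp add: case_prod_unfold)
  then have "integrable (PiM I M \<Otimes>\<^sub>M M i) (\<lambda>p. (\<lambda>x. F (restrict x I) * G (x i)) ((\<lambda>(x, y). x(i := y)) p))"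
    by (rule Bochner_Integration.integrable_cong[THEN iffD1, rotated -1]) (simp_all only: eq)
  then show "integrable (PiM (insert i I) M) (\<lambda>x. F (restrict x I) * G (x i))"
    by (subst PiM_insert_eq_distr[OF I], subst integrable_distr_eq[OF m FG])
  have "(LINT x|PiM (insert i I) M. F (restrict x I) * G (x i)) =
     (LINT p|(PiM I M \<Otimes>\<^sub>M M i). (\<lambda>x. F (restrict x I) * G (x i)) ((\<lambda>(x, y). x(i := y)) p))"
    by (subst PiM_insert_eq_distr[OF I], subst integral_distr[OF m FG]) (rule refl)
  also have "\<dots> = (LINT p|(PiM I M \<Otimes>\<^sub>M M i). F (fst p) * G (snd p))"
    by (rule Bochner_Integration.integral_cong[OF refl eq])
  finally show "(LINT x|PiM (insert i I) M. F (restrict x I) * G (x i)) = (LINT x|PiM I M. F x) * (LINT y|M i. G y)"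
    unfolding P.integral_prod_mult[OF F G] .
qed

end

section \<open>Chains of Barnes integrals\<close>

text \<open>A name for the argument that \<open>vline_integral\<close> passes to its integrand,
  including the convention z_0 = 0.\<close>

definition vpt :: "(nat \<Rightarrow> real) \<Rightarrow> (nat \<Rightarrow> real) \<Rightarrow> nat \<Rightarrow> complex" where
  "vpt c y = (\<lambda>j. if j = 0 then 0 else Complex (c j) (y j))"

lemma vline_integral_vpt:
  "vline_integral m c F = (LINT y|PiM {1..m} (\<lambda>_. lborel). F (vpt c y)) / complex_of_real ((2 * pi) ^ m)"
  by (simp add: vline_integral_def vpt_def)

lemma Re_vpt: "Re (vpt c y j) = (if j = 0 then 0 else c j)"
  by (simp add: vpt_def)

lemma vpt_measurable:
  assumes "j \<le> r"
  shows "(\<lambda>y. vpt c y j) \<in> borel_measurable (PiM {1..r} (\<lambda>_. lborel))"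
proof (cases "j = 0")
  case False
  with assms have "j \<in> {1..r}" by auto
  then have [measurable]: "(\<lambda>y. y j) \<in> borel_measurable (PiM {1..r} (\<lambda>_. lborel))"
    using measurable_component_singleton[of j "{1..r}" "\<lambda>_. lborel :: real measure"] by simp
  have "(\<lambda>y. Complex (c j) (y j)) \<in> borel_measurable (PiM {1..r} (\<lambda>_. lborel))" by measurable
  then show ?thesis unfolding vpt_def using False by (simp only: if_False)
qed (simp add: vpt_def)

lemma vpt_upd: "vpt c (x(Suc r := y)) j = (if j = Suc r then Complex (c (Suc r)) y else vpt c x j)"
  by (simp add: vpt_def)

lemma prod_atLeast1_Suc: "(\<Prod>j=1..Suc r. f j) = (\<Prod>j=1..r. f j) * f (Suc r)" for f :: "nat \<Rightarrow> 'a::comm_monoid_mult"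
  by simp

context
  fixes c d g :: "nat \<Rightarrow> real" and \<alpha> \<beta> :: "nat \<Rightarrow> complex"
  assumes g: "\<And>j. 0 < g j"
begin

text \<open>\<open>g\<close> will hold the diagonal entries a_j ... a_(n-1) of the torus element, so
  that \<open>g j / g (Suc j)\<close> is a_j.\<close>

definition chain_factor :: "nat \<Rightarrow> (nat \<Rightarrow> complex) \<Rightarrow> complex" where
  "chain_factor j z = barnes (g j / g (Suc j)) (\<alpha> j) (\<beta> j) (d j) (z (j - 1)) (z j)"

definition chain_ok :: "nat \<Rightarrow> bool" where
  "chain_ok r \<longleftrightarrow> (\<forall>j\<in>{1..r}. Re (\<alpha> j) + (d j - (if j = 1 then 0 else c (j - 1))) / 2 > 0 \<and>
     Re (\<beta> j) + (d j - c j) / 2 > 0)"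

text \<open>What is left of the j-th Barnes factor once both of its Gamma factors are inverted: t_j
  interacts with the two neighbouring entries g_j and g_(j+1).\<close>

definition torus_kernel :: "(nat \<Rightarrow> real) \<Rightarrow> nat \<Rightarrow> complex" where
  "torus_kernel t j = gker (\<beta> j) (t j / g (Suc j)) * gker (\<alpha> j) (g j / t j)"

lemma chain_factor_measurable:
  assumes "j \<le> r"
  shows "(\<lambda>y. chain_factor j (vpt c y)) \<in> borel_measurable (PiM {1..r} (\<lambda>_. lborel))"
proof -
  have [measurable]: "(\<lambda>y. vpt c y j) \<in> borel_measurable (PiM {1..r} (\<lambda>_. lborel))"
    "(\<lambda>y. vpt c y (j - 1)) \<in> borel_measurable (PiM {1..r} (\<lambda>_. lborel))"
    using assms by (intro vpt_measurable; simp)+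
  show ?thesis unfolding chain_factor_def by measurable
qed

lemma chain_factor_upd:
  "j \<le> r \<Longrightarrow> chain_factor j (vpt c (x(Suc r := y))) = chain_factor j (vpt c x)"
  "chain_factor (Suc r) (vpt c (x(Suc r := y))) =
     barnes (g (Suc r) / g (Suc (Suc r))) (\<alpha> (Suc r)) (\<beta> (Suc r)) (d (Suc r)) (vpt c x r) (Complex (c (Suc r)) y)"
proof -
  assume "j \<le> r"
  then have "j \<noteq> Suc r" "j - 1 \<noteq> Suc r" by auto
  then show "chain_factor j (vpt c (x(Suc r := y))) = chain_factor j (vpt c x)"
    unfolding chain_factor_def vpt_upd by simp
qed (simp add: chain_factor_def vpt_upd)

text \<open>The last variable occurs only in the last factor, whose L1 norm in it is bounded
  uniformly in the previous variable; the bound comes out as a constant and the other factors are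
  handled by induction.\<close>

lemma chain_integrable:
  assumes "chain_ok r"
  shows "integrable (PiM {1..r} (\<lambda>_. lborel)) (\<lambda>y. \<Prod>j=1..r. chain_factor j (vpt c y))"
  using assms
proof (induction r)
  case 0
  then show ?case by (simp add: PiM_empty integrable_count_space)
next
  case (Suc r)
  then have ok: "chain_ok r" by (simp add: chain_ok_def)
  have ins: "{1..Suc r} = insert (Suc r) {1..r}" by auto
  let ?f = "\<lambda>y. \<Prod>j=1..Suc r. chain_factor j (vpt c y)"
  let ?h = "\<lambda>y. \<Prod>j=1..r. chain_factor j (vpt c y)"
  have fm: "?f \<in> borel_measurable (PiM {1..Suc r} (\<lambda>_. lborel))"
    by (intro borel_measurable_prod chain_factor_measurable) auto
  have hm[measurable]: "?h \<in> borel_measurable (PiM {1..r} (\<lambda>_. lborel))"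
    by (intro borel_measurable_prod chain_factor_measurable) auto
  let ?c = "if r = 0 then 0 else c r"
  have "Re (\<alpha> (Suc r)) + (d (Suc r) - ?c) / 2 > 0" "Re (\<beta> (Suc r)) + (d (Suc r) - c (Suc r)) / 2 > 0"
    using Suc.prems by (auto simp: chain_ok_def dest!: bspec[of _ _ "Suc r"])
  then obtain C where C: "\<And>\<eta>. (\<integral>\<^sup>+y. ennreal (norm (barnes (g (Suc r) / g (Suc (Suc r))) (\<alpha> (Suc r)) (\<beta> (Suc r)) (d (Suc r))
        (Complex ?c \<eta>) (Complex (c (Suc r)) y))) \<partial>lborel) \<le> ennreal C"
    using barnes_bounded_L1[of "g (Suc r) / g (Suc (Suc r))"] g by (metis divide_pos_pos)
  have vr: "vpt c x r = Complex ?c (if r = 0 then 0 else x r)" for x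
    by (simp add: vpt_def complex_eq_iff)
  have "(\<integral>\<^sup>+y. ennreal (norm (?f y)) \<partial>PiM {1..Suc r} (\<lambda>_. lborel)) =
      (\<integral>\<^sup>+x. (\<integral>\<^sup>+y. ennreal (norm (?f (x(Suc r := y)))) \<partial>lborel) \<partial>PiM {1..r} (\<lambda>_. lborel))"
    by (rule LB.product_nn_integral_insert[of "{1..r}" "Suc r" "\<lambda>y. ennreal (norm (?f y))", folded ins])
      (simp, simp, rule measurable_compose[OF fm], simp)
  also have "\<dots> = (\<integral>\<^sup>+x. (\<integral>\<^sup>+y. ennreal (norm (?h x)) *
     ennreal (norm (barnes (g (Suc r) / g (Suc (Suc r))) (\<alpha> (Suc r)) (\<beta> (Suc r)) (d (Suc r))
        (vpt c x r) (Complex (c (Suc r)) y))) \<partial>lborel) \<partial>PiM {1..r} (\<lambda>_. lborel))"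
  proof -
    have "?h (x(Suc r := y)) = ?h x" for x y
      by (rule prod.cong) (auto simp: chain_factor_upd)
    then show ?thesis
      unfolding prod_atLeast1_Suc chain_factor_upd(2) norm_mult by (simp only: ennreal_mult' norm_ge_zero)
  qed
  also have "\<dots> = (\<integral>\<^sup>+x. ennreal (norm (?h x)) * (\<integral>\<^sup>+y.
     ennreal (norm (barnes (g (Suc r) / g (Suc (Suc r))) (\<alpha> (Suc r)) (\<beta> (Suc r)) (d (Suc r))
        (vpt c x r) (Complex (c (Suc r)) y))) \<partial>lborel) \<partial>PiM {1..r} (\<lambda>_. lborel))"
    by (subst nn_integral_cmult) auto
  also have "\<dots> \<le> (\<integral>\<^sup>+x. ennreal (norm (?h x)) * ennreal C \<partial>PiM {1..r} (\<lambda>_. lborel))"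
    unfolding vr by (intro nn_integral_mono mult_left_mono C) auto
  also have "\<dots> = (\<integral>\<^sup>+x. ennreal (norm (?h x)) \<partial>PiM {1..r} (\<lambda>_. lborel)) * ennreal C"
    by (rule nn_integral_multc) measurable
  also have "\<dots> < \<infinity>"
    using Suc.IH[OF ok] by (auto simp: integrable_iff_bounded ennreal_mult_less_top)
  finally show ?case using fm by (intro integrableI_bounded)
qed

lemma phase_measurable:
  assumes "r \<le> r'"
  shows "(\<lambda>y. \<Prod>j=1..r. complex_of_real (x j) powr vpt c y j) \<in> borel_measurable (PiM {1..r'} (\<lambda>_. lborel))"
  using assms by (intro borel_measurable_prod measurable_of_real_powr vpt_measurable) auto

lemma norm_phase:
  assumes "\<And>j. j \<in> {1..r} \<Longrightarrow> 0 < x j"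
  shows "norm (\<Prod>j=1..r. complex_of_real (x j) powr vpt c y j) = (\<Prod>j=1..r. x j powr c j)"
  unfolding prod_norm[symmetric]
  by (rule prod.cong) (use assms in \<open>auto simp: norm_of_real_powr Re_vpt\<close>)

lemma phase_chain_integrable:
  assumes ok: "chain_ok r" and x: "\<And>j. j \<in> {1..r} \<Longrightarrow> 0 < x j" and w: "0 < w"
  shows "integrable (PiM {1..r} (\<lambda>_. lborel)) (\<lambda>y. (\<Prod>j=1..r. complex_of_real (x j) powr vpt c y j) *
     (\<Prod>j=1..r. chain_factor j (vpt c y)) * complex_of_real w powr (- vpt c y r))"
proof (rule Bochner_Integration.integrable_bound)
  let ?K = "(\<Prod>j=1..r. x j powr c j) * w powr (- (if r = 0 then 0 else c r))"
  show "integrable (PiM {1..r} (\<lambda>_. lborel)) (\<lambda>y. ?K * norm (\<Prod>j=1..r. chain_factor j (vpt c y)))"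
    using chain_integrable[OF ok] by auto
  have [measurable]: "(\<lambda>y. vpt c y r) \<in> borel_measurable (PiM {1..r} (\<lambda>_. lborel))"
    "(\<lambda>y. \<Prod>j=1..r. complex_of_real (x j) powr vpt c y j) \<in> borel_measurable (PiM {1..r} (\<lambda>_. lborel))"
    "(\<lambda>y. \<Prod>j=1..r. chain_factor j (vpt c y)) \<in> borel_measurable (PiM {1..r} (\<lambda>_. lborel))"
    by (intro vpt_measurable phase_measurable borel_measurable_prod chain_factor_measurable; simp)+
  show "(\<lambda>y. (\<Prod>j=1..r. complex_of_real (x j) powr vpt c y j) *
     (\<Prod>j=1..r. chain_factor j (vpt c y)) * complex_of_real w powr (- vpt c y r)) \<in> borel_measurable (PiM {1..r} (\<lambda>_. lborel))"
    by measurable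
  have K: "0 \<le> ?K" using w by (auto intro!: mult_nonneg_nonneg prod_nonneg)
  have np: "norm (\<Prod>j=1..r. complex_of_real (x j) powr vpt c y j) = (\<Prod>j=1..r. x j powr c j)" for y
    by (rule norm_phase[OF x])
  have nw: "norm (complex_of_real w powr (- vpt c y r)) = w powr (- (if r = 0 then 0 else c r))" for y
    unfolding norm_of_real_powr[OF w] by (simp add: Re_vpt)
  show "AE y in PiM {1..r} (\<lambda>_. lborel). norm ((\<Prod>j=1..r. complex_of_real (x j) powr vpt c y j) *
     (\<Prod>j=1..r. chain_factor j (vpt c y)) * complex_of_real w powr (- vpt c y r)) \<le>
     norm (?K * norm (\<Prod>j=1..r. chain_factor j (vpt c y)))"
  proof (intro AE_I2)
    fix y
    have "norm ((\<Prod>j=1..r. complex_of_real (x j) powr vpt c y j) *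
     (\<Prod>j=1..r. chain_factor j (vpt c y)) * complex_of_real w powr (- vpt c y r)) =
     ?K * norm (\<Prod>j=1..r. chain_factor j (vpt c y))"
      by (simp only: norm_mult np nw mult_ac)
    then show "norm ((\<Prod>j=1..r. complex_of_real (x j) powr vpt c y j) *
     (\<Prod>j=1..r. chain_factor j (vpt c y)) * complex_of_real w powr (- vpt c y r)) \<le>
     norm (?K * norm (\<Prod>j=1..r. chain_factor j (vpt c y)))" by simp
  qed
qed

text \<open>Integrating out \<open>z\<^sub>r\<close> turns the last factor into values of \<open>gker\<close> and reproduces the same
  integral in one variable less.\<close>

lemma chain_integral:
  assumes "chain_ok r" and "\<And>j. j \<in> {1..Suc r} \<Longrightarrow> 0 < t j"
  shows "(LINT y|PiM {1..r} (\<lambda>_. lborel). (\<Prod>j=1..r. complex_of_real (t j / t (Suc j)) powr vpt c y j) *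
     (\<Prod>j=1..r. chain_factor j (vpt c y)) * complex_of_real (g (Suc r) / t (Suc r)) powr (- vpt c y r)) =
     (2 * pi) ^ r * (\<Prod>j=1..r. torus_kernel t j)"
  using assms
proof (induction r)
  case 0
  have "g (Suc 0) \<noteq> 0" "t (Suc 0) \<noteq> 0" using g[of 1] 0(2)[of 1] by auto
  then show ?case by (simp add: PiM_empty lebesgue_integral_count_space_finite vpt_def)
next
  case (Suc r)
  then have ok: "chain_ok r" by (simp add: chain_ok_def)
  have tp: "0 < t (Suc r)" "0 < t (Suc (Suc r))" using Suc.prems(2) by auto
  have gp: "0 < g (Suc r)" "0 < g (Suc (Suc r))" using g by auto
  have ins: "{1..Suc r} = insert (Suc r) {1..r}" by auto
  let ?ph = "\<lambda>r y. \<Prod>j=1..r. complex_of_real (t j / t (Suc j)) powr vpt c y j"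
  let ?ch = "\<lambda>r y. \<Prod>j=1..r. chain_factor j (vpt c y)"
  let ?f = "\<lambda>r y. ?ph r y * ?ch r y * complex_of_real (g (Suc r) / t (Suc r)) powr (- vpt c y r)"
  let ?b = "\<lambda>x y. barnes (g (Suc r) / g (Suc (Suc r))) (\<alpha> (Suc r)) (\<beta> (Suc r)) (d (Suc r))
        (vpt c x r) (Complex (c (Suc r)) y)"
  have int: "integrable (PiM {1..Suc r} (\<lambda>_. lborel)) (?f (Suc r))"
    by (rule phase_chain_integrable[OF Suc.prems(1)]) (use Suc.prems(2) g in \<open>auto intro!: divide_pos_pos\<close>)
  have pos: "Re (\<alpha> (Suc r)) + (d (Suc r) - Re (vpt c x r)) / 2 > 0" "Re (\<beta> (Suc r)) + (d (Suc r) - c (Suc r)) / 2 > 0" for x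
    using Suc.prems by (auto simp: chain_ok_def Re_vpt dest!: bspec[of _ _ "Suc r"])
  \<comment> \<open>The two phases in the last variable combine: (t_(r+1) / t_(r+2)) / (g_(r+2) /
    t_(r+2)) = t_(r+1) / g_(r+2), which is the point \<open>x\<close> for
    \<open>barnes_step\<close>.\<close>
  have upd: "?f (Suc r) (x(Suc r := y)) = (?ph r x * ?ch r x) *
     (complex_of_real (t (Suc r) / g (Suc (Suc r))) powr Complex (c (Suc r)) y * ?b x y)" for x y
  proof -
    have "complex_of_real (t (Suc r) / t (Suc (Suc r))) powr z * complex_of_real (g (Suc (Suc r)) / t (Suc (Suc r))) powr (- z) =
        complex_of_real (t (Suc r) / g (Suc (Suc r))) powr z" for z
      using tp gp by (simp only: of_real_powr_divide) (simp add: powr_minus divide_inverse)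
    moreover have "?ph r (x(Suc r := y)) = ?ph r x" "?ch r (x(Suc r := y)) = ?ch r x"
      by (auto intro!: prod.cong simp: vpt_upd chain_factor_upd)
    ultimately show ?thesis
      unfolding prod_atLeast1_Suc chain_factor_upd(2) vpt_upd by simp
  qed
  \<comment> \<open>The power of a / x left by \<open>barnes_step\<close> is that of g_(r+1) /
    t_(r+1) with exponent - z_r, exactly the extra phase of the induction hypothesis.\<close>
  have inner: "(LINT y|lborel. ?f (Suc r) (x(Suc r := y))) = 2 * pi * torus_kernel t (Suc r) * ?f r x" for x
  proof -
    have "(LINT y|lborel. complex_of_real (t (Suc r) / g (Suc (Suc r))) powr Complex (c (Suc r)) y * ?b x y) =
        2 * pi * (gker (\<beta> (Suc r)) (t (Suc r) / g (Suc (Suc r))) *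
          gker (\<alpha> (Suc r)) (g (Suc r) / g (Suc (Suc r)) / (t (Suc r) / g (Suc (Suc r)))) *
          complex_of_real (g (Suc r) / g (Suc (Suc r)) / (t (Suc r) / g (Suc (Suc r)))) powr (- vpt c x r))"
      using tp gp by (intro barnes_step(3) pos divide_pos_pos)
    moreover have "g (Suc r) / g (Suc (Suc r)) / (t (Suc r) / g (Suc (Suc r))) = g (Suc r) / t (Suc r)"
      using tp gp by simp
    ultimately show ?thesis
      unfolding upd integral_mult_right_zero torus_kernel_def by (simp only: mult_ac)
  qed
  have "(LINT y|PiM {1..Suc r} (\<lambda>_. lborel). ?f (Suc r) y) =
      (LINT x|PiM {1..r} (\<lambda>_. lborel). (LINT y|lborel. ?f (Suc r) (x(Suc r := y))))"
    using int unfolding ins by (intro LB.product_integral_insert) auto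
  also have "\<dots> = 2 * pi * torus_kernel t (Suc r) * (LINT x|PiM {1..r} (\<lambda>_. lborel). ?f r x)"
    unfolding inner integral_mult_right_zero ..
  also have "(LINT x|PiM {1..r} (\<lambda>_. lborel). ?f r x) = (2 * pi) ^ r * (\<Prod>j=1..r. torus_kernel t j)"
    by (rule Suc.IH[OF ok]) (use Suc.prems(2) in auto)
  finally show ?case by (simp add: mult_ac)
qed

text \<open>The arguments of \<open>f\<close> are the ratios that parametrize \<open>tmat\<close>.
  The guard keeps the function measurable, since \<open>f\<close> is controlled by its Mellin
  integrand only at positive arguments.\<close>

definition torus_integrand :: "nat \<Rightarrow> ((nat \<Rightarrow> real) \<Rightarrow> complex) \<Rightarrow> (nat \<Rightarrow> real) \<Rightarrow> complex" where
  "torus_integrand r f t = (if \<forall>j\<in>{1..Suc r}. 0 < t j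
     then f (\<lambda>j\<in>{1..r}. t j / t (Suc j)) * (\<Prod>j=1..Suc r. torus_kernel t j) else 0)"

lemma mult_haar_pow_component: "j \<in> {1..m} \<Longrightarrow> (\<lambda>t. t j) \<in> borel_measurable (mult_haar_pow m)"
  unfolding mult_haar_pow_def by (rule mult_haar_component_measurable)

text \<open>Measurability is known only for \<open>f\<close> times powers of the coordinates; on the
  positive orthant these powers can be divided out.\<close>

lemma positive_part_measurable:
  assumes f: "mellin_integrand r f z \<in> borel_measurable (mult_haar_pow r)"
  shows "(\<lambda>b. if \<forall>j\<in>{1..r}. 0 < b j then f b else 0) \<in> borel_measurable (mult_haar_pow r)"
proof -
  have q: "(\<lambda>b. \<Prod>j=1..r. complex_of_real (b j) powr (- z j)) \<in> borel_measurable (mult_haar_pow r)"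
    by (intro borel_measurable_prod measurable_of_real_powr mult_haar_pow_component) auto
  have s: "{b \<in> space (mult_haar_pow r). \<forall>j\<in>{1..r}. 0 < b j} \<in> sets (mult_haar_pow r)"
  proof (intro sets.sets_Collect_finite_All)
    fix j assume "j \<in> {1..r}"
    then have [measurable]: "(\<lambda>t. t j) \<in> borel_measurable (mult_haar_pow r)" by (rule mult_haar_pow_component)
    show "{b \<in> space (mult_haar_pow r). 0 < b j} \<in> sets (mult_haar_pow r)" by measurable
  qed simp
  have eq: "(\<lambda>b. if \<forall>j\<in>{1..r}. 0 < b j then f b else 0) =
     (\<lambda>b. if \<forall>j\<in>{1..r}. 0 < b j then mellin_integrand r f z b * (\<Prod>j=1..r. complex_of_real (b j) powr (- z j)) else 0)"
  proof (intro ext if_cong refl)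
    fix b :: "nat \<Rightarrow> real" assume "\<forall>j\<in>{1..r}. 0 < b j"
    then have "(\<Prod>j=1..r. complex_of_real (b j) powr z j) * (\<Prod>j=1..r. complex_of_real (b j) powr (- z j)) = 1"
      unfolding prod.distrib[symmetric] by (intro prod.neutral) (auto simp flip: powr_add)
    then show "f b = mellin_integrand r f z b * (\<Prod>j=1..r. complex_of_real (b j) powr (- z j))"
      by (simp only: mellin_integrand_def mult.assoc mult_1_right)
  qed
  show ?thesis
    unfolding eq by (rule measurable_If[OF borel_measurable_times[OF f q] borel_measurable_const s])
qed

lemma torus_integrand_measurable:
  assumes f: "mellin_integrand r f z \<in> borel_measurable (mult_haar_pow r)"
  shows "torus_integrand r f \<in> borel_measurable (mult_haar_pow (Suc r))"
proof -
  have comp: "(\<lambda>t. t j) \<in> borel_measurable (mult_haar_pow (Suc r))" if "j \<in> {1..Suc r}" for j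
    using that by (rule mult_haar_pow_component)
  have s: "{t \<in> space (mult_haar_pow (Suc r)). \<forall>j\<in>{1..Suc r}. 0 < t j} \<in> sets (mult_haar_pow (Suc r))"
  proof (intro sets.sets_Collect_finite_All)
    fix j assume "j \<in> {1..Suc r}"
    then have [measurable]: "(\<lambda>t. t j) \<in> borel_measurable (mult_haar_pow (Suc r))" by (rule comp)
    show "{b \<in> space (mult_haar_pow (Suc r)). 0 < b j} \<in> sets (mult_haar_pow (Suc r))" by measurable
  qed simp
  have q: "(\<lambda>t. \<lambda>j\<in>{1..r}. t j / t (Suc j)) \<in> mult_haar_pow (Suc r) \<rightarrow>\<^sub>M mult_haar_pow r"
    unfolding mult_haar_pow_def[of r]
  proof (rule measurable_restrict)
    fix j assume "j \<in> {1..r}"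
    then have "(\<lambda>t. t j / t (Suc j)) \<in> borel_measurable (mult_haar_pow (Suc r))"
      by (intro borel_measurable_divide comp) auto
    then show "(\<lambda>t. t j / t (Suc j)) \<in> mult_haar_pow (Suc r) \<rightarrow>\<^sub>M mult_haar"
      by (simp only: measurable_cong_sets[OF refl sets_mult_haar])
  qed
  have k: "(\<lambda>t. \<Prod>j=1..Suc r. torus_kernel t j) \<in> borel_measurable (mult_haar_pow (Suc r))"
  proof (rule borel_measurable_prod)
    fix j assume "j \<in> {1..Suc r}"
    then have [measurable]: "(\<lambda>t. t j) \<in> borel_measurable (mult_haar_pow (Suc r))" by (rule comp)
    show "(\<lambda>t. torus_kernel t j) \<in> borel_measurable (mult_haar_pow (Suc r))"
      unfolding torus_kernel_def by measurable
  qed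
  have eq: "torus_integrand r f = (\<lambda>t. if \<forall>j\<in>{1..Suc r}. 0 < t j
     then (\<lambda>b. if \<forall>j\<in>{1..r}. 0 < b j then f b else 0) (\<lambda>j\<in>{1..r}. t j / t (Suc j)) *
       (\<Prod>j=1..Suc r. torus_kernel t j) else 0)"
    by (auto simp: torus_integrand_def fun_eq_iff)
  show ?thesis
    unfolding eq
    by (intro measurable_If borel_measurable_times measurable_compose[OF q positive_part_measurable[OF f]] k s) simp
qed

text \<open>The Mellin transform of \<open>f\<close> and the last factor \<open>barnes\<close> are expanded into one integral
  over the torus. Since the remaining factors are absolutely integrable in \<open>z\<close>, the \<open>z\<close>-integral
  can be taken first, and the substitution \<open>t\<^sub>j = b\<^sub>j \<cdots> b\<^sub>m\<close> gives the formula.\<close>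

lemma vline_integral_chain:
  assumes ok: "chain_ok r" and gend: "g (Suc (Suc r)) = 1"
    and pos: "Re (\<alpha> (Suc r)) + (d (Suc r) - (if r = 0 then 0 else c r)) / 2 > 0" "Re (\<beta> (Suc r)) + d (Suc r) / 2 > 0"
    and f: "\<And>y. integrable (mult_haar_pow r) (mellin_integrand r f (vpt c y))"
  shows "vline_integral r c (\<lambda>z. mellin r f z * ((\<Prod>j=1..r. chain_factor j z) *
      barnes (g (Suc r)) (\<alpha> (Suc r)) (\<beta> (Suc r)) (d (Suc r)) (z r) 0)) =
    (LINT t|mult_haar_pow (Suc r). torus_integrand r f t)"
proof -
  let ?m = "Suc r"
  let ?Y = "PiM {1..r} (\<lambda>_. lborel :: real measure)"
  let ?p = "\<lambda>z v. gker (\<beta> ?m) v * gker (\<alpha> ?m) (g ?m / v) * complex_of_real (g ?m / v) powr (- z)"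
  let ?H = "\<lambda>y b. mellin_integrand r f (vpt c y) (restrict b {1..r}) * ?p (vpt c y r) (b ?m)"
  let ?C = "\<lambda>y. \<Prod>j=1..r. chain_factor j (vpt c y)"
  have ins: "{1..?m} = insert ?m {1..r}" by auto
  have gm: "g ?m > 0" by (rule g)
  have pos': "Re (\<alpha> ?m) + (d ?m - Re (vpt c y r)) / 2 > 0" for y using pos(1) by (simp add: Re_vpt)
  note bend = barnes_end[OF gm pos' pos(2)]
  have H: "integrable (mult_haar_pow ?m) (?H y)"
    "(LINT b|mult_haar_pow ?m. ?H y b) = mellin r f (vpt c y) *
       barnes (g ?m) (\<alpha> ?m) (\<beta> ?m) (d ?m) (vpt c y r) 0" for y
    using MH.product_mult_insert[OF _ _ f[of y, unfolded mult_haar_pow_def] bend(1)[of y], of ?m]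
    unfolding mult_haar_pow_def ins mellin_def bend(2)[symmetric] by auto
  interpret Y: finite_product_sigma_finite "\<lambda>_. lborel :: real measure" "{1..r}" by standard auto
  interpret B: finite_product_sigma_finite "\<lambda>_. mult_haar" "{1..?m}" by standard auto
  interpret P: pair_sigma_finite ?Y "mult_haar_pow ?m"
    unfolding mult_haar_pow_def by standard
  have comp: "(\<lambda>t. t j) \<in> borel_measurable (mult_haar_pow ?m)" if "j \<in> {1..?m}" for j
    using that by (rule mult_haar_pow_component)
  \<comment> \<open>At \<open>?y0\<close> all contour points are real. For positive b the absolute
    value of \<open>?E y b\<close> does not depend on y, and \<open>?F b\<close> vanishes otherwise,
    so the integrand at \<open>?y0\<close> dominates all others.\<close>
  let ?y0 = "\<lambda>_::nat. 0::real"
  let ?E = "\<lambda>y b. (\<Prod>j=1..r. complex_of_real (b j) powr vpt c y j) * complex_of_real (g ?m / b ?m) powr (- vpt c y r)"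
  let ?F = "\<lambda>b. (if \<forall>j\<in>{1..?m}. 0 < b j then f (restrict b {1..r}) else 0) * (gker (\<beta> ?m) (b ?m) * gker (\<alpha> ?m) (g ?m / b ?m))"
  have Hsplit: "?H y b = ?F b * ?E y b" if "\<forall>j\<in>{1..?m}. 0 < b j" for y b
    using that by (simp add: mellin_integrand_def mult_ac)
  have Fm: "?F \<in> borel_measurable (mult_haar_pow ?m)"
  proof -
    have r: "(\<lambda>b. restrict b {1..r}) \<in> mult_haar_pow ?m \<rightarrow>\<^sub>M mult_haar_pow r"
      unfolding mult_haar_pow_def by (rule measurable_restrict_subset) auto
    have [measurable]: "(\<lambda>b. b ?m) \<in> borel_measurable (mult_haar_pow ?m)" by (rule comp) simp
    have k: "(\<lambda>b. gker (\<beta> ?m) (b ?m) * gker (\<alpha> ?m) (g ?m / b ?m)) \<in> borel_measurable (mult_haar_pow ?m)" by measurable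
    have s: "{t \<in> space (mult_haar_pow ?m). \<forall>j\<in>{1..?m}. 0 < t j} \<in> sets (mult_haar_pow ?m)"
    proof (intro sets.sets_Collect_finite_All)
      fix j assume "j \<in> {1..?m}"
      then have [measurable]: "(\<lambda>t. t j) \<in> borel_measurable (mult_haar_pow ?m)" by (rule comp)
      show "{b \<in> space (mult_haar_pow ?m). 0 < b j} \<in> sets (mult_haar_pow ?m)" by measurable
    qed simp
    have eq: "(\<lambda>b. if \<forall>j\<in>{1..?m}. 0 < b j then f (restrict b {1..r}) else 0) =
      (\<lambda>b. if \<forall>j\<in>{1..?m}. 0 < b j then (\<lambda>b. if \<forall>j\<in>{1..r}. 0 < b j then f b else 0) (restrict b {1..r}) else 0)"
      by (auto simp: fun_eq_iff)
    have "(\<lambda>b. if \<forall>j\<in>{1..?m}. 0 < b j then f (restrict b {1..r}) else 0) \<in> borel_measurable (mult_haar_pow ?m)"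
      unfolding eq
      by (intro measurable_If measurable_compose[OF r positive_part_measurable[OF borel_measurable_integrable[OF f[of ?y0]]]] s) simp
    then show ?thesis by (rule borel_measurable_times[OF _ k])
  qed
  have Em: "(\<lambda>(y, b). ?E y b) \<in> borel_measurable (?Y \<Otimes>\<^sub>M mult_haar_pow ?m)"
  proof -
    have 1: "(\<lambda>q. vpt c (fst q) j) \<in> borel_measurable (?Y \<Otimes>\<^sub>M mult_haar_pow ?m)" if "j \<le> r" for j
      by (rule measurable_compose[OF measurable_fst vpt_measurable[OF that]])
    have 2: "(\<lambda>q. snd q j) \<in> borel_measurable (?Y \<Otimes>\<^sub>M mult_haar_pow ?m)" if "j \<in> {1..?m}" for j
      by (rule measurable_compose[OF measurable_snd comp[OF that]])
    show ?thesis
      unfolding case_prod_unfold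
      by (intro borel_measurable_times borel_measurable_prod measurable_of_real_powr borel_measurable_divide
          borel_measurable_uminus 1 2) auto
  qed
  have normE: "norm (?E y b) = norm (?E ?y0 b)" if "\<forall>j\<in>{1..?m}. 0 < b j" for y b
  proof -
    have "norm (\<Prod>j=1..r. complex_of_real (b j) powr vpt c y j) = (\<Prod>j=1..r. b j powr c j)" for y
      by (rule norm_phase) (use that in auto)
    moreover have "g ?m / b ?m > 0" using that gm by simp
    ultimately show ?thesis by (simp only: norm_mult norm_of_real_powr) (simp add: Re_vpt)
  qed
  have AEpos: "AE b in mult_haar_pow ?m. \<forall>j\<in>{1..?m}. 0 < b j" by (rule AE_mult_haar_pow_pos)
  have FEm: "(\<lambda>b. ?F b * ?E y b) \<in> borel_measurable (mult_haar_pow ?m)" for y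
    by (rule borel_measurable_times[OF Fm])
      (intro borel_measurable_times borel_measurable_prod measurable_of_real_powr borel_measurable_divide comp, auto)
  have FE0: "integrable (mult_haar_pow ?m) (\<lambda>b. ?F b * ?E ?y0 b)"
  proof (rule integrable_cong_AE_imp[OF H(1)[of ?y0]])
    show "AE b in mult_haar_pow ?m. ?H ?y0 b = ?F b * ?E ?y0 b"
      using AEpos by eventually_elim (rule Hsplit)
    show "(\<lambda>b. ?F b * ?E ?y0 b) \<in> borel_measurable (mult_haar_pow ?m)" by (rule FEm)
  qed
  have int: "integrable (?Y \<Otimes>\<^sub>M mult_haar_pow ?m) (\<lambda>(y, b). ?C y * (?F b * ?E y b))"
  proof (rule Bochner_Integration.integrable_bound)
    show "integrable (?Y \<Otimes>\<^sub>M mult_haar_pow ?m) (\<lambda>(y, b). ?C y * (?F b * ?E ?y0 b))"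
      by (rule P.integrable_prod_mult[OF chain_integrable[OF ok] FE0])
    have Cm: "(\<lambda>q. ?C (fst q)) \<in> borel_measurable (?Y \<Otimes>\<^sub>M mult_haar_pow ?m)"
      by (rule measurable_compose[OF measurable_fst borel_measurable_integrable[OF chain_integrable[OF ok]]])
    show "(\<lambda>(y, b). ?C y * (?F b * ?E y b)) \<in> borel_measurable (?Y \<Otimes>\<^sub>M mult_haar_pow ?m)"
      unfolding case_prod_unfold
      by (intro borel_measurable_times[OF Cm] borel_measurable_times[OF measurable_compose[OF measurable_snd Fm]]
         Em[unfolded case_prod_unfold])
    show "AE q in ?Y \<Otimes>\<^sub>M mult_haar_pow ?m. norm (case q of (y, b) \<Rightarrow> ?C y * (?F b * ?E y b)) \<le>
        norm (case q of (y, b) \<Rightarrow> ?C y * (?F b * ?E ?y0 b))"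
    proof (intro AE_I2)
      fix q :: "(nat \<Rightarrow> real) \<times> (nat \<Rightarrow> real)"
      obtain y b where q: "q = (y, b)" by (cases q)
      show "norm (case q of (y, b) \<Rightarrow> ?C y * (?F b * ?E y b)) \<le>
        norm (case q of (y, b) \<Rightarrow> ?C y * (?F b * ?E ?y0 b))"
      proof (cases "\<forall>j\<in>{1..?m}. 0 < b j")
        case True
        show ?thesis unfolding q prod.case norm_mult[of "?C _"] norm_mult[of "?F _"] normE[OF True, of y] by (rule order_refl)
      qed (simp only: q prod.case if_False mult_zero_left mult_zero_right)
    qed
  qed
  let ?t = "partial_prods ?m (Suc 0)"
  have tP: "?t \<in> mult_haar_pow ?m \<rightarrow>\<^sub>M mult_haar_pow ?m"
    "distr (mult_haar_pow ?m) (mult_haar_pow ?m) ?t = mult_haar_pow ?m"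
    using distr_partial_prods[of "Suc 0" ?m] by auto
  have inner: "(LINT y|?Y. ?C y * (?F b * ?E y b)) = (2 * pi) ^ r * torus_integrand r f (?t b)"
    if b: "\<forall>j\<in>{1..?m}. 0 < b j" and ext: "b \<in> extensional {1..?m}" for b
  proof -
    have tj: "?t b j = (\<Prod>i=j..?m. b i)" if "j \<in> {1..?m}" for j using that by (simp add: partial_prods_def)
    have tpos: "0 < ?t b j" if "j \<in> {1..?m}" for j
      unfolding tj[OF that] using that b by (intro prod_pos) auto
    have tm: "?t b ?m = b ?m" by (simp add: tj)
    have tq: "?t b j / ?t b (Suc j) = b j" if "j \<in> {1..r}" for j
    proof -
      have "?t b j = b j * ?t b (Suc j)" using that by (simp add: tj prod.atLeast_Suc_atMost)
      then show ?thesis using tpos[of "Suc j"] that by simp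
    qed
    have "(\<Prod>j=1..r. complex_of_real (b j) powr vpt c y j) = (\<Prod>j=1..r. complex_of_real (?t b j / ?t b (Suc j)) powr vpt c y j)" for y
      by (rule prod.cong) (simp_all only: tq)
    then have "(LINT y|?Y. ?C y * (?F b * ?E y b)) = ?F b * (LINT y|?Y. (\<Prod>j=1..r. complex_of_real (?t b j / ?t b (Suc j)) powr vpt c y j) *
        ?C y * complex_of_real (g ?m / ?t b ?m) powr (- vpt c y r))"
      by (simp only: tm integral_mult_right_zero[symmetric] mult_ac)
    also have "\<dots> = ?F b * ((2 * pi) ^ r * (\<Prod>j=1..r. torus_kernel (?t b) j))"
      by (subst chain_integral[OF ok tpos], assumption, rule refl)
    \<comment> \<open>Because g_(m+1) = 1, the two values of \<open>gker\<close> contained in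
      \<open>?F b\<close> are precisely \<open>torus_kernel\<close> at index m.\<close>
    also have "\<dots> = (2 * pi) ^ r * (f (restrict b {1..r}) * (\<Prod>j=1..?m. torus_kernel (?t b) j))"
      using b unfolding prod_atLeast1_Suc torus_kernel_def[of _ ?m] tm gend by simp
    finally have *: "(LINT y|?Y. ?C y * (?F b * ?E y b)) =
        (2 * pi) ^ r * (f (restrict b {1..r}) * (\<Prod>j=1..?m. torus_kernel (?t b) j))" .
    have "(\<lambda>j\<in>{1..r}. ?t b j / ?t b (Suc j)) = restrict b {1..r}"
      by (rule restrict_ext) (simp only: tq)
    then have "torus_integrand r f (?t b) = f (restrict b {1..r}) * (\<Prod>j=1..?m. torus_kernel (?t b) j)"
      unfolding torus_integrand_def using tpos by (subst if_P) (auto simp only:)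
    then show ?thesis unfolding * by (simp only:)
  qed
  have m1: "torus_integrand r f \<in> borel_measurable (mult_haar_pow ?m)"
    by (rule torus_integrand_measurable[OF borel_measurable_integrable[OF f[of ?y0]]])
  have "(LINT y|?Y. mellin r f (vpt c y) * (?C y * barnes (g ?m) (\<alpha> ?m) (\<beta> ?m) (d ?m) (vpt c y r) 0)) =
     (LINT y|?Y. (LINT b|mult_haar_pow ?m. ?C y * (?F b * ?E y b)))"
  proof (rule Bochner_Integration.integral_cong[OF refl])
    fix y
    have "(LINT b|mult_haar_pow ?m. ?F b * ?E y b) = (LINT b|mult_haar_pow ?m. ?H y b)"
    proof (rule integral_cong_AE[OF FEm borel_measurable_integrable[OF H(1)]])
      show "AE b in mult_haar_pow ?m. ?F b * ?E y b = ?H y b"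
        using AEpos by eventually_elim (rule Hsplit[symmetric])
    qed
    then show "mellin r f (vpt c y) * (?C y * barnes (g ?m) (\<alpha> ?m) (\<beta> ?m) (d ?m) (vpt c y r) 0) =
       (LINT b|mult_haar_pow ?m. ?C y * (?F b * ?E y b))"
      unfolding integral_mult_right_zero H(2) by (simp only: mult_ac)
  qed
  also have "\<dots> = (LINT b|mult_haar_pow ?m. (LINT y|?Y. ?C y * (?F b * ?E y b)))"
    using int by (rule P.Fubini_integral[symmetric])
  also have "\<dots> = (LINT b|mult_haar_pow ?m. (2 * pi) ^ r * torus_integrand r f (?t b))"
  proof (rule integral_cong_AE)
    show "(\<lambda>b. LINT y|?Y. ?C y * (?F b * ?E y b)) \<in> borel_measurable (mult_haar_pow ?m)"
      using P.integrable_snd[OF int] by (rule borel_measurable_integrable)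
    show "(\<lambda>b. (2 * pi) ^ r * torus_integrand r f (?t b)) \<in> borel_measurable (mult_haar_pow ?m)"
      by (intro borel_measurable_times measurable_compose[OF tP(1) m1]) auto
    show "AE b in mult_haar_pow ?m. (LINT y|?Y. ?C y * (?F b * ?E y b)) = (2 * pi) ^ r * torus_integrand r f (?t b)"
      using AEpos AE_space
    proof eventually_elim
      case (elim b)
      then show ?case by (intro inner) (auto simp: mult_haar_pow_def space_PiM PiE_def)
    qed
  qed
  also have "\<dots> = (2 * pi) ^ r * (LINT b|mult_haar_pow ?m. torus_integrand r f (?t b))"
    by simp
  also have "(LINT b|mult_haar_pow ?m. torus_integrand r f (?t b)) = (LINT t|mult_haar_pow ?m. torus_integrand r f t)"
    using integral_distr[OF tP(1) m1] unfolding tP(2) by simp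
  finally show ?thesis unfolding vline_integral_vpt by simp
qed

end

section \<open>Coefficients of the determinant of a bordered bidiagonal matrix\<close>

lemma lookup_single_times_add:
  fixes P :: "('a::cancel_comm_monoid_add) \<Rightarrow>\<^sub>0 ('b::comm_semiring_0)"
  shows "Poly_Mapping.lookup (Poly_Mapping.single a c * P) (a + b) = c * Poly_Mapping.lookup P b"
  by (simp add: lookup_mult lookup_single when_mult)

lemma lookup_single_times_zero:
  fixes P :: "('a::cancel_comm_monoid_add) \<Rightarrow>\<^sub>0 ('b::comm_semiring_0)"
  assumes "\<And>b. e \<noteq> a + b"
  shows "Poly_Mapping.lookup (Poly_Mapping.single a c * P) e = 0"
  using assms by (simp add: lookup_mult lookup_single when_mult)

lemma lookup_Cst_times: "Poly_Mapping.lookup (Cst c * P) e = c * Poly_Mapping.lookup P e"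
  using lookup_single_times_add[of 0 c P e] by (simp add: Cst_def)

lemma Cst_mult: "Cst (a * b) = Cst a * Cst b"
  by (simp add: Cst_def mult_single)

lemma Cst_add: "Cst (a + b) = Cst a + Cst b"
  by (simp add: Cst_def single_add)

lemma Cst_0 [simp]: "Cst 0 = 0"
  by (simp add: Cst_def)

lemma Cst_1 [simp]: "Cst 1 = 1"
  by (simp add: Cst_def)

lemma Cst_prod: "Cst (prod f A) = (\<Prod>x\<in>A. Cst (f x))"
  by (induction A rule: infinite_finite_induct) (auto simp: Cst_mult)

lemma Cst_power: "Cst (c ^ k) = Cst c ^ k"
  by (induction k) (auto simp: Cst_mult)

lemma Cst_uminus: "Cst (- c) = - Cst c"
  by (simp add: Cst_def single_uminus)

lemma lookup_monomial_exp: "Poly_Mapping.lookup (monomial_exp n l) j = (if j \<in> {1..n} then l j else 0)"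
  unfolding monomial_exp_def lookup_sum lookup_single when_def
  by (auto simp: if_distrib sum.delta cong: if_cong)

text \<open>The multinomial theorem. Splitting off one factor X_j contributes a term proportional to
  l_j, and these exponents add up to the degree.\<close>

lemma lookup_linear_power:
  assumes "(\<Sum>i=1..n. l i) = \<kappa>"
  shows "Poly_Mapping.lookup ((\<Sum>j=1..n. Var j * Cst (m j)) ^ \<kappa>) (monomial_exp n l) =
    fact \<kappa> / (\<Prod>i=1..n. fact (l i)) * (\<Prod>i=1..n. m i ^ l i)"
  using assms
proof (induction \<kappa> arbitrary: l)
  case 0
  then have "\<And>i. i \<in> {1..n} \<Longrightarrow> l i = 0" by auto
  moreover from this have "monomial_exp n l = 0" by (simp add: monomial_exp_def)
  ultimately show ?case by (simp add: lookup_one)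
next
  case (Suc \<kappa>)
  let ?L = "\<Sum>j=1..n. Var j * Cst (m j)"
  let ?P = "\<Prod>i=1..n. m i ^ l i" and ?F = "\<Prod>i=1..n. fact (l i) :: complex"
  have summand: "Poly_Mapping.lookup ((Var j * Cst (m j)) * ?L ^ \<kappa>) (monomial_exp n l) = fact \<kappa> * of_nat (l j) / ?F * ?P"
    if j: "j \<in> {1..n}" for j
  proof -
    have V: "Var j * Cst (m j) = Poly_Mapping.single (Poly_Mapping.single j 1) (m j)"
      by (simp add: Var_def Cst_def mult_single)
    show ?thesis
    proof (cases "l j = 0")
      case True
      have "monomial_exp n l \<noteq> Poly_Mapping.single j 1 + b" for b
      proof
        assume "monomial_exp n l = Poly_Mapping.single j 1 + b"
        then have "Poly_Mapping.lookup (monomial_exp n l) j = 1 + Poly_Mapping.lookup b j"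
          by (simp add: lookup_add)
        with True j show False by (simp add: lookup_monomial_exp)
      qed
      then show ?thesis unfolding V using True by (simp add: lookup_single_times_zero)
    next
      case False
      let ?l = "l(j := l j - 1)"
      have e: "monomial_exp n l = Poly_Mapping.single j 1 + monomial_exp n ?l"
        using False j by (intro poly_mapping_eqI) (auto simp: lookup_monomial_exp lookup_add lookup_single when_def)
      have fin: "{1..n} = insert j ({1..n} - {j})" using j by auto
      have "(\<Sum>i=1..n. l i) = l j + (\<Sum>i\<in>{1..n} - {j}. l i)" by (rule sum.remove) (use j in auto)
      moreover have "(\<Sum>i=1..n. ?l i) = (l j - 1) + (\<Sum>i\<in>{1..n} - {j}. l i)"
        by (subst sum.remove[of _ j]) (use j in \<open>auto intro!: sum.cong\<close>)
      ultimately have s: "(\<Sum>i=1..n. ?l i) = \<kappa>" using Suc.prems False by simp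
      have P: "m j * (\<Prod>i=1..n. m i ^ ?l i) = ?P"
      proof -
        have "(\<Prod>i=1..n. m i ^ ?l i) = m j ^ (l j - 1) * (\<Prod>i\<in>{1..n} - {j}. m i ^ l i)"
          by (subst prod.remove[of _ j]) (use j in \<open>auto intro!: prod.cong\<close>)
        moreover have "?P = m j ^ l j * (\<Prod>i\<in>{1..n} - {j}. m i ^ l i)"
          by (rule prod.remove) (use j in auto)
        moreover have "m j ^ l j = m j * m j ^ (l j - 1)" using False by (cases "l j") auto
        ultimately show ?thesis by (simp add: mult_ac)
      qed
      have F: "?F = of_nat (l j) * (\<Prod>i=1..n. fact (?l i))"
      proof -
        have "(\<Prod>i=1..n. fact (?l i) :: complex) = fact (l j - 1) * (\<Prod>i\<in>{1..n} - {j}. fact (l i))"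
          by (subst prod.remove[of _ j]) (use j in \<open>auto intro!: prod.cong\<close>)
        moreover have "?F = fact (l j) * (\<Prod>i\<in>{1..n} - {j}. fact (l i))"
          by (rule prod.remove) (use j in auto)
        moreover have "(fact (l j) :: complex) = of_nat (l j) * fact (l j - 1)" using False by (simp add: fact_reduce)
        ultimately show ?thesis by (simp add: mult_ac)
      qed
      have "Poly_Mapping.lookup ((Var j * Cst (m j)) * ?L ^ \<kappa>) (monomial_exp n l) =
         m j * (fact \<kappa> / (\<Prod>i=1..n. fact (?l i)) * (\<Prod>i=1..n. m i ^ ?l i))"
        unfolding V e lookup_single_times_add Suc.IH[OF s] ..
      also have "\<dots> = fact \<kappa> / (\<Prod>i=1..n. fact (?l i)) * ?P" unfolding P[symmetric] by simp
      also have "\<dots> = fact \<kappa> * of_nat (l j) / ?F * ?P" unfolding F using False by simp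
      finally show ?thesis .
    qed
  qed
  have "Poly_Mapping.lookup (?L ^ Suc \<kappa>) (monomial_exp n l) = (\<Sum>j=1..n. Poly_Mapping.lookup ((Var j * Cst (m j)) * ?L ^ \<kappa>) (monomial_exp n l))"
    by (simp add: sum_distrib_right lookup_sum)
  also have "\<dots> = (\<Sum>j=1..n. fact \<kappa> * of_nat (l j) / ?F * ?P)"
    by (rule sum.cong[OF refl summand])
  also have "\<dots> = fact \<kappa> * of_nat (\<Sum>j=1..n. l j) / ?F * ?P"
    by (simp add: sum_distrib_left sum_distrib_right sum_divide_distrib)
  finally show ?case unfolding Suc.prems by (simp add: algebra_simps)
qed

text \<open>The form that the matrix in \<open>phi\<close> takes after the Gaussian integration. The
  row of variables on top pushes the diagonal of the lower block below the diagonal of the whole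
  matrix.\<close>

definition bordered_bidiag :: "nat \<Rightarrow> (nat \<Rightarrow> 'a) \<Rightarrow> (nat \<Rightarrow> 'a) \<Rightarrow> (nat \<Rightarrow> 'a) \<Rightarrow> 'a::comm_ring_1 mat" where
  "bordered_bidiag n x a b = Matrix.mat n n (\<lambda>(i, j). if i = 0 then x j
     else if j = i - 1 then a (i - 1) else if j = i then b (i - 1) else 0)"

text \<open>The last column has two nonzero entries. The bottom one leaves the bordered matrix of
  smaller size; the top one leaves a triangular minor with the \<open>a i\<close> on its
  diagonal.\<close>

lemma det_bordered_bidiag:
  "Determinant.det (bordered_bidiag (Suc n) x a b) =
    (\<Sum>j\<le>n. (-1) ^ j * x j * (\<Prod>i<j. a i) * (\<Prod>i=j..<n. b i))"
proof (induction n)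
  case 0
  then show ?case by (simp add: bordered_bidiag_def det_single)
next
  case (Suc n)
  let ?A = "bordered_bidiag (Suc (Suc n)) x a b"
  have A: "?A \<in> carrier_mat (Suc (Suc n)) (Suc (Suc n))" by (simp add: bordered_bidiag_def)
  have "Determinant.det ?A = (\<Sum>i<Suc (Suc n). ?A $$ (i, Suc n) * cofactor ?A i (Suc n))"
    by (rule laplace_expansion_column[OF A]) simp
  also have "\<dots> = (\<Sum>i\<in>{0, Suc n}. ?A $$ (i, Suc n) * cofactor ?A i (Suc n))"
    by (rule sum.mono_neutral_right) (auto simp: bordered_bidiag_def)
  also have "\<dots> = x (Suc n) * cofactor ?A 0 (Suc n) + b n * cofactor ?A (Suc n) (Suc n)"
    by (simp add: bordered_bidiag_def)
  also have "cofactor ?A 0 (Suc n) = (-1) ^ Suc n * (\<Prod>i<Suc n. a i)"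
  proof -
    let ?B = "mat_delete ?A 0 (Suc n)"
    have B: "?B \<in> carrier_mat (Suc n) (Suc n)" by (simp add: mat_delete_def bordered_bidiag_def)
    have "upper_triangular ?B"
      by (auto simp: upper_triangular_def mat_delete_def bordered_bidiag_def)
    then have "Determinant.det ?B = prod_list (diag_mat ?B)" using B by (rule det_upper_triangular)
    also have "\<dots> = (\<Prod>i<Suc n. ?B $$ (i, i))"
      unfolding prod_list_diag_prod carrier_matD(1)[OF B] atLeast0LessThan ..
    also have "\<dots> = (\<Prod>i<Suc n. a i)"
      by (rule prod.cong) (auto simp: mat_delete_def bordered_bidiag_def)
    finally show ?thesis by (simp add: cofactor_def)
  qed
  also have "cofactor ?A (Suc n) (Suc n) = Determinant.det (bordered_bidiag (Suc n) x a b)"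
  proof -
    have "mat_delete ?A (Suc n) (Suc n) = bordered_bidiag (Suc n) x a b"
      by (rule eq_matI) (auto simp: mat_delete_def bordered_bidiag_def)
    then show ?thesis by (simp add: cofactor_def)
  qed
  finally show ?case
    unfolding Suc.IH by (simp add: sum_distrib_left algebra_simps)
qed

section \<open>Complex Gaussian moments\<close>

lemma lborel_complex_eq:
  "(lborel :: complex measure) = distr (lborel \<Otimes>\<^sub>M lborel) borel (\<lambda>(x, y). Complex x y)"
proof (rule lborel_eqI)
  fix l u :: complex
  assume le: "\<And>b. b \<in> Basis \<Longrightarrow> inner l b \<le> inner u b"
  have [simp]: "Re l \<le> Re u" "Im l \<le> Im u"
    using le[of 1] le[of \<i>] by (auto simp: Basis_complex_def)
  have m: "(\<lambda>(x, y). Complex x y) \<in> lborel \<Otimes>\<^sub>M lborel \<rightarrow>\<^sub>M borel" by measurable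
  have "(\<lambda>(x, y). Complex x y) -` box l u \<inter> space (lborel \<Otimes>\<^sub>M lborel) =
      {Re l<..<Re u} \<times> {Im l<..<Im u}"
    by (auto simp: box_def Basis_complex_def space_pair_measure)
  then have "emeasure (distr (lborel \<Otimes>\<^sub>M lborel) borel (\<lambda>(x, y). Complex x y)) (box l u) =
      emeasure (lborel \<Otimes>\<^sub>M lborel) ({Re l<..<Re u} \<times> {Im l<..<Im u})"
    by (subst emeasure_distr[OF m]) auto
  also have "\<dots> = ennreal (Re u - Re l) * ennreal (Im u - Im l)"
    by (subst lborel.emeasure_pair_measure_Times) simp_all
  also have "\<dots> = ennreal ((Re u - Re l) * (Im u - Im l))"
    by (rule ennreal_mult[symmetric]) simp_all
  also have "(Re u - Re l) * (Im u - Im l) = prod (inner (u - l)) Basis"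
    by (simp add: Basis_complex_def)
  finally show "emeasure (distr (lborel \<Otimes>\<^sub>M lborel) borel (\<lambda>(x, y). Complex x y)) (box l u) =
      ennreal (prod (inner (u - l)) Basis)" .
qed simp

text \<open>The 2 in the phase comes from z + cnj z = 2 Re z, so that \<open>cgauss\<close> splits
  into \<open>gauss1 \<alpha> \<beta>\<close> and \<open>gauss1 \<alpha> 0\<close>.\<close>

definition gauss1 :: "real \<Rightarrow> real \<Rightarrow> real \<Rightarrow> complex" where
  "gauss1 \<alpha> \<beta> x = complex_of_real (exp (- \<alpha> * x\<^sup>2)) * cis (- 2 * \<beta> * x)"

lemma gauss1_measurable [measurable]: "gauss1 \<alpha> \<beta> \<in> borel_measurable borel"
proof -
  have [measurable]: "cis \<in> borel_measurable borel"
    by (intro borel_measurable_continuous_onI) (simp add: continuous_intros)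
  have "(\<lambda>x. complex_of_real (exp (- \<alpha> * x\<^sup>2)) * cis (- 2 * \<beta> * x)) \<in> borel_measurable borel" by measurable
  then show ?thesis by (subst gauss1_def[abs_def])
qed

lemma gauss1_integral:
  assumes "\<alpha> > 0"
  shows "(LINT x|lborel. gauss1 \<alpha> \<beta> x) = complex_of_real (sqrt (pi / \<alpha>) * exp (- \<beta>\<^sup>2 / \<alpha>))"
proof -
  have "gauss1 \<alpha> \<beta> x = complex_of_real (exp (- (sqrt (2 * \<alpha>) * x)\<^sup>2 / 2)) * cis (x * (- 2 * \<beta>))" for x
    using assms by (simp add: gauss1_def power_mult_distrib mult_ac)
  then have "(LINT x|lborel. gauss1 \<alpha> \<beta> x) = complex_of_real (sqrt (2 * pi) / sqrt (2 * \<alpha>) * exp (- ((- 2 * \<beta>) / sqrt (2 * \<alpha>))\<^sup>2 / 2))"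
    using gaussian_fourier(2)[of "sqrt (2 * \<alpha>)" "- 2 * \<beta>"] assms by simp
  moreover have "- ((- 2 * \<beta>) / sqrt (2 * \<alpha>))\<^sup>2 / 2 = - \<beta>\<^sup>2 / \<alpha>"
    using assms by (simp add: power_divide power_mult_distrib field_simps)
  moreover have "sqrt (2 * pi) / sqrt (2 * \<alpha>) = sqrt (pi / \<alpha>)"
    using assms by (simp add: real_sqrt_mult real_sqrt_divide)
  ultimately show ?thesis by simp
qed

lemma gauss_power_integrable:
  assumes "\<alpha> > 0"
  shows "integrable lborel (\<lambda>x. x ^ k * exp (- \<alpha> * x\<^sup>2) :: real)"
proof -
  define \<sigma> where "\<sigma> = 1 / sqrt (2 * \<alpha>)"
  have \<sigma>: "\<sigma> > 0" "2 * \<sigma>\<^sup>2 = 1 / \<alpha>" using assms by (auto simp: \<sigma>_def power_divide)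
  have "integrable lborel (\<lambda>x. sqrt (2 * pi * \<sigma>\<^sup>2) * (normal_density 0 \<sigma> x * (x - 0) ^ k))"
    using \<sigma> by (intro integrable_mult_right integrable_normal_moment)
  moreover have "sqrt (2 * pi * \<sigma>\<^sup>2) * (normal_density 0 \<sigma> x * (x - 0) ^ k) = x ^ k * exp (- \<alpha> * x\<^sup>2)" for x
  proof -
    have "- (x - 0)\<^sup>2 / (2 * \<sigma>\<^sup>2) = - \<alpha> * x\<^sup>2" unfolding \<sigma>(2) using assms by simp
    then show ?thesis using \<sigma>(1) by (simp add: normal_density_def)
  qed
  ultimately show ?thesis by (simp only:)
qed

lemma gauss1_power_integrable:
  assumes "\<alpha> > 0"
  shows "integrable lborel (\<lambda>x. complex_of_real x ^ k * gauss1 \<alpha> \<beta> x)"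
proof (rule Bochner_Integration.integrable_bound[OF gauss_power_integrable[OF assms, of k]])
  show "AE x in lborel. norm (complex_of_real x ^ k * gauss1 \<alpha> \<beta> x) \<le> norm (x ^ k * exp (- \<alpha> * x\<^sup>2))"
    by (intro AE_I2) (simp add: gauss1_def norm_mult norm_power abs_mult power_abs)
qed measurable

lemma gauss1_shift_integrable:
  assumes "\<alpha> > 0"
  shows "integrable lborel (\<lambda>x. (complex_of_real x + w) ^ k * gauss1 \<alpha> \<beta> x)"
proof -
  have "integrable lborel (\<lambda>x. \<Sum>j\<le>k. (of_nat (k choose j) * w ^ (k - j)) * (complex_of_real x ^ j * gauss1 \<alpha> \<beta> x))"
    using gauss1_power_integrable[OF assms] by (intro Bochner_Integration.integrable_sum integrable_mult_right)
  also have "(\<lambda>x. \<Sum>j\<le>k. (of_nat (k choose j) * w ^ (k - j)) * (complex_of_real x ^ j * gauss1 \<alpha> \<beta> x)) =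
      (\<lambda>x. (complex_of_real x + w) ^ k * gauss1 \<alpha> \<beta> x)"
    unfolding binomial_ring sum_distrib_right by (intro ext sum.cong) (simp_all add: mult_ac)
  finally show ?thesis .
qed

lemma gauss1_tendsto_0:
  assumes "\<alpha> > 0"
  shows "((\<lambda>x. (complex_of_real x + w) ^ m * gauss1 \<alpha> \<beta> x) \<longlongrightarrow> 0) at_top"
proof (rule Lim_null_comparison)
  have "((\<lambda>x. (2 / \<alpha>) ^ m * ((\<alpha> * x) ^ m / exp (\<alpha> * x))) \<longlongrightarrow> (2 / \<alpha>) ^ m * 0) at_top"
    by (intro tendsto_mult tendsto_const filterlim_compose[OF tendsto_power_div_exp_0]
        filterlim_tendsto_pos_mult_at_top[OF tendsto_const assms] filterlim_ident)
  then show "((\<lambda>x. (2 / \<alpha>) ^ m * ((\<alpha> * x) ^ m / exp (\<alpha> * x))) \<longlongrightarrow> 0) at_top" by simp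
  show "\<forall>\<^sub>F x in at_top. norm ((complex_of_real x + w) ^ m * gauss1 \<alpha> \<beta> x) \<le> (2 / \<alpha>) ^ m * ((\<alpha> * x) ^ m / exp (\<alpha> * x))"
    using eventually_ge_at_top[of "max 1 (norm w)"]
  proof eventually_elim
    case (elim x)
    have "norm (complex_of_real x + w) \<le> 2 * x"
      using norm_triangle_ineq[of "complex_of_real x" w] elim by simp
    then have "norm (complex_of_real x + w) ^ m \<le> (2 * x) ^ m" by (intro power_mono) auto
    moreover have "exp (- \<alpha> * x\<^sup>2) \<le> exp (- (\<alpha> * x))"
      using elim assms by (simp add: power2_eq_square)
    ultimately have "norm ((complex_of_real x + w) ^ m * gauss1 \<alpha> \<beta> x) \<le> (2 * x) ^ m * exp (- (\<alpha> * x))"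
      unfolding gauss1_def norm_mult norm_power norm_cis using elim by (simp add: mult_mono)
    also have "\<dots> = (2 / \<alpha>) ^ m * ((\<alpha> * x) ^ m / exp (\<alpha> * x))"
      using assms by (simp add: power_mult_distrib power_divide exp_minus field_simps)
    finally show ?case .
  qed
qed

text \<open>The integrand is the derivative of (x + w)^m times \<open>gauss1\<close>, which vanishes
  at both ends. The complex shift \<open>w\<close> will carry the other real coordinate of
  z.\<close>

lemma gauss1_ibp:
  assumes "\<alpha> > 0"
  shows "(LINT x|lborel. (of_nat m * (complex_of_real x + w) ^ (m - 1) -
    (2 * \<alpha> * x + 2 * \<i> * \<beta>) * (complex_of_real x + w) ^ m) * gauss1 \<alpha> \<beta> x) = 0"
proof -
  let ?F = "\<lambda>x. (complex_of_real x + w) ^ m * gauss1 \<alpha> \<beta> x"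
  let ?f = "\<lambda>x. (of_nat m * (complex_of_real x + w) ^ (m - 1) -
    (2 * \<alpha> * x + 2 * \<i> * \<beta>) * (complex_of_real x + w) ^ m) * gauss1 \<alpha> \<beta> x"
  have g: "gauss1 \<alpha> \<beta> x = exp (- of_real \<alpha> * (complex_of_real x)\<^sup>2 - 2 * \<i> * \<beta> * of_real x)" for x
    by (simp add: gauss1_def cis_conv_exp exp_diff exp_minus exp_add[symmetric] flip: exp_of_real)
       (simp add: exp_minus field_simps)
  have int: "integrable lborel ?f"
  proof -
    have eq: "?f x = of_nat m * ((complex_of_real x + w) ^ (m - 1) * gauss1 \<alpha> \<beta> x)
      - 2 * \<alpha> * ((complex_of_real x + w) ^ Suc m * gauss1 \<alpha> \<beta> x)
      + (2 * \<alpha> * w - 2 * \<i> * \<beta>) * ((complex_of_real x + w) ^ m * gauss1 \<alpha> \<beta> x)" for x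
      by (simp add: algebra_simps)
    show ?thesis unfolding eq
      by (intro Bochner_Integration.integrable_add Bochner_Integration.integrable_diff integrable_mult_right
          gauss1_shift_integrable assms)
  qed
  have "(LBINT x=-\<infinity>..\<infinity>. ?f x) = 0 - 0"
  proof (rule interval_integral_FTC_integrable)
    fix x :: real
    have "((\<lambda>z. (z + w) ^ m * exp (- of_real \<alpha> * z\<^sup>2 - 2 * \<i> * \<beta> * z)) has_field_derivative ?f x) (at (complex_of_real x))"
      unfolding g
      by (auto intro!: derivative_eq_intros simp: algebra_simps power2_eq_square)
    then have "((\<lambda>x. (complex_of_real x + w) ^ m * exp (- of_real \<alpha> * (complex_of_real x)\<^sup>2 - 2 * \<i> * \<beta> * of_real x)) has_vector_derivative ?f x) (at x)"
      by (rule has_vector_derivative_real_field)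
    then show "(?F has_vector_derivative ?f x) (at x)" unfolding g .
    show "isCont ?f x" unfolding g by (intro continuous_intros)
  next
    show "set_integrable lborel (einterval (- \<infinity>) \<infinity>) ?f" using int by (simp add: set_integrable_def)
    \<comment> \<open>The limit at minus infinity is the limit at plus infinity after x -> - x,
      which negates \<open>w\<close> and \<open>\<beta>\<close>.\<close>
    have "((\<lambda>x. (- 1) ^ m * ((complex_of_real x + (- w)) ^ m * gauss1 \<alpha> (- \<beta>) x)) \<longlongrightarrow> (- 1) ^ m * 0) at_top"
      by (intro tendsto_mult tendsto_const gauss1_tendsto_0 assms)
    also have "(\<lambda>x. (- 1) ^ m * ((complex_of_real x + (- w)) ^ m * gauss1 \<alpha> (- \<beta>) x)) = (\<lambda>x. ?F (- x))"
    proof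
      fix x :: real
      have "(complex_of_real (- x) + w) ^ m = (- 1) ^ m * (complex_of_real x + (- w)) ^ m"
        by (simp flip: power_mult_distrib)
      then show "(- 1) ^ m * ((complex_of_real x + (- w)) ^ m * gauss1 \<alpha> (- \<beta>) x) = ?F (- x)"
        by (simp add: gauss1_def)
    qed
    finally have "(?F \<longlongrightarrow> 0) at_bot" by (simp add: filterlim_at_bot_mirror)
    then show "((?F \<circ> real_of_ereal) \<longlongrightarrow> 0) (at_right (- \<infinity>))"
      by (simp add: ereal_tendsto_simps)
    show "((?F \<circ> real_of_ereal) \<longlongrightarrow> 0) (at_left \<infinity>)"
      using gauss1_tendsto_0[OF assms] by (simp add: ereal_tendsto_simps)
  qed simp
  then show ?thesis by (simp add: interval_lebesgue_integral_def set_lebesgue_integral_def)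
qed

lemma cnj_measurable [measurable]: "cnj \<in> borel_measurable borel"
  by (intro borel_measurable_continuous_onI linear_continuous_on bounded_linear_cnj)

context
  fixes \<alpha> \<beta> :: real
  assumes \<alpha>: "\<alpha> > 0"
begin

text \<open>The contribution of one unipotent coordinate: a Gaussian from \<open>phi\<close> times
  the inverse of the additive character.\<close>

definition cgauss :: "complex \<Rightarrow> complex" where
  "cgauss z = complex_of_real (exp (- \<alpha> * (cmod z)\<^sup>2)) * exp (- \<i> * \<beta> * (z + cnj z))"

lemma cgauss_Complex: "cgauss (Complex x y) = gauss1 \<alpha> \<beta> x * gauss1 \<alpha> 0 y"
proof -
  have "(cmod (Complex x y))\<^sup>2 = x\<^sup>2 + y\<^sup>2" by (simp add: cmod_def)
  then have "exp (- \<alpha> * (cmod (Complex x y))\<^sup>2) = exp (- \<alpha> * x\<^sup>2) * exp (- \<alpha> * y\<^sup>2)"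
    by (simp add: distrib_left exp_add exp_diff exp_minus divide_inverse)
  moreover have "- \<i> * \<beta> * (Complex x y + cnj (Complex x y)) = \<i> * complex_of_real (- 2 * \<beta> * x)"
    by (simp add: complex_eq_iff)
  ultimately show ?thesis by (simp only: cgauss_def gauss1_def cis_conv_exp of_real_mult) simp
qed

lemma cgauss_measurable [measurable]: "cgauss \<in> borel_measurable borel"
proof -
  have "(\<lambda>z. complex_of_real (exp (- \<alpha> * (cmod z)\<^sup>2)) * exp (- \<i> * \<beta> * (z + cnj z))) \<in> borel_measurable borel"
    by measurable
  then show ?thesis by (subst cgauss_def[abs_def])
qed

text \<open>The additional powers of x and y let integrability be shown by induction on
  \<open>k\<close>: one factor x - i y raises either \<open>a\<close> or \<open>b\<close>.\<close>

definition gmom :: "nat \<Rightarrow> nat \<Rightarrow> nat \<Rightarrow> real \<times> real \<Rightarrow> complex" where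
  "gmom a b k p = of_real (fst p) ^ a * of_real (snd p) ^ b *
     ((of_real (fst p) - \<i> * of_real (snd p)) ^ k * (gauss1 \<alpha> \<beta> (fst p) * gauss1 \<alpha> 0 (snd p)))"

lemma gmom_integrable: "integrable (lborel \<Otimes>\<^sub>M lborel) (gmom a b k)"
proof (induction k arbitrary: a b)
  case 0
  have "gmom a b 0 = (\<lambda>(x, y). (of_real x ^ a * gauss1 \<alpha> \<beta> x) * (of_real y ^ b * gauss1 \<alpha> 0 y))"
    by (simp add: gmom_def fun_eq_iff)
  then show ?case
    using lborel_pair.integrable_prod_mult[OF gauss1_power_integrable[OF \<alpha>] gauss1_power_integrable[OF \<alpha>]]
    by (simp only:)
next
  case (Suc k)
  have "gmom a b (Suc k) = (\<lambda>p. gmom (Suc a) b k p - \<i> * gmom a (Suc b) k p)"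
    by (simp add: gmom_def fun_eq_iff algebra_simps)
  then show ?case using Suc by (simp only:) (intro Bochner_Integration.integrable_diff integrable_mult_right)
qed

lemma gmom_integral_fst: "(LINT p|(lborel \<Otimes>\<^sub>M lborel). F p) = (LINT x|lborel. LINT y|lborel. F (x, y))"
  and gmom_integral_snd: "(LINT p|(lborel \<Otimes>\<^sub>M lborel). F p) = (LINT y|lborel. LINT x|lborel. F (x, y))"
  if "integrable (lborel \<Otimes>\<^sub>M lborel) F" for F :: "real \<times> real \<Rightarrow> complex"
  using lborel_pair.integral_fst'[OF that] lborel_pair.integral_snd[of "\<lambda>x y. F (x, y)"] that by simp_all

lemma cgauss_moment_coords:
  shows "integrable lborel (\<lambda>z. cnj z ^ k * cgauss z)"
    and "(LINT z|lborel. cnj z ^ k * cgauss z) = (LINT p|(lborel \<Otimes>\<^sub>M lborel). gmom 0 0 k p)"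
proof -
  have m: "(\<lambda>(x, y). Complex x y) \<in> lborel \<Otimes>\<^sub>M lborel \<rightarrow>\<^sub>M borel" by measurable
  have f: "(\<lambda>z. cnj z ^ k * cgauss z) \<in> borel_measurable borel" by measurable
  have eq: "(\<lambda>z. cnj z ^ k * cgauss z) ((\<lambda>(x, y). Complex x y) p) = gmom 0 0 k p" for p
  proof -
    have "cnj (Complex x y) = complex_of_real x - \<i> * of_real y" for x y by (simp add: complex_eq_iff)
    then show ?thesis by (cases p) (simp add: gmom_def cgauss_Complex)
  qed
  show "integrable lborel (\<lambda>z. cnj z ^ k * cgauss z)"
    unfolding lborel_complex_eq integrable_distr_eq[OF m f] eq by (rule gmom_integrable)
  show "(LINT z|lborel. cnj z ^ k * cgauss z) = (LINT p|(lborel \<Otimes>\<^sub>M lborel). gmom 0 0 k p)"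
    unfolding lborel_complex_eq integral_distr[OF m f] eq ..
qed

text \<open>Pure moments in \<open>cnj z\<close> satisfy a two-term recursion, obtained by
  integrating by parts in both real coordinates, and are therefore geometric in
  \<open>k\<close>.\<close>

lemma cgauss_moment:
  "(LINT z|lborel. cnj z ^ k * cgauss z) = of_real (pi / \<alpha> * exp (- \<beta>\<^sup>2 / \<alpha>)) * (- \<i> * \<beta> / \<alpha>) ^ k"
proof (induction k)
  case 0
  have "(LINT z|lborel. cnj z ^ 0 * cgauss z) = (LINT x|lborel. LINT y|lborel. gauss1 \<alpha> \<beta> x * gauss1 \<alpha> 0 y)"
    unfolding cgauss_moment_coords(2) gmom_integral_fst[OF gmom_integrable] by (simp add: gmom_def)
  also have "\<dots> = (LINT x|lborel. gauss1 \<alpha> \<beta> x) * (LINT y|lborel. gauss1 \<alpha> 0 y)" by simp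
  also have "\<dots> = of_real (pi / \<alpha> * exp (- \<beta>\<^sup>2 / \<alpha>))"
  proof -
    define q where "q = sqrt (pi / \<alpha>)"
    have "q * q = pi / \<alpha>" unfolding q_def real_sqrt_mult_self using \<alpha> by simp
    then have "(q * q) * exp (- \<beta>\<^sup>2 / \<alpha>) = pi / \<alpha> * exp (- \<beta>\<^sup>2 / \<alpha>)" by (simp only:)
    moreover have "exp (- 0\<^sup>2 / \<alpha>) = 1" by simp
    ultimately have "q * exp (- \<beta>\<^sup>2 / \<alpha>) * (q * exp (- 0\<^sup>2 / \<alpha>)) = pi / \<alpha> * exp (- \<beta>\<^sup>2 / \<alpha>)"
      by (simp only: mult_1_right mult_ac)
    then show ?thesis unfolding gauss1_integral[OF \<alpha>] q_def[symmetric] by (simp only: of_real_mult[symmetric])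
  qed
  finally show ?case by simp
next
  case (Suc k)
  define A B :: complex where "A = 2 * of_real \<alpha>" and "B = 2 * \<i> * of_real \<beta>"
  define D1 where "D1 p = of_nat k * gmom 0 0 (k - 1) p - A * gmom 1 0 k p - B * gmom 0 0 k p" for p
  define D2 where "D2 p = - \<i> * of_nat k * gmom 0 0 (k - 1) p - A * gmom 0 1 k p" for p
  text \<open>\<open>D1\<close> and \<open>D2\<close> are the partial derivatives of the integrand, and
    \<open>\<partial>\<^sub>x - \<i> \<partial>\<^sub>y\<close> annihilates powers of \<open>x - \<i> y\<close>.\<close>
  have D1: "integrable (lborel \<Otimes>\<^sub>M lborel) D1"
    unfolding D1_def by (intro Bochner_Integration.integrable_diff integrable_mult_right gmom_integrable)
  have D2: "integrable (lborel \<Otimes>\<^sub>M lborel) D2"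
    unfolding D2_def by (intro Bochner_Integration.integrable_diff integrable_mult_right gmom_integrable)
  have I1: "(LINT p|(lborel \<Otimes>\<^sub>M lborel). D1 p) = 0"
  proof -
    have "D1 (x, y) = gauss1 \<alpha> 0 y * ((of_nat k * (of_real x + (- \<i> * of_real y)) ^ (k - 1) -
       (2 * \<alpha> * x + 2 * \<i> * \<beta>) * (of_real x + (- \<i> * of_real y)) ^ k) * gauss1 \<alpha> \<beta> x)" for x y
      by (simp add: D1_def gmom_def A_def B_def algebra_simps)
    then show ?thesis
      unfolding gmom_integral_snd[OF D1] using gauss1_ibp[OF \<alpha>, of k "- \<i> * of_real y" \<beta> for y]
      by (simp add: integral_mult_right_zero)
  qed
  have I2: "(LINT p|(lborel \<Otimes>\<^sub>M lborel). D2 p) = 0"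
  proof -
    \<comment> \<open>This rewriting puts the derivative in y into the form of
      \<open>gauss1_ibp\<close> with \<beta> = 0 and shift i x.\<close>
    have u: "of_real x - \<i> * of_real y = - \<i> * (of_real y + \<i> * of_real x)" for x y by (simp add: algebra_simps)
    have "D2 (x, y) = ((- \<i>) ^ k * gauss1 \<alpha> \<beta> x) * ((of_nat k * (of_real y + \<i> * of_real x) ^ (k - 1) -
       (2 * \<alpha> * y + 2 * \<i> * (0::real)) * (of_real y + \<i> * of_real x) ^ k) * gauss1 \<alpha> 0 y)" for x y
    proof (cases k)
      case (Suc k')
      show ?thesis unfolding D2_def gmom_def fst_conv snd_conv u power_mult_distrib Suc
        by (simp add: A_def algebra_simps)
    qed (simp add: D2_def gmom_def A_def)
    then show ?thesis
      unfolding gmom_integral_fst[OF D2] using gauss1_ibp[OF \<alpha>, of k "\<i> * of_real x" 0 for x]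
      by (simp add: integral_mult_right_zero)
  qed
  have comb: "D1 p - \<i> * D2 p = - A * gmom 0 0 (Suc k) p - B * gmom 0 0 k p" for p
    by (simp add: D1_def D2_def gmom_def algebra_simps)
  have "0 = (LINT p|(lborel \<Otimes>\<^sub>M lborel). D1 p - \<i> * D2 p)"
    using D1 D2 by (subst Bochner_Integration.integral_diff) (simp_all add: I1 I2)
  also have "\<dots> = - A * (LINT p|(lborel \<Otimes>\<^sub>M lborel). gmom 0 0 (Suc k) p) - B * (LINT p|(lborel \<Otimes>\<^sub>M lborel). gmom 0 0 k p)"
    unfolding comb
    by (subst Bochner_Integration.integral_diff) (intro integrable_mult_right gmom_integrable, intro integrable_mult_right gmom_integrable, simp only: integral_mult_right_zero)
  finally have "A * (LINT z|lborel. cnj z ^ Suc k * cgauss z) = - B * (LINT z|lborel. cnj z ^ k * cgauss z)"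
    unfolding cgauss_moment_coords(2) by (simp only: minus_mult_left[symmetric]) (simp add: algebra_simps)
  then show ?case unfolding Suc.IH A_def B_def using \<alpha> by (simp add: field_simps)
qed

end

text \<open>One list of terms, with coefficients in \<open>cpoly\<close> independent of
  \<open>v\<close>, serves both for integrating over conjugates and for evaluating at a
  point.\<close>

definition conj_poly :: "'i set \<Rightarrow> (('i \<Rightarrow> complex) \<Rightarrow> cpoly) \<Rightarrow> bool" where
  "conj_poly S R \<longleftrightarrow> (\<exists>ts. \<forall>v. R v = (\<Sum>(C, e)\<leftarrow>ts. C * Cst (\<Prod>s\<in>S. v s ^ e s)))"

lemma conj_poly_const: "conj_poly S (\<lambda>_. C)"
  unfolding conj_poly_def by (rule exI[of _ "[(C, \<lambda>_. 0)]"]) simp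

lemma conj_poly_var:
  assumes "finite S" "s \<in> S"
  shows "conj_poly S (\<lambda>v. Cst (v s))"
proof -
  have "(\<Prod>s'\<in>S. v s' ^ (if s' = s then 1 else 0)) = v s" for v :: "'a \<Rightarrow> complex"
  proof -
    have "(\<Prod>s'\<in>S. v s' ^ (if s' = s then 1 else 0)) = (\<Prod>s'\<in>S. if s' = s then v s' else 1)"
      by (rule prod.cong) auto
    then show ?thesis using assms by (simp add: prod.delta)
  qed
  then show ?thesis
    unfolding conj_poly_def by (intro exI[of _ "[(1, \<lambda>s'. if s' = s then 1 else 0)]"]) simp
qed

lemma conj_poly_add: "conj_poly S R \<Longrightarrow> conj_poly S R' \<Longrightarrow> conj_poly S (\<lambda>v. R v + R' v)"
  unfolding conj_poly_def
proof (elim exE)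
  fix ts ts'
  assume "\<forall>v. R v = (\<Sum>(C, e)\<leftarrow>ts. C * Cst (\<Prod>s\<in>S. v s ^ e s))"
    "\<forall>v. R' v = (\<Sum>(C, e)\<leftarrow>ts'. C * Cst (\<Prod>s\<in>S. v s ^ e s))"
  then show "\<exists>ts. \<forall>v. R v + R' v = (\<Sum>(C, e)\<leftarrow>ts. C * Cst (\<Prod>s\<in>S. v s ^ e s))"
    by (intro exI[of _ "ts @ ts'"]) simp
qed

lemma conj_poly_mult:
  assumes "conj_poly S R" "conj_poly S R'"
  shows "conj_poly S (\<lambda>v. R v * R' v)"
proof -
  obtain ts ts' where ts: "\<And>v. R v = (\<Sum>(C, e)\<leftarrow>ts. C * Cst (\<Prod>s\<in>S. v s ^ e s))"
    and ts': "\<And>v. R' v = (\<Sum>(C, e)\<leftarrow>ts'. C * Cst (\<Prod>s\<in>S. v s ^ e s))"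
    using assms unfolding conj_poly_def by blast
  have one: "conj_poly S (\<lambda>v. (D * Cst (\<Prod>s\<in>S. v s ^ f s)) * R' v)" for D f
  proof -
    have "(D * Cst (\<Prod>s\<in>S. v s ^ f s)) * (\<Sum>(C, e)\<leftarrow>us. C * Cst (\<Prod>s\<in>S. v s ^ e s)) =
       (\<Sum>(C, e)\<leftarrow>map (\<lambda>(C, e). (D * C, \<lambda>s. f s + e s)) us. C * Cst (\<Prod>s\<in>S. v s ^ e s))" for v :: "'a \<Rightarrow> complex" and us
    proof (induction us)
      case (Cons a us)
      obtain C e where a: "a = (C, e)" by (cases a)
      have "(\<Prod>s\<in>S. v s ^ (f s + e s)) = (\<Prod>s\<in>S. v s ^ f s) * (\<Prod>s\<in>S. v s ^ e s)"
        by (simp add: power_add prod.distrib)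
      with Cons show ?case by (simp add: a Cst_mult algebra_simps)
    qed simp
    then show ?thesis unfolding conj_poly_def ts' by blast
  qed
  have "conj_poly S (\<lambda>v. (\<Sum>(C, e)\<leftarrow>us. C * Cst (\<Prod>s\<in>S. v s ^ e s)) * R' v)" for us
  proof (induction us)
    case Nil
    then show ?case using conj_poly_const[of S 0] by simp
  next
    case (Cons a us)
    obtain C e where a: "a = (C, e)" by (cases a)
    show ?case using conj_poly_add[OF one[of C e] Cons] by (simp add: a algebra_simps)
  qed
  then show ?thesis using ts by simp
qed

lemma conj_poly_sum: "(\<And>i. i \<in> I \<Longrightarrow> conj_poly S (R i)) \<Longrightarrow> conj_poly S (\<lambda>v. \<Sum>i\<in>I. R i v)"
  by (induction I rule: infinite_finite_induct) (auto intro: conj_poly_const conj_poly_add)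

lemma conj_poly_prod: "(\<And>i. i \<in> I \<Longrightarrow> conj_poly S (R i)) \<Longrightarrow> conj_poly S (\<lambda>v. \<Prod>i\<in>I. R i v)"
  by (induction I rule: infinite_finite_induct) (auto intro: conj_poly_const conj_poly_mult)

lemma conj_poly_power: "conj_poly S R \<Longrightarrow> conj_poly S (\<lambda>v. R v ^ k)"
  by (induction k) (auto intro: conj_poly_const conj_poly_mult)

lemma conj_poly_det:
  assumes "\<And>i j. i < n \<Longrightarrow> j < n \<Longrightarrow> conj_poly S (\<lambda>v. A v i j)"
  shows "conj_poly S (\<lambda>v. Determinant.det (Matrix.mat n n (\<lambda>(i, j). A v i j)))"
proof -
  have "Determinant.det (Matrix.mat n n (\<lambda>(i, j). A v i j)) =
     (\<Sum>p | p permutes {0..<n}. signof p * (\<Prod>i = 0..<n. A v i (p i)))" for v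
    by (subst det_def'[where n=n]) (auto intro!: sum.cong prod.cong simp: permutes_in_image)
  then show ?thesis
    using assms
    by (simp only:) (intro conj_poly_sum conj_poly_mult conj_poly_const conj_poly_prod, auto simp: permutes_in_image)
qed

lemma scale_lborel: "scale_measure 2 (lborel :: complex measure) = density lborel (\<lambda>_. 2)"
  by (rule measure_eqI) (auto simp: emeasure_density_const)

lemma cgauss_moment_scaled:
  assumes "\<alpha> > 0"
  shows "integrable (scale_measure 2 lborel) (\<lambda>z. cnj z ^ k * cgauss \<alpha> \<beta> z)"
    and "(LINT z|scale_measure 2 lborel. cnj z ^ k * cgauss \<alpha> \<beta> z) =
      of_real (2 * pi / \<alpha> * exp (- \<beta>\<^sup>2 / \<alpha>)) * (- \<i> * \<beta> / \<alpha>) ^ k"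
proof -
  have d: "density lborel (\<lambda>_. 2) = density (lborel :: complex measure) (\<lambda>_. ennreal 2)" by simp
  have m: "(\<lambda>z. cnj z ^ k * cgauss \<alpha> \<beta> z) \<in> borel_measurable lborel"
    using borel_measurable_integrable[OF cgauss_moment_coords(1)[OF assms]] .
  show "integrable (scale_measure 2 lborel) (\<lambda>z. cnj z ^ k * cgauss \<alpha> \<beta> z)"
    unfolding scale_lborel d using cgauss_moment_coords(1)[OF assms, of k \<beta>]
    by (subst integrable_density[OF m]) auto
  show "(LINT z|scale_measure 2 lborel. cnj z ^ k * cgauss \<alpha> \<beta> z) =
      of_real (2 * pi / \<alpha> * exp (- \<beta>\<^sup>2 / \<alpha>)) * (- \<i> * \<beta> / \<alpha>) ^ k"
    unfolding scale_lborel d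
    by (subst integral_density[OF m]) (auto simp: cgauss_moment[OF assms] scaleR_conv_of_real)
qed

lemma sigma_finite_scale_lborel: "sigma_finite_measure (scale_measure 2 (lborel :: complex measure))"
  unfolding scale_lborel
  by (subst sigma_finite_measure.sigma_finite_iff_density_finite[OF sigma_finite_lborel]) auto

interpretation SC: product_sigma_finite "\<lambda>_::'i. scale_measure 2 (lborel :: complex measure)"
  by (rule product_sigma_finite.intro) (rule sigma_finite_scale_lborel)

lemma lookup_times_Cst: "Poly_Mapping.lookup (P * Cst c) e = Poly_Mapping.lookup P e * c"
  using lookup_Cst_times[of c P e] by (simp add: mult.commute)

text \<open>The moments are multiplicative in the exponent, so integrating a polynomial in the
  conjugate variables amounts to evaluating it at a point.\<close>

lemma conj_poly_integral:
  assumes S: "finite S" and \<alpha>: "\<And>s. s \<in> S \<Longrightarrow> 0 < \<alpha> s" and R: "conj_poly S R"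
  shows "(LINT v|PiM S (\<lambda>_. scale_measure 2 lborel).
      Poly_Mapping.lookup (R (\<lambda>s. cnj (v s))) e0 * (\<Prod>s\<in>S. cgauss (\<alpha> s) (\<beta> s) (v s))) =
    Poly_Mapping.lookup (R (\<lambda>s. - \<i> * \<beta> s / \<alpha> s)) e0 *
      (\<Prod>s\<in>S. of_real (2 * pi / \<alpha> s * exp (- (\<beta> s)\<^sup>2 / \<alpha> s)))"
proof -
  let ?p = "\<lambda>s. - \<i> * complex_of_real (\<beta> s) / of_real (\<alpha> s)"
  let ?M = "PiM S (\<lambda>_. scale_measure 2 (lborel :: complex measure))"
  let ?w = "\<lambda>v. \<Prod>s\<in>S. cgauss (\<alpha> s) (\<beta> s) (v s)"
  let ?c = "\<Prod>s\<in>S. complex_of_real (2 * pi / \<alpha> s * exp (- (\<beta> s)\<^sup>2 / \<alpha> s))"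
  obtain ts where ts: "\<And>v. R v = (\<Sum>(C, e)\<leftarrow>ts. C * Cst (\<Prod>s\<in>S. v s ^ e s))"
    using R unfolding conj_poly_def by blast
  have mono: "integrable ?M (\<lambda>v. Poly_Mapping.lookup (C * Cst (\<Prod>s\<in>S. cnj (v s) ^ e s)) e0 * ?w v) \<and>
      (LINT v|?M. Poly_Mapping.lookup (C * Cst (\<Prod>s\<in>S. cnj (v s) ^ e s)) e0 * ?w v) =
       Poly_Mapping.lookup (C * Cst (\<Prod>s\<in>S. ?p s ^ e s)) e0 * ?c" for C e
  proof -
    have eq: "Poly_Mapping.lookup (C * Cst (\<Prod>s\<in>S. cnj (v s) ^ e s)) e0 * ?w v =
        Poly_Mapping.lookup C e0 * (\<Prod>s\<in>S. cnj (v s) ^ e s * cgauss (\<alpha> s) (\<beta> s) (v s))" for v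
      by (simp only: lookup_times_Cst prod.distrib mult.assoc)
    have i: "integrable (scale_measure 2 lborel) (\<lambda>z. cnj z ^ e s * cgauss (\<alpha> s) (\<beta> s) z)" if "s \<in> S" for s
      by (rule cgauss_moment_scaled(1)[OF \<alpha>[OF that]])
    have a: "integrable ?M (\<lambda>v. \<Prod>s\<in>S. cnj (v s) ^ e s * cgauss (\<alpha> s) (\<beta> s) (v s))"
      by (rule SC.product_integrable_prod[OF S, where f="\<lambda>s z. cnj z ^ e s * cgauss (\<alpha> s) (\<beta> s) z"]) (rule i)
    have b: "(LINT v|?M. (\<Prod>s\<in>S. cnj (v s) ^ e s * cgauss (\<alpha> s) (\<beta> s) (v s))) =
        (\<Prod>s\<in>S. LINT z|scale_measure 2 lborel. cnj z ^ e s * cgauss (\<alpha> s) (\<beta> s) z)"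
      by (rule SC.product_integral_prod[OF S, where f="\<lambda>s z. cnj z ^ e s * cgauss (\<alpha> s) (\<beta> s) z"]) (rule i)
    have c: "(\<Prod>s\<in>S. LINT z|scale_measure 2 lborel. cnj z ^ e s * cgauss (\<alpha> s) (\<beta> s) z) = (\<Prod>s\<in>S. complex_of_real (2 * pi / \<alpha> s * exp (- (\<beta> s)\<^sup>2 / \<alpha> s)) * ?p s ^ e s)"
      by (rule prod.cong[OF refl cgauss_moment_scaled(2)[OF \<alpha>]])
    have "(\<Prod>s\<in>S. complex_of_real (2 * pi / \<alpha> s * exp (- (\<beta> s)\<^sup>2 / \<alpha> s)) * ?p s ^ e s) = ?c * (\<Prod>s\<in>S. ?p s ^ e s)"
      by (rule prod.distrib)
    then have "(LINT v|?M. Poly_Mapping.lookup C e0 * (\<Prod>s\<in>S. cnj (v s) ^ e s * cgauss (\<alpha> s) (\<beta> s) (v s))) =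
        Poly_Mapping.lookup (C * Cst (\<Prod>s\<in>S. ?p s ^ e s)) e0 * ?c"
      unfolding integral_mult_right_zero b c lookup_times_Cst by (simp only: mult_ac)
    then show ?thesis
      unfolding eq using integrable_mult_right[OF a] by blast
  qed
  have "integrable ?M (\<lambda>v. Poly_Mapping.lookup (\<Sum>(C, e)\<leftarrow>us. C * Cst (\<Prod>s\<in>S. cnj (v s) ^ e s)) e0 * ?w v) \<and>
      (LINT v|?M. Poly_Mapping.lookup (\<Sum>(C, e)\<leftarrow>us. C * Cst (\<Prod>s\<in>S. cnj (v s) ^ e s)) e0 * ?w v) =
       Poly_Mapping.lookup (\<Sum>(C, e)\<leftarrow>us. C * Cst (\<Prod>s\<in>S. ?p s ^ e s)) e0 * ?c" for us
  proof (induction us)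
    case (Cons a us)
    obtain C e where a: "a = (C, e)" by (cases a)
    show ?case
      using Cons mono[of C e] by (simp add: a lookup_add distrib_right)
  qed simp
  then show ?thesis unfolding ts by blast
qed

section \<open>The unitary and unipotent integrals\<close>

lemma mat_adjoint_eq: "mat_adjoint (A :: complex mat) = Matrix.mat (dim_col A) (dim_row A) (\<lambda>(i, j). cnj (A $$ (j, i)))"
  by (rule eq_matI) (auto simp: mat_adjoint_def mat_of_rows_index)

lemma mat_adjoint_carrier: "(A :: complex mat) \<in> carrier_mat n m \<Longrightarrow> mat_adjoint A \<in> carrier_mat m n"
  by (auto simp: mat_adjoint_eq)

interpretation cnj_hom: comm_ring_hom cnj
  by unfold_locales auto

interpretation Cst_cnj_hom: comm_ring_hom "\<lambda>c. Cst (cnj c)"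
  by unfold_locales (auto simp: Cst_add Cst_mult)

lemma det_mat_adjoint:
  assumes "(A :: complex mat) \<in> carrier_mat n n"
  shows "Determinant.det (mat_adjoint A) = cnj (Determinant.det A)"
proof -
  have "mat_adjoint A = transpose_mat (map_mat cnj A)"
    using assms by (intro eq_matI) (auto simp: mat_adjoint_eq)
  then show ?thesis
    using assms by (simp add: det_transpose[of _ n])
qed

lemma UgrpD:
  assumes "k \<in> Ugrp m"
  shows "k \<in> carrier_mat m m" "mat_adjoint k \<in> carrier_mat m m" "k * mat_adjoint k = 1\<^sub>m m" "mat_adjoint k * k = 1\<^sub>m m"
    and "Determinant.det k * cnj (Determinant.det k) = 1" "cmod (Determinant.det k) = 1" "Determinant.det k \<noteq> 0"
proof -
  show k: "k \<in> carrier_mat m m" "k * mat_adjoint k = 1\<^sub>m m" using assms by (auto simp: Ugrp_def)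
  then show a: "mat_adjoint k \<in> carrier_mat m m" by (intro mat_adjoint_carrier)
  show "mat_adjoint k * k = 1\<^sub>m m" by (rule mat_mult_left_right_inverse[OF k(1) a k(2)])
  have "Determinant.det k * Determinant.det (mat_adjoint k) = 1"
    using det_mult[OF k(1) a] k(2) by simp
  then show d: "Determinant.det k * cnj (Determinant.det k) = 1" by (simp add: det_mat_adjoint[OF k(1)])
  then have "(cmod (Determinant.det k))\<^sup>2 = 1"
    by (simp add: complex_norm_square[symmetric] flip: of_real_eq_iff of_real_power)
  then show "cmod (Determinant.det k) = 1" by (simp add: power2_eq_1_iff) (smt (verit) norm_ge_zero)
  show "Determinant.det k \<noteq> 0" using d by auto
qed

lemma diag_real_carrier [simp]: "diag_real m t \<in> carrier_mat m m"
  by (simp add: diag_real_def)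

lemma det_diag_real: "Determinant.det (diag_real m t) = complex_of_real (\<Prod>i=1..m. t i)"
proof -
  have "upper_triangular (diag_real m t)" by (auto simp: diag_real_def mat_diag_def upper_triangular_def)
  then have "Determinant.det (diag_real m t) = prod_list (diag_mat (diag_real m t))"
    by (rule det_upper_triangular[OF _ diag_real_carrier])
  also have "\<dots> = (\<Prod>i = 0..<m. diag_real m t $$ (i, i))"
    unfolding prod_list_diag_prod carrier_matD(1)[OF diag_real_carrier] ..
  also have "\<dots> = (\<Prod>i = 0..<m. complex_of_real (t (Suc i)))"
    by (rule prod.cong) (auto simp: diag_real_def mat_diag_def)
  also have "\<dots> = complex_of_real (\<Prod>i=1..m. t i)"
    by (simp add: prod.atLeast1_atMost_eq atLeast0LessThan)
  finally show ?thesis .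
qed

text \<open>\<open>mat_inverse\<close> returns an option. \<open>None\<close> is excluded because
  the product is a unit of the matrix ring, and a value in \<open>Some\<close> is determined by
  uniqueness of inverses.\<close>

lemma mat_inverse_diag_unitary:
  assumes t: "\<And>i. i \<in> {1..m} \<Longrightarrow> t i \<noteq> 0" and k: "k \<in> Ugrp m"
  shows "the (mat_inverse (diag_real m t * k)) = mat_adjoint k * diag_real m (\<lambda>i. 1 / t i)"
proof -
  note kU = UgrpD[OF k]
  let ?D = "diag_real m t" and ?D' = "diag_real m (\<lambda>i. 1 / t i)"
  let ?h = "?D * k" and ?B = "mat_adjoint k * ?D'"
  have DD': "?D * ?D' = 1\<^sub>m m" "?D' * ?D = 1\<^sub>m m"
    using t by (auto simp: diag_real_def mat_diag_def intro!: eq_matI) (auto simp: scalar_prod_def if_distrib sum.delta cong: if_cong)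
  have h: "?h \<in> carrier_mat m m" and B: "?B \<in> carrier_mat m m"
    using mult_carrier_mat[OF diag_real_carrier kU(1)] mult_carrier_mat[OF kU(2) diag_real_carrier] by auto
  have hB: "?h * ?B = 1\<^sub>m m"
  proof -
    have "?h * ?B = ?D * (k * (mat_adjoint k * ?D'))"
      using kU B by (intro assoc_mult_mat[of _ m m _ m _ m]) auto
    also have "k * (mat_adjoint k * ?D') = (k * mat_adjoint k) * ?D'"
      using kU by (intro assoc_mult_mat[of _ m m _ m _ m, symmetric]) auto
    finally show ?thesis unfolding kU(3) left_mult_one_mat[OF diag_real_carrier] DD'(1) .
  qed
  have Bh: "?B * ?h = 1\<^sub>m m" by (rule mat_mult_left_right_inverse[OF h B hB])
  show ?thesis
  proof (cases "mat_inverse ?h")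
    case None
    then have "?h \<notin> Units (ring_mat TYPE(complex) m ())" by (rule mat_inverse(1)[OF h])
    moreover have "?h \<in> Units (ring_mat TYPE(complex) m ())"
      using h B hB Bh by (auto simp: Units_def ring_mat_def)
    ultimately show ?thesis by blast
  next
    case (Some C)
    then have C: "?h * C = 1\<^sub>m m" "C \<in> carrier_mat m m" using mat_inverse(2)[OF h] by auto
    have "?B * (?h * C) = (?B * ?h) * C" using B h C(2) by (intro assoc_mult_mat[of _ m m _ m _ m, symmetric]) auto
    then have "?B = C" unfolding C(1) Bh right_mult_one_mat[OF B] left_mult_one_mat[OF C(2)] .
    then show ?thesis using Some by simp
  qed
qed

text \<open>Conjugation is left to the argument \<open>y\<close>, so that the same matrix can be
  evaluated at the point produced by the Gaussian moments.\<close>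

definition phi_mat :: "nat \<Rightarrow> (nat \<Rightarrow> nat \<Rightarrow> complex) \<Rightarrow> cpoly mat" where
  "phi_mat n y = Matrix.mat n n (\<lambda>(i, j). if i = 0 then Var (j + 1) else Cst (y (i - 1) j))"

text \<open>Bordering the conjugate of \<open>u\<close> by 1 gives \<open>?Q\<close>, which acts on
  the lower rows and leaves the row of variables unchanged; its determinant is the conjugate of that
  of \<open>u\<close>.\<close>

lemma det_phi_mat_mult:
  assumes u: "u \<in> carrier_mat m m" and y: "y \<in> carrier_mat m (Suc m)"
  shows "Determinant.det (phi_mat (Suc m) (\<lambda>i j. cnj ((u * y) $$ (i, j)))) =
    Cst (cnj (Determinant.det u)) * Determinant.det (phi_mat (Suc m) (\<lambda>i j. cnj (y $$ (i, j))))"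
proof -
  let ?P = "\<lambda>y. phi_mat (Suc m) (\<lambda>i j. cnj (y $$ (i, j)))"
  let ?Q = "Matrix.mat (Suc m) (Suc m) (\<lambda>(i, j). if i = 0 then (if j = 0 then 1 else 0) else
      if j = 0 then 0 else Cst (cnj (u $$ (i - 1, j - 1))))"
  have Q: "?Q \<in> carrier_mat (Suc m) (Suc m)" and P: "?P y \<in> carrier_mat (Suc m) (Suc m)"
    by (auto simp: phi_mat_def)
  have "?Q * ?P y = ?P (u * y)"
  proof (rule eq_matI)
    fix i j assume "i < dim_row (?P (u * y))" "j < dim_col (?P (u * y))"
    then have ij: "i < Suc m" "j < Suc m" by (auto simp: phi_mat_def)
    have "(?Q * ?P y) $$ (i, j) = (\<Sum>k = 0..<Suc m. ?Q $$ (i, k) * ?P y $$ (k, j))"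
      using ij by (simp add: scalar_prod_def phi_mat_def del: sum.op_ivl_Suc)
    also have "\<dots> = ?Q $$ (i, 0) * ?P y $$ (0, j) + (\<Sum>k = 0..<m. ?Q $$ (i, Suc k) * ?P y $$ (Suc k, j))"
      by (simp only: sum.atLeast0_lessThan_Suc_shift o_def)
    also have "\<dots> = ?P (u * y) $$ (i, j)"
    proof (cases i)
      case 0
      then show ?thesis using ij by (simp add: phi_mat_def)
    next
      case (Suc i')
      have "(u * y) $$ (i', j) = (\<Sum>k = 0..<m. u $$ (i', k) * y $$ (k, j))"
        using u y ij Suc by (simp add: scalar_prod_def)
      then have "Cst (cnj ((u * y) $$ (i', j))) = (\<Sum>k = 0..<m. Cst (cnj (u $$ (i', k))) * Cst (cnj (y $$ (k, j))))"
        by (simp only: Cst_cnj_hom.hom_sum Cst_cnj_hom.hom_mult)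
      then show ?thesis using ij Suc by (simp add: phi_mat_def)
    qed
    finally show "(?Q * ?P y) $$ (i, j) = ?P (u * y) $$ (i, j)" .
  qed (auto simp: phi_mat_def)
  then have "Determinant.det (?P (u * y)) = Determinant.det ?Q * Determinant.det (?P y)"
    using det_mult[OF Q P] by simp
  also have "Determinant.det ?Q = (\<Sum>j<Suc m. ?Q $$ (0, j) * cofactor ?Q 0 j)"
    by (rule laplace_expansion_row[OF Q]) simp
  also have "\<dots> = (\<Sum>j\<in>{0}. ?Q $$ (0, j) * cofactor ?Q 0 j)"
    by (rule sum.mono_neutral_right) auto
  also have "\<dots> = Determinant.det (mat_delete ?Q 0 0)" by (simp add: cofactor_def)
  also have "mat_delete ?Q 0 0 = map_mat (\<lambda>c. Cst (cnj c)) u"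
    using u by (intro eq_matI) (auto simp: mat_delete_def)
  finally show ?thesis by simp
qed

lemma trace_adjoint_sum:
  assumes "(y :: complex mat) \<in> carrier_mat m n"
  shows "(\<Sum>i<m. (y * mat_adjoint y) $$ (i, i)) = complex_of_real (\<Sum>i<m. \<Sum>j<n. (cmod (y $$ (i, j)))\<^sup>2)"
proof -
  have "(y * mat_adjoint y) $$ (i, i) = complex_of_real (\<Sum>j<n. (cmod (y $$ (i, j)))\<^sup>2)" if "i < m" for i
  proof -
    have "(y * mat_adjoint y) $$ (i, i) = (\<Sum>j<n. y $$ (i, j) * cnj (y $$ (i, j)))"
      using assms that by (simp add: mat_adjoint_eq scalar_prod_def atLeast0LessThan)
    then show ?thesis by (simp only: of_real_sum complex_norm_square)
  qed
  then show ?thesis by (simp add: of_real_sum)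
qed

lemma trace_adjoint_unitary:
  assumes u: "u \<in> carrier_mat m m" "mat_adjoint u * u = 1\<^sub>m m" and y: "(y :: complex mat) \<in> carrier_mat m n"
  shows "(\<Sum>i<m. \<Sum>j<n. (cmod ((u * y) $$ (i, j)))\<^sup>2) = (\<Sum>i<m. \<Sum>j<n. (cmod (y $$ (i, j)))\<^sup>2)"
proof -
  have col: "(\<Sum>i<m. (cmod ((u * y) $$ (i, j)))\<^sup>2) = (\<Sum>i<m. (cmod (y $$ (i, j)))\<^sup>2)" if j: "j < n" for j
  proof -
    have uu: "(\<Sum>i<m. cnj (u $$ (i, p)) * u $$ (i, q)) = (if p = q then 1 else 0)" if "p < m" "q < m" for p q
    proof -
      have "(mat_adjoint u * u) $$ (p, q) = (\<Sum>i<m. cnj (u $$ (i, p)) * u $$ (i, q))"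
        using u(1) that by (simp add: mat_adjoint_eq scalar_prod_def atLeast0LessThan)
      moreover have "(mat_adjoint u * u) $$ (p, q) = (if p = q then 1 else 0)"
        unfolding u(2) using that by simp
      ultimately show ?thesis by (simp only:)
    qed
    have "complex_of_real (\<Sum>i<m. (cmod ((u * y) $$ (i, j)))\<^sup>2) =
        (\<Sum>i<m. (\<Sum>q<m. u $$ (i, q) * y $$ (q, j)) * cnj (\<Sum>p<m. u $$ (i, p) * y $$ (p, j)))"
    proof -
      have "(u * y) $$ (i, j) = (\<Sum>q<m. u $$ (i, q) * y $$ (q, j))" if "i < m" for i
        using u(1) y j that by (simp add: scalar_prod_def atLeast0LessThan)
      then show ?thesis unfolding of_real_sum complex_norm_square by (intro sum.cong) auto
    qed
    also have "\<dots> = (\<Sum>i<m. \<Sum>q<m. \<Sum>p<m. (y $$ (q, j) * cnj (y $$ (p, j))) * (cnj (u $$ (i, p)) * u $$ (i, q)))"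
      by (simp add: sum_product mult_ac)
    also have "\<dots> = (\<Sum>q<m. \<Sum>p<m. \<Sum>i<m. (y $$ (q, j) * cnj (y $$ (p, j))) * (cnj (u $$ (i, p)) * u $$ (i, q)))"
      by (subst sum.swap, rule sum.cong[OF refl], rule sum.swap)
    also have "\<dots> = (\<Sum>q<m. \<Sum>p<m. (y $$ (q, j) * cnj (y $$ (p, j))) * (if p = q then 1 else 0))"
      by (simp add: uu flip: sum_distrib_left)
    also have "\<dots> = (\<Sum>q<m. y $$ (q, j) * cnj (y $$ (q, j)))"
      by (simp add: if_distrib sum.delta cong: if_cong)
    also have "\<dots> = complex_of_real (\<Sum>i<m. (cmod (y $$ (i, j)))\<^sup>2)"
      by (simp only: of_real_sum complex_norm_square)
    finally show ?thesis by (simp only: of_real_eq_iff)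
  qed
  have "(\<Sum>i<m. \<Sum>j<n. (cmod ((u * y) $$ (i, j)))\<^sup>2) = (\<Sum>j<n. \<Sum>i<m. (cmod ((u * y) $$ (i, j)))\<^sup>2)"
    by (rule sum.swap)
  also have "\<dots> = (\<Sum>j<n. \<Sum>i<m. (cmod (y $$ (i, j)))\<^sup>2)" by (simp add: col)
  finally show ?thesis by (subst (asm) sum.swap)
qed

lemma phi_eq:
  assumes "x \<in> carrier_mat m (Suc m)"
  shows "phi (Suc m) \<kappa> x = Cst ((-1) ^ (\<kappa> * m) * 2 ^ (4 * m) *
     complex_of_real (exp (- 2 * pi * (\<Sum>i<m. \<Sum>j<Suc m. (cmod (x $$ (i, j)))\<^sup>2)))) *
     Determinant.det (phi_mat (Suc m) (\<lambda>i j. cnj (x $$ (i, j)))) ^ \<kappa>"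
proof -
  have "exp (- 2 * complex_of_real pi * complex_of_real r) = complex_of_real (exp (- 2 * pi * r))" for r
    by (simp flip: exp_of_real)
  note e = this
  show ?thesis
    unfolding phi_def diff_Suc_1 trace_adjoint_sum[OF assms] phi_mat_def e
    by (simp only: Cst_mult mult_ac)
qed

text \<open>The Gaussian depends only on the norm of the matrix, and the determinant acquires the
  conjugate of the determinant of the adjoint, which is det k.\<close>

lemma phi_unitary:
  assumes k: "k \<in> Ugrp m" and y: "y \<in> carrier_mat m (Suc m)"
  shows "phi (Suc m) \<kappa> (mat_adjoint k * y) = Cst (Determinant.det k ^ \<kappa>) * phi (Suc m) \<kappa> y"
proof -
  note kU = UgrpD[OF k]
  have aa: "mat_adjoint (mat_adjoint k) = k" using kU(1) by (auto simp: mat_adjoint_eq)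
  have ky: "mat_adjoint k * y \<in> carrier_mat m (Suc m)" using kU y by auto
  show ?thesis
    unfolding phi_eq[OF ky] phi_eq[OF y] det_phi_mat_mult[OF kU(2) y]
      trace_adjoint_unitary[OF kU(2) _ y, unfolded aa, OF kU(3)] det_mat_adjoint[OF kU(1)]
    by (simp add: power_mult_distrib Cst_power Cst_mult mult_ac)
qed

text \<open>\<open>eps_mat\<close> selects the first m rows of \<open>G\<close>, the inverse of the
  diagonal part divides row i by t_i, and the unitary part goes through
  \<open>phi_unitary\<close>.\<close>

lemma omega_unitary:
  assumes k: "k \<in> Ugrp m" and t: "\<And>i. i \<in> {1..m} \<Longrightarrow> t i \<noteq> 0" and G: "G \<in> carrier_mat (Suc m) (Suc m)"
  shows "omega (Suc m) (diag_real m t * k) G (phi (Suc m) \<kappa>) (eps_mat (Suc m)) =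
    Cst (complex_of_real (absC (complex_of_real (\<Prod>i=1..m. t i)) powr (- real (Suc m) / 2) *
      absC (Determinant.det G) powr (real m / 2)) * Determinant.det k ^ \<kappa>) *
    phi (Suc m) \<kappa> (Matrix.mat m (Suc m) (\<lambda>(i, j). G $$ (i, j) / complex_of_real (t (i + 1))))"
proof -
  note kU = UgrpD[OF k]
  let ?y = "Matrix.mat m (Suc m) (\<lambda>(i, j). G $$ (i, j) / complex_of_real (t (i + 1)))"
  have e: "eps_mat (Suc m) * G = Matrix.mat m (Suc m) (\<lambda>(i, j). G $$ (i, j))"
  proof (rule eq_matI)
    fix i j assume "i < dim_row (Matrix.mat m (Suc m) (\<lambda>(i, j). G $$ (i, j)))" "j < dim_col (Matrix.mat m (Suc m) (\<lambda>(i, j). G $$ (i, j)))"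
    then have ij: "i < m" "j < Suc m" by auto
    have "(eps_mat (Suc m) * G) $$ (i, j) = (\<Sum>l = 0..<Suc m. (if i = l then 1 else 0) * G $$ (l, j))"
      using ij G by (simp add: eps_mat_def scalar_prod_def del: sum.op_ivl_Suc)
    also have "\<dots> = (\<Sum>l = 0..<Suc m. if i = l then G $$ (l, j) else 0)"
      by (rule sum.cong) auto
    also have "\<dots> = G $$ (i, j)" using ij by (subst sum.delta') auto
    finally show "(eps_mat (Suc m) * G) $$ (i, j) = Matrix.mat m (Suc m) (\<lambda>(i, j). G $$ (i, j)) $$ (i, j)"
      using ij by simp
  qed (use G in \<open>auto simp: eps_mat_def\<close>)
  let ?E = "eps_mat (Suc m)" and ?D' = "diag_real m (\<lambda>i. 1 / t i)"
  have E: "?E \<in> carrier_mat m (Suc m)" by (auto simp: eps_mat_def)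
  have "mat_adjoint k * ?D' * ?E * G = mat_adjoint k * ?D' * (?E * G)"
    using kU E G by (intro assoc_mult_mat[of _ m m _ "Suc m" _ "Suc m"]) auto
  also have "\<dots> = mat_adjoint k * (?D' * (?E * G))"
    using kU E G by (intro assoc_mult_mat[of _ m m _ m _ "Suc m"]) auto
  also have "?D' * (?E * G) = ?y"
    unfolding e diag_real_def by (subst mat_diag_mult_left[of _ _ "Suc m"]) (auto intro!: eq_matI)
  finally have x: "the (mat_inverse (diag_real m t * k)) * ?E * G = mat_adjoint k * ?y"
    by (simp only: mat_inverse_diag_unitary[OF t k])
  have "absC (Determinant.det (diag_real m t * k)) = absC (complex_of_real (\<Prod>i=1..m. t i))"
    by (simp only: det_mult[OF diag_real_carrier kU(1)] det_diag_real absC_def norm_mult kU(6) mult_1_right)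
  moreover have "real (Suc m) - 1 = real m" by simp
  ultimately show ?thesis
    unfolding omega_def x by (subst phi_unitary[OF k]) (simp_all only: Cst_mult mult_ac mat_carrier)
qed

lemma chi_unitary:
  assumes k: "k \<in> Ugrp m" and t: "\<And>i. i \<in> {1..m} \<Longrightarrow> 0 < t i"
  shows "Determinant.det k ^ \<kappa> * chi 0 (- int \<kappa>) (Determinant.det (diag_real m t * k)) = 1"
proof -
  note kU = UgrpD[OF k]
  define T where "T = (\<Prod>i=1..m. t i)"
  have T: "T > 0" unfolding T_def using t by (intro prod_pos) auto
  have d: "Determinant.det (diag_real m t * k) = complex_of_real T * Determinant.det k"
    by (simp only: det_mult[OF diag_real_carrier kU(1)] det_diag_real T_def)
  have a: "absC (complex_of_real T * Determinant.det k) = T\<^sup>2"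
    by (simp add: absC_def norm_mult kU(6))
  have "chi 0 (- int \<kappa>) (Determinant.det (diag_real m t * k)) = Determinant.det k powi (- int \<kappa>)"
    unfolding chi_def d a using T by (simp add: real_sqrt_abs)
  then show ?thesis using kU(7) by (simp add: power_int_minus)
qed

lemma partial_sum_le: "j \<le> n \<Longrightarrow> partial_sum l j \<le> (\<Sum>i=1..n. l i)"
  unfolding partial_sum_def by (rule sum_mono2) auto

text \<open>\<open>A i\<close> occurs for the indices j > i + 1 and \<open>B i\<close> for j <= i +
  1, so their exponents l_j add up to a complementary and to a partial sum. The numbers l_1 + ... +
  l_j of the formula originate here.\<close>

lemma prod_split_power:
  fixes A B :: "nat \<Rightarrow> 'a::comm_semiring_1"
  assumes "(\<Sum>i=1..Suc m. l i) = \<kappa>"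
  shows "(\<Prod>j=1..Suc m. (\<Prod>i<m. if Suc i < j then A i else B i) ^ l j) =
    (\<Prod>i<m. A i ^ (\<kappa> - partial_sum l (Suc i)) * B i ^ partial_sum l (Suc i))"
proof -
  have "(\<Prod>j=1..Suc m. (\<Prod>i<m. if Suc i < j then A i else B i) ^ l j) =
      (\<Prod>i<m. \<Prod>j=1..Suc m. (if Suc i < j then A i else B i) ^ l j)"
    unfolding prod_power_distrib by (rule prod.swap)
  also have "\<dots> = (\<Prod>i<m. A i ^ (\<kappa> - partial_sum l (Suc i)) * B i ^ partial_sum l (Suc i))"
  proof (rule prod.cong[OF refl])
    fix i assume "i \<in> {..<m}"
    then have i: "i < m" by simp
    have U: "{1..Suc m} = {1..Suc i} \<union> {Suc (Suc i)..Suc m}" using i by auto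
    have s: "\<kappa> = partial_sum l (Suc i) + (\<Sum>j=Suc (Suc i)..Suc m. l j)"
      unfolding partial_sum_def assms[symmetric] U by (rule sum.union_disjoint) auto
    have "(\<Prod>j=1..Suc m. (if Suc i < j then A i else B i) ^ l j) =
       (\<Prod>j=1..Suc i. (if Suc i < j then A i else B i) ^ l j) *
       (\<Prod>j=Suc (Suc i)..Suc m. (if Suc i < j then A i else B i) ^ l j)"
      unfolding U by (rule prod.union_disjoint) auto
    also have "(\<Prod>j=1..Suc i. (if Suc i < j then A i else B i) ^ l j) = (\<Prod>j=1..Suc i. B i ^ l j)"
      by (rule prod.cong) auto
    also have "\<dots> = B i ^ partial_sum l (Suc i)" by (simp only: power_sum partial_sum_def)
    also have "(\<Prod>j=Suc (Suc i)..Suc m. (if Suc i < j then A i else B i) ^ l j) = (\<Prod>j=Suc (Suc i)..Suc m. A i ^ l j)"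
      by (rule prod.cong) auto
    also have "\<dots> = A i ^ (\<kappa> - partial_sum l (Suc i))" using s by (simp flip: power_sum)
    finally show "(\<Prod>j=1..Suc m. (if Suc i < j then A i else B i) ^ l j) =
        A i ^ (\<kappa> - partial_sum l (Suc i)) * B i ^ partial_sum l (Suc i)" by (simp add: mult.commute)
  qed
  finally show ?thesis .
qed

text \<open>The sign (-1)^j of the expansion is absorbed into the j factors \<open>A i\<close>. The
  coefficient of each variable becomes a product over all rows, to which the multinomial theorem
  applies.\<close>

lemma lookup_det_bordered_power:
  assumes "(\<Sum>i=1..Suc m. l i) = \<kappa>"
  shows "Poly_Mapping.lookup (Determinant.det (bordered_bidiag (Suc m) (\<lambda>j. Var (j + 1)) (\<lambda>i. Cst (A i)) (\<lambda>i. Cst (B i))) ^ \<kappa>)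
      (monomial_exp (Suc m) l) =
    fact \<kappa> / (\<Prod>i=1..Suc m. fact (l i)) *
      (\<Prod>i<m. (- A i) ^ (\<kappa> - partial_sum l (Suc i)) * B i ^ partial_sum l (Suc i))"
proof -
  let ?c = "\<lambda>j. \<Prod>i<m. if Suc i < j then - A i else B i"
  have c: "(-1) ^ j * Var (j + 1) * (\<Prod>i<j. Cst (A i)) * (\<Prod>i=j..<m. Cst (B i)) = Var (Suc j) * Cst (?c (Suc j))"
    if "j \<le> m" for j
  proof -
    have U: "{..<m} = {..<j} \<union> {j..<m}" using that by auto
    have "?c (Suc j) = (\<Prod>i<j. if Suc i < Suc j then - A i else B i) * (\<Prod>i=j..<m. if Suc i < Suc j then - A i else B i)"
      unfolding U by (rule prod.union_disjoint) auto
    also have "(\<Prod>i<j. if Suc i < Suc j then - A i else B i) = (\<Prod>i<j. (- 1) * A i)" by (rule prod.cong) auto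
    also have "\<dots> = (-1) ^ j * (\<Prod>i<j. A i)" by (simp only: prod.distrib) simp
    also have "(\<Prod>i=j..<m. if Suc i < Suc j then - A i else B i) = (\<Prod>i=j..<m. B i)" by (rule prod.cong) auto
    finally show ?thesis by (simp add: Cst_mult Cst_prod Cst_power Cst_uminus mult_ac)
  qed
  have "Determinant.det (bordered_bidiag (Suc m) (\<lambda>j. Var (j + 1)) (\<lambda>i. Cst (A i)) (\<lambda>i. Cst (B i))) =
      (\<Sum>j\<le>m. Var (Suc j) * Cst (?c (Suc j)))"
    unfolding det_bordered_bidiag by (rule sum.cong) (auto simp only: c atMost_iff)
  also have "\<dots> = (\<Sum>j=1..Suc m. Var j * Cst (?c j))"
    by (simp only: One_nat_def sum.atLeast1_atMost_eq lessThan_Suc_atMost)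
  finally show ?thesis
    by (simp only: lookup_linear_power[OF assms] prod_split_power[OF assms])
qed

section \<open>The unipotent integral as a product over rows\<close>

definition upper_idx :: "nat \<Rightarrow> (nat \<times> nat) set" where
  "upper_idx m = (SIGMA i:{..<m}. {i<..<Suc m})"

lemma upper_idx_eq: "{(i, j). i < j \<and> j < Suc m} = upper_idx m"
  by (auto simp: upper_idx_def)

lemma finite_upper_idx: "finite (upper_idx m)"
  by (simp add: upper_idx_def)

lemma sum_upper_idx: "(\<Sum>s\<in>upper_idx m. F s) = (\<Sum>i<m. \<Sum>j\<in>{i<..<Suc m}. F (i, j))"
  unfolding upper_idx_def by (subst sum.Sigma) (auto simp: case_prod_unfold)

lemma prod_upper_idx: "(\<Prod>s\<in>upper_idx m. F s) = (\<Prod>i<m. \<Prod>j\<in>{i<..<Suc m}. F (i, j))"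
  unfolding upper_idx_def by (subst prod.Sigma) (auto simp: case_prod_unfold)

lemma unip_mat_diag:
  assumes "i < n" "j < n"
  shows "(unip_mat n v * diag_real n g) $$ (i, j) = (if i = j then 1 else if i < j then v (i, j) else 0) * complex_of_real (g (Suc j))"
  unfolding diag_real_def by (subst mat_diag_mult_right[of _ n]) (use assms in \<open>auto simp: unip_mat_def\<close>)

lemma det_unip_mat_diag: "Determinant.det (unip_mat n v * diag_real n g) = complex_of_real (\<Prod>i=1..n. g i)"
proof -
  have u: "unip_mat n v \<in> carrier_mat n n" by (simp add: unip_mat_def)
  have "Determinant.det (unip_mat n v) = prod_list (diag_mat (unip_mat n v))"
    by (rule det_upper_triangular[OF _ u]) (auto simp: unip_mat_def upper_triangular_def)
  also have "\<dots> = (\<Prod>i = 0..<n. unip_mat n v $$ (i, i))"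
    unfolding prod_list_diag_prod carrier_matD(1)[OF u] ..
  also have "\<dots> = 1" by (rule prod.neutral) (auto simp: unip_mat_def)
  finally show ?thesis by (simp only: det_mult[OF u diag_real_carrier] det_diag_real mult_1_left)
qed

context
  fixes m :: nat and g t :: "nat \<Rightarrow> real"
  assumes g: "\<And>i. i \<in> {1..Suc m} \<Longrightarrow> 0 < g i" and t: "\<And>i. i \<in> {1..m} \<Longrightarrow> 0 < t i"
begin

text \<open>The coefficient of |v (i, j)|^2 in the exponent of \<open>phi\<close>: the entry (i, j)
  is scaled by g_(j+1) / t_(i+1).\<close>

definition uni_alpha :: "nat \<times> nat \<Rightarrow> real" where
  "uni_alpha s = 2 * pi * (g (Suc (snd s)) / t (Suc (fst s)))\<^sup>2"

text \<open>\<open>psi_N\<close> sees only the superdiagonal, where the inverse of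
  \<open>psi v\<close> is exp (- 2 pi i (v + cnj v)).\<close>

definition uni_beta :: "nat \<times> nat \<Rightarrow> real" where
  "uni_beta s = (if snd s = Suc (fst s) then 2 * pi else 0)"

definition uni_entry :: "(nat \<times> nat \<Rightarrow> complex) \<Rightarrow> nat \<Rightarrow> nat \<Rightarrow> complex" where
  "uni_entry w i j = (if i = j then 1 else if i < j then w (i, j) else 0) * complex_of_real (g (Suc j) / t (Suc i))"

lemma uni_alpha_pos: "s \<in> upper_idx m \<Longrightarrow> 0 < uni_alpha s"
proof -
  assume "s \<in> upper_idx m"
  then have "0 < g (Suc (snd s))" "0 < t (Suc (fst s))" by (auto simp: upper_idx_def intro!: g t)
  then show ?thesis by (simp add: uni_alpha_def)
qed

text \<open>The diagonal entries do not involve \<open>v\<close> and give the Gaussian in g_i / t_i;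
  the other entries and the character separate into one \<open>cgauss\<close> for each
  coordinate.\<close>

lemma uni_gauss:
  "complex_of_real (exp (- 2 * pi * (\<Sum>i<m. \<Sum>j<Suc m. (cmod (uni_entry v i j))\<^sup>2))) *
     inverse (psi_N (Suc m) (unip_mat (Suc m) v)) =
   complex_of_real (exp (- 2 * pi * (\<Sum>i<m. (g (Suc i) / t (Suc i))\<^sup>2))) *
     (\<Prod>s\<in>upper_idx m. cgauss (uni_alpha s) (uni_beta s) (v s))"
proof -
  have row: "(\<Sum>j<Suc m. (cmod (uni_entry v i j))\<^sup>2) = (g (Suc i) / t (Suc i))\<^sup>2 +
      (\<Sum>j\<in>{i<..<Suc m}. (cmod (v (i, j)))\<^sup>2 * (g (Suc j) / t (Suc i))\<^sup>2)" if i: "i < m" for i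
  proof -
    have U: "{..<Suc m} = insert i ({..<i} \<union> {i<..<Suc m})" using i by auto
    have "(\<Sum>j<Suc m. (cmod (uni_entry v i j))\<^sup>2) = (cmod (uni_entry v i i))\<^sup>2 +
       (\<Sum>j\<in>{..<i} \<union> {i<..<Suc m}. (cmod (uni_entry v i j))\<^sup>2)"
      unfolding U by (rule sum.insert) auto
    also have "(\<Sum>j\<in>{..<i} \<union> {i<..<Suc m}. (cmod (uni_entry v i j))\<^sup>2) = (\<Sum>j<i. (cmod (uni_entry v i j))\<^sup>2) +
       (\<Sum>j\<in>{i<..<Suc m}. (cmod (uni_entry v i j))\<^sup>2)"
      by (rule sum.union_disjoint) auto
    also have "(\<Sum>j<i. (cmod (uni_entry v i j))\<^sup>2) = 0"
      by (rule sum.neutral) (auto simp: uni_entry_def)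
    also have "(\<Sum>j\<in>{i<..<Suc m}. (cmod (uni_entry v i j))\<^sup>2) =
        (\<Sum>j\<in>{i<..<Suc m}. (cmod (v (i, j)))\<^sup>2 * (g (Suc j) / t (Suc i))\<^sup>2)"
      by (rule sum.cong[OF refl]) (auto simp: uni_entry_def norm_mult norm_divide power_mult_distrib power_divide)
    also have "(cmod (uni_entry v i i))\<^sup>2 = (g (Suc i) / t (Suc i))\<^sup>2"
      by (simp add: uni_entry_def norm_divide power_divide)
    finally show ?thesis by simp
  qed
  have A: "- 2 * pi * (\<Sum>i<m. \<Sum>j<Suc m. (cmod (uni_entry v i j))\<^sup>2) =
      - 2 * pi * (\<Sum>i<m. (g (Suc i) / t (Suc i))\<^sup>2) + (\<Sum>s\<in>upper_idx m. - uni_alpha s * (cmod (v s))\<^sup>2)"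
  proof -
    have "(\<Sum>s\<in>upper_idx m. - uni_alpha s * (cmod (v s))\<^sup>2) =
       - 2 * pi * (\<Sum>i<m. \<Sum>j\<in>{i<..<Suc m}. (cmod (v (i, j)))\<^sup>2 * (g (Suc j) / t (Suc i))\<^sup>2)"
      unfolding sum_upper_idx by (simp add: uni_alpha_def sum_distrib_left sum_negf mult_ac)
    moreover have "(\<Sum>i<m. \<Sum>j<Suc m. (cmod (uni_entry v i j))\<^sup>2) = (\<Sum>i<m. (g (Suc i) / t (Suc i))\<^sup>2 +
      (\<Sum>j\<in>{i<..<Suc m}. (cmod (v (i, j)))\<^sup>2 * (g (Suc j) / t (Suc i))\<^sup>2))"
      by (rule sum.cong[OF refl row]) simp
    ultimately show ?thesis by (simp only: sum.distrib distrib_left)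
  qed
  have B: "inverse (psi_N (Suc m) (unip_mat (Suc m) v)) =
      exp (\<Sum>s\<in>upper_idx m. - \<i> * uni_beta s * (v s + cnj (v s)))"
  proof -
    have "(\<Sum>j\<in>{i<..<Suc m}. - \<i> * uni_beta (i, j) * (v (i, j) + cnj (v (i, j)))) =
       - (2 * complex_of_real pi * \<i> * (v (i, Suc i) + cnj (v (i, Suc i))))" if "i < m" for i
    proof -
      have "(\<Sum>j\<in>{i<..<Suc m}. - \<i> * uni_beta (i, j) * (v (i, j) + cnj (v (i, j)))) =
         (\<Sum>j\<in>{i<..<Suc m}. if j = Suc i then - (2 * complex_of_real pi * \<i> * (v (i, j) + cnj (v (i, j)))) else 0)"
        by (rule sum.cong) (auto simp: uni_beta_def)
      then show ?thesis using that by (simp add: sum.delta)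
    qed
    then have "(\<Sum>s\<in>upper_idx m. - \<i> * uni_beta s * (v s + cnj (v s))) =
       (\<Sum>i<m. - (2 * complex_of_real pi * \<i> * (v (i, Suc i) + cnj (v (i, Suc i)))))"
      unfolding sum_upper_idx by (intro sum.cong) auto
    also have "\<dots> = - (2 * complex_of_real pi * \<i> * ((\<Sum>i<m. v (i, Suc i)) + cnj (\<Sum>i<m. v (i, Suc i))))"
      by (simp only: sum_negf sum.distrib cnj_sum sum_distrib_left[symmetric])
    also have "(\<Sum>i<m. v (i, Suc i)) = (\<Sum>i<Suc m - 1. unip_mat (Suc m) v $$ (i, i + 1))"
      by (rule sum.cong) (auto simp: unip_mat_def)
    finally show ?thesis by (simp only: psi_N_def psi_def exp_minus)
  qed
  have "(\<Prod>s\<in>upper_idx m. cgauss (uni_alpha s) (uni_beta s) (v s)) =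
      (\<Prod>s\<in>upper_idx m. complex_of_real (exp (- uni_alpha s * (cmod (v s))\<^sup>2)) * exp (- \<i> * uni_beta s * (v s + cnj (v s))))"
    by (rule prod.cong[OF refl], rule cgauss_def, rule uni_alpha_pos)
  also have "\<dots> = complex_of_real (exp (\<Sum>s\<in>upper_idx m. - uni_alpha s * (cmod (v s))\<^sup>2)) *
      exp (\<Sum>s\<in>upper_idx m. - \<i> * uni_beta s * (v s + cnj (v s)))"
    by (simp only: prod.distrib exp_sum[OF finite_upper_idx] of_real_prod)
  finally show ?thesis unfolding A B exp_add of_real_mult by (simp only: mult.assoc)
qed

text \<open>On the superdiagonal - i \<beta> / \<alpha> equals - i (t / g)^2, and the scaling g / t
  of the entry leaves - i t / g; the other coordinates vanish there because their \<beta> is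
  0.\<close>

lemma uni_entry_point:
  assumes "i < m" "j < Suc m"
  shows "uni_entry (\<lambda>s. - \<i> * uni_beta s / uni_alpha s) i j =
    (if j = i then complex_of_real (g (Suc i) / t (Suc i)) else if j = Suc i then - \<i> * complex_of_real (t (Suc i) / g (Suc (Suc i))) else 0)"
proof -
  have "0 < t (Suc i)" using assms by (auto intro!: t)
  show ?thesis
  proof (cases "j = Suc i")
    case True
    have "0 < g (Suc (Suc i))" using assms True by (auto intro!: g)
    with \<open>0 < t (Suc i)\<close> show ?thesis
      by (simp add: True uni_entry_def uni_beta_def uni_alpha_def power2_eq_square field_simps)
  qed (auto simp: uni_entry_def uni_beta_def)
qed

lemma conj_poly_uni: "conj_poly (upper_idx m) (\<lambda>w. Determinant.det (phi_mat (Suc m) (uni_entry w)) ^ \<kappa>)"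
  unfolding phi_mat_def
proof (intro conj_poly_power conj_poly_det)
  fix i j assume ij: "i < Suc m" "j < Suc m"
  show "conj_poly (upper_idx m) (\<lambda>w. if i = 0 then Var (j + 1) else Cst (uni_entry w (i - 1) j))"
  proof (cases "i \<noteq> 0 \<and> i - 1 < j")
    case True
    then have "(i - 1, j) \<in> upper_idx m" using ij by (auto simp: upper_idx_def)
    then have "conj_poly (upper_idx m) (\<lambda>w. Cst (w (i - 1, j)) * Cst (complex_of_real (g (Suc j) / t (Suc (i - 1)))))"
      by (intro conj_poly_mult conj_poly_var conj_poly_const finite_upper_idx)
    moreover have "uni_entry w (i - 1) j = w (i - 1, j) * complex_of_real (g (Suc j) / t (Suc (i - 1)))" for w
      using True by (simp add: uni_entry_def)
    ultimately show ?thesis using True by (simp only: Cst_mult if_False)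
  next
    case False
    then have "(\<lambda>w. if i = 0 then Var (j + 1) else Cst (uni_entry w (i - 1) j)) =
      (\<lambda>w. if i = 0 then Var (j + 1) else Cst (uni_entry (\<lambda>_. 0) (i - 1) j))"
      by (auto simp: uni_entry_def fun_eq_iff)
    then show ?thesis by (simp only: conj_poly_const)
  qed
qed

text \<open>With the measure 2 dx dy each coordinate contributes 2 pi / \<alpha> = (t / g)^2. On the
  superdiagonal \<beta>^2 / \<alpha> = 2 pi (t / g)^2, the exponent of the second Gaussian of
  \<open>torus_kernel\<close>.\<close>

lemma uni_constants:
  "(\<Prod>s\<in>upper_idx m. complex_of_real (2 * pi / uni_alpha s * exp (- (uni_beta s)\<^sup>2 / uni_alpha s))) =
   complex_of_real (exp (- 2 * pi * (\<Sum>i<m. (t (Suc i) / g (Suc (Suc i)))\<^sup>2)) *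
     (\<Prod>i<m. \<Prod>j\<in>{i<..<Suc m}. (t (Suc i) / g (Suc j))\<^sup>2))"
proof -
  have row: "(\<Prod>j\<in>{i<..<Suc m}. 2 * pi / uni_alpha (i, j) * exp (- (uni_beta (i, j))\<^sup>2 / uni_alpha (i, j))) =
      exp (- 2 * pi * (t (Suc i) / g (Suc (Suc i)))\<^sup>2) * (\<Prod>j\<in>{i<..<Suc m}. (t (Suc i) / g (Suc j))\<^sup>2)" if i: "i < m" for i
  proof -
    have "2 * pi / uni_alpha (i, j) * exp (- (uni_beta (i, j))\<^sup>2 / uni_alpha (i, j)) =
       (if j = Suc i then exp (- 2 * pi * (t (Suc i) / g (Suc (Suc i)))\<^sup>2) else 1) * (t (Suc i) / g (Suc j))\<^sup>2"
      if "j \<in> {i<..<Suc m}" for j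
    proof -
      have pos: "0 < g (Suc j)" "0 < t (Suc i)" using i that by (auto intro!: g t)
      then have "2 * pi / uni_alpha (i, j) = (t (Suc i) / g (Suc j))\<^sup>2"
        by (simp add: uni_alpha_def power_divide field_simps)
      moreover have "- (uni_beta (i, j))\<^sup>2 / uni_alpha (i, j) = (if j = Suc i then - 2 * pi * (t (Suc i) / g (Suc j))\<^sup>2 else 0)"
        using pos by (cases "j = Suc i") (auto simp: uni_alpha_def uni_beta_def power_divide power2_eq_square field_simps)
      ultimately show ?thesis by simp
    qed
    then have "(\<Prod>j\<in>{i<..<Suc m}. 2 * pi / uni_alpha (i, j) * exp (- (uni_beta (i, j))\<^sup>2 / uni_alpha (i, j))) =
       (\<Prod>j\<in>{i<..<Suc m}. (if j = Suc i then exp (- 2 * pi * (t (Suc i) / g (Suc (Suc i)))\<^sup>2) else 1) * (t (Suc i) / g (Suc j))\<^sup>2)"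
      by (intro prod.cong) auto
    also have "\<dots> = (\<Prod>j\<in>{i<..<Suc m}. if j = Suc i then exp (- 2 * pi * (t (Suc i) / g (Suc (Suc i)))\<^sup>2) else 1) *
       (\<Prod>j\<in>{i<..<Suc m}. (t (Suc i) / g (Suc j))\<^sup>2)" by (rule prod.distrib)
    finally show ?thesis using i by (simp add: prod.delta)
  qed
  have "(\<Prod>s\<in>upper_idx m. 2 * pi / uni_alpha s * exp (- (uni_beta s)\<^sup>2 / uni_alpha s)) =
     (\<Prod>i<m. exp (- 2 * pi * (t (Suc i) / g (Suc (Suc i)))\<^sup>2) * (\<Prod>j\<in>{i<..<Suc m}. (t (Suc i) / g (Suc j))\<^sup>2))"
    unfolding prod_upper_idx by (rule prod.cong[OF refl row]) simp
  also have "\<dots> = exp (- 2 * pi * (\<Sum>i<m. (t (Suc i) / g (Suc (Suc i)))\<^sup>2)) *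
     (\<Prod>i<m. \<Prod>j\<in>{i<..<Suc m}. (t (Suc i) / g (Suc j))\<^sup>2)"
    by (simp only: prod.distrib exp_sum[OF finite_lessThan] sum_distrib_left)
  finally show ?thesis by (simp only: of_real_prod[symmetric])
qed

text \<open>The shape of the kernels emerges here: the Gaussians in g_i / t_i come from the diagonal
  entries, those in t_i / g_(i+1) from the Fourier transform on the superdiagonal. The last product
  is a Jacobian, to be matched with the moduli.\<close>

lemma unipotent_integral:
  assumes l: "(\<Sum>i=1..Suc m. l i) = \<kappa>"
  shows "(LINT v|unip_measure (Suc m).
      Poly_Mapping.lookup (phi (Suc m) \<kappa> (Matrix.mat m (Suc m) (\<lambda>(i, j).
        (unip_mat (Suc m) v * diag_real (Suc m) g) $$ (i, j) / complex_of_real (t (i + 1))))) (monomial_exp (Suc m) l)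
      * inverse (psi_N (Suc m) (unip_mat (Suc m) v))) =
    (fact \<kappa> / (\<Prod>i=1..Suc m. fact (l i)) * \<i> ^ (\<Sum>i=1..m. partial_sum l i)) *
    complex_of_real (2 ^ (4 * m) *
      (\<Prod>i<m. (g (Suc i) / t (Suc i)) ^ (\<kappa> - partial_sum l (Suc i)) * (t (Suc i) / g (Suc (Suc i))) ^ partial_sum l (Suc i)) *
      (exp (- 2 * pi * (\<Sum>i<m. (g (Suc i) / t (Suc i))\<^sup>2)) * exp (- 2 * pi * (\<Sum>i<m. (t (Suc i) / g (Suc (Suc i)))\<^sup>2))) *
      (\<Prod>i<m. \<Prod>j\<in>{i<..<Suc m}. (t (Suc i) / g (Suc j))\<^sup>2))"
proof -
  let ?e = "monomial_exp (Suc m) l"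
  let ?R = "\<lambda>w. Determinant.det (phi_mat (Suc m) (uni_entry w)) ^ \<kappa>"
  define Y where "Y = (\<lambda>v. Matrix.mat m (Suc m) (\<lambda>(i, j). (unip_mat (Suc m) v * diag_real (Suc m) g) $$ (i, j) / complex_of_real (t (i + 1))))"
  have Yc: "Y v \<in> carrier_mat m (Suc m)" for v by (simp add: Y_def)
  let ?E = "complex_of_real (exp (- 2 * pi * (\<Sum>i<m. (g (Suc i) / t (Suc i))\<^sup>2)))"
  define k0 :: complex where "k0 = (-1) ^ (\<kappa> * m) * 2 ^ (4 * m)"
  have y: "Y v $$ (i, j) = uni_entry v i j" if "i < m" "j < Suc m" for v i j
    using that by (simp add: Y_def unip_mat_diag uni_entry_def del: index_mult_mat)
  have yR: "Determinant.det (phi_mat (Suc m) (\<lambda>i j. cnj (Y v $$ (i, j)))) ^ \<kappa> = ?R (\<lambda>s. cnj (v s))" for v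
  proof -
    have "phi_mat (Suc m) (\<lambda>i j. cnj (Y v $$ (i, j))) = phi_mat (Suc m) (uni_entry (\<lambda>s. cnj (v s)))"
    proof (rule eq_matI)
      fix i j assume "i < dim_row (phi_mat (Suc m) (uni_entry (\<lambda>s. cnj (v s))))" "j < dim_col (phi_mat (Suc m) (uni_entry (\<lambda>s. cnj (v s))))"
      then have ij: "i < Suc m" "j < Suc m" by (auto simp: phi_mat_def)
      have "cnj (Y v $$ (i - 1, j)) = uni_entry (\<lambda>s. cnj (v s)) (i - 1) j" if "i \<noteq> 0"
        using ij that by (subst y) (auto simp: uni_entry_def)
      then show "phi_mat (Suc m) (\<lambda>i j. cnj (Y v $$ (i, j))) $$ (i, j) = phi_mat (Suc m) (uni_entry (\<lambda>s. cnj (v s))) $$ (i, j)"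
        using ij by (simp add: phi_mat_def)
    qed (simp_all add: phi_mat_def)
    then show ?thesis by (simp only:)
  qed
  have int: "Poly_Mapping.lookup (phi (Suc m) \<kappa> (Y v)) ?e * inverse (psi_N (Suc m) (unip_mat (Suc m) v)) =
     k0 * ?E * (Poly_Mapping.lookup (?R (\<lambda>s. cnj (v s))) ?e * (\<Prod>s\<in>upper_idx m. cgauss (uni_alpha s) (uni_beta s) (v s)))" for v
  proof -
    have s: "(\<Sum>i<m. \<Sum>j<Suc m. (cmod (Y v $$ (i, j)))\<^sup>2) = (\<Sum>i<m. \<Sum>j<Suc m. (cmod (uni_entry v i j))\<^sup>2)"
      by (intro sum.cong refl) (simp only: y lessThan_iff)
    have "Poly_Mapping.lookup (phi (Suc m) \<kappa> (Y v)) ?e = k0 *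
       complex_of_real (exp (- 2 * pi * (\<Sum>i<m. \<Sum>j<Suc m. (cmod (uni_entry v i j))\<^sup>2))) *
       Poly_Mapping.lookup (?R (\<lambda>s. cnj (v s))) ?e"
      unfolding phi_eq[OF Yc] lookup_Cst_times yR s k0_def ..
    moreover have "k0 * x * r * p = k0 * e * (r * q)" if "x * p = e * q" for x r p e q
    proof -
      have "k0 * x * r * p = k0 * r * (x * p)" by (simp only: mult_ac)
      then show ?thesis unfolding that by (simp only: mult_ac)
    qed
    ultimately show ?thesis using uni_gauss[of v] by (simp only:)
  qed
  have S: "unip_measure (Suc m) = PiM (upper_idx m) (\<lambda>_. scale_measure 2 lborel)"
    unfolding unip_measure_def upper_idx_eq ..
  let ?p = "\<lambda>s. - \<i> * complex_of_real (uni_beta s) / complex_of_real (uni_alpha s)"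
  have bb: "phi_mat (Suc m) (uni_entry ?p) = bordered_bidiag (Suc m) (\<lambda>j. Var (j + 1))
      (\<lambda>i. Cst (complex_of_real (g (Suc i) / t (Suc i)))) (\<lambda>i. Cst (- \<i> * complex_of_real (t (Suc i) / g (Suc (Suc i)))))"
  proof (rule eq_matI)
    fix i j assume "i < dim_row (bordered_bidiag (Suc m) (\<lambda>j. Var (j + 1))
      (\<lambda>i. Cst (complex_of_real (g (Suc i) / t (Suc i)))) (\<lambda>i. Cst (- \<i> * complex_of_real (t (Suc i) / g (Suc (Suc i))))))"
      "j < dim_col (bordered_bidiag (Suc m) (\<lambda>j. Var (j + 1))
      (\<lambda>i. Cst (complex_of_real (g (Suc i) / t (Suc i)))) (\<lambda>i. Cst (- \<i> * complex_of_real (t (Suc i) / g (Suc (Suc i))))))"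
    then have ij: "i < Suc m" "j < Suc m" by (auto simp: bordered_bidiag_def)
    show "phi_mat (Suc m) (uni_entry ?p) $$ (i, j) = bordered_bidiag (Suc m) (\<lambda>j. Var (j + 1))
      (\<lambda>i. Cst (complex_of_real (g (Suc i) / t (Suc i)))) (\<lambda>i. Cst (- \<i> * complex_of_real (t (Suc i) / g (Suc (Suc i))))) $$ (i, j)"
    proof (cases i)
      case 0
      then show ?thesis using ij by (simp add: phi_mat_def bordered_bidiag_def)
    next
      case (Suc i')
      then show ?thesis using ij uni_entry_point[of i' j] by (auto simp: phi_mat_def bordered_bidiag_def)
    qed
  qed (simp_all add: phi_mat_def bordered_bidiag_def)
  \<comment> \<open>In each row (-1)^kappa (-1)^(kappa - L) (-1)^L = 1, so the sign in
    \<open>phi\<close> cancels and only i^L is left.\<close>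
  have sign: "k0 * (\<Prod>i<m. (- complex_of_real (g (Suc i) / t (Suc i))) ^ (\<kappa> - partial_sum l (Suc i)) *
        (- \<i> * complex_of_real (t (Suc i) / g (Suc (Suc i)))) ^ partial_sum l (Suc i)) =
     \<i> ^ (\<Sum>i=1..m. partial_sum l i) * complex_of_real (2 ^ (4 * m) *
       (\<Prod>i<m. (g (Suc i) / t (Suc i)) ^ (\<kappa> - partial_sum l (Suc i)) * (t (Suc i) / g (Suc (Suc i))) ^ partial_sum l (Suc i)))"
  proof -
    have one: "(-1) ^ \<kappa> * ((- complex_of_real A) ^ (\<kappa> - L) * (- \<i> * complex_of_real B) ^ L) =
        \<i> ^ L * complex_of_real (A ^ (\<kappa> - L) * B ^ L)" if "L \<le> \<kappa>" for A B L
    proof -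
      have "(- complex_of_real A) ^ (\<kappa> - L) = (-1) ^ (\<kappa> - L) * complex_of_real A ^ (\<kappa> - L)"
        by (rule power_minus)
      moreover have "(- \<i> * complex_of_real B) ^ L = (-1) ^ L * \<i> ^ L * complex_of_real B ^ L"
        by (simp only: power_mult_distrib power_minus[of \<i>])
      moreover have "(-1 :: complex) ^ \<kappa> * ((-1) ^ (\<kappa> - L) * (-1) ^ L) = 1"
      proof -
        have "(-1 :: complex) ^ (\<kappa> - L) * (-1) ^ L = (-1) ^ \<kappa>" using that by (simp flip: power_add)
        then show ?thesis by (simp flip: power_add power_mult_distrib)
      qed
      ultimately show ?thesis by (simp add: mult_ac)
    qed
    have "k0 * (\<Prod>i<m. (- complex_of_real (g (Suc i) / t (Suc i))) ^ (\<kappa> - partial_sum l (Suc i)) *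
        (- \<i> * complex_of_real (t (Suc i) / g (Suc (Suc i)))) ^ partial_sum l (Suc i)) =
       2 ^ (4 * m) * (\<Prod>i<m. (-1) ^ \<kappa> * ((- complex_of_real (g (Suc i) / t (Suc i))) ^ (\<kappa> - partial_sum l (Suc i)) *
        (- \<i> * complex_of_real (t (Suc i) / g (Suc (Suc i)))) ^ partial_sum l (Suc i)))"
      unfolding k0_def prod.distrib[of "\<lambda>_. (-1) ^ \<kappa>"] by (simp add: power_mult)
    also have "\<dots> = 2 ^ (4 * m) * (\<Prod>i<m. \<i> ^ partial_sum l (Suc i) *
        complex_of_real ((g (Suc i) / t (Suc i)) ^ (\<kappa> - partial_sum l (Suc i)) * (t (Suc i) / g (Suc (Suc i))) ^ partial_sum l (Suc i)))"
    proof (rule arg_cong2[where f="(*)", OF refl prod.cong[OF refl]])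
      fix i assume "i \<in> {..<m}"
      then have "partial_sum l (Suc i) \<le> \<kappa>" using partial_sum_le[of "Suc i" "Suc m" l] l by simp
      then show "(-1) ^ \<kappa> * ((- complex_of_real (g (Suc i) / t (Suc i))) ^ (\<kappa> - partial_sum l (Suc i)) *
        (- \<i> * complex_of_real (t (Suc i) / g (Suc (Suc i)))) ^ partial_sum l (Suc i)) = \<i> ^ partial_sum l (Suc i) *
        complex_of_real ((g (Suc i) / t (Suc i)) ^ (\<kappa> - partial_sum l (Suc i)) * (t (Suc i) / g (Suc (Suc i))) ^ partial_sum l (Suc i))"
        by (rule one)
    qed
    also have "\<dots> = (\<Prod>i<m. \<i> ^ partial_sum l (Suc i)) * complex_of_real (2 ^ (4 * m) *
       (\<Prod>i<m. (g (Suc i) / t (Suc i)) ^ (\<kappa> - partial_sum l (Suc i)) * (t (Suc i) / g (Suc (Suc i))) ^ partial_sum l (Suc i)))"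
      unfolding prod.distrib[of "\<lambda>i. \<i> ^ partial_sum l (Suc i)"] of_real_mult[of "2 ^ (4 * m)"] of_real_prod
      by simp
    also have "(\<Prod>i<m. \<i> ^ partial_sum l (Suc i)) = \<i> ^ (\<Sum>i=1..m. partial_sum l i)"
      by (simp only: power_sum One_nat_def sum.atLeast1_atMost_eq)
    finally show ?thesis .
  qed
  have "(LINT v|unip_measure (Suc m). Poly_Mapping.lookup (phi (Suc m) \<kappa> (Y v)) ?e * inverse (psi_N (Suc m) (unip_mat (Suc m) v))) =
     k0 * ?E * (Poly_Mapping.lookup (?R ?p) ?e *
      (\<Prod>s\<in>upper_idx m. complex_of_real (2 * pi / uni_alpha s * exp (- (uni_beta s)\<^sup>2 / uni_alpha s))))"
    unfolding int S integral_mult_right_zero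
    by (subst conj_poly_integral[OF finite_upper_idx uni_alpha_pos conj_poly_uni]) simp_all
  also have "Poly_Mapping.lookup (?R ?p) ?e = fact \<kappa> / (\<Prod>i=1..Suc m. fact (l i)) *
      (\<Prod>i<m. (- complex_of_real (g (Suc i) / t (Suc i))) ^ (\<kappa> - partial_sum l (Suc i)) *
        (- \<i> * complex_of_real (t (Suc i) / g (Suc (Suc i)))) ^ partial_sum l (Suc i))"
    unfolding bb by (rule lookup_det_bordered_power[OF l])
  finally have fin: "(LINT v|unip_measure (Suc m). Poly_Mapping.lookup (phi (Suc m) \<kappa> (Y v)) ?e * inverse (psi_N (Suc m) (unip_mat (Suc m) v))) =
     k0 * ?E * (fact \<kappa> / (\<Prod>i=1..Suc m. fact (l i)) *
      (\<Prod>i<m. (- complex_of_real (g (Suc i) / t (Suc i))) ^ (\<kappa> - partial_sum l (Suc i)) *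
        (- \<i> * complex_of_real (t (Suc i) / g (Suc (Suc i)))) ^ partial_sum l (Suc i)) *
      (\<Prod>s\<in>upper_idx m. complex_of_real (2 * pi / uni_alpha s * exp (- (uni_beta s)\<^sup>2 / uni_alpha s))))" .
  have gen: "k0 * E * ((f * p) * complex_of_real (e' * c)) =
      (f * s) * complex_of_real (k * q * (e * e') * c)"
    if "k0 * p = s * complex_of_real (k * q)" "E = complex_of_real e" for E f p s :: complex and e e' c k q :: real
  proof -
    have "k0 * E * ((f * p) * complex_of_real (e' * c)) = E * f * (k0 * p) * complex_of_real (e' * c)"
      by (simp only: mult_ac)
    then show ?thesis unfolding that by (simp only: of_real_mult mult_ac)
  qed
  show ?thesis
    using gen[OF sign refl] fin unfolding uni_constants Y_def by (simp only:)
qed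

end

section \<open>Spherical Whittaker functions on the torus\<close>

lemma GLD: "g \<in> GL n \<Longrightarrow> g \<in> carrier_mat n n" "g \<in> GL n \<Longrightarrow> Determinant.det g \<noteq> 0"
  by (auto simp: GL_def)

lemma GL_mult: "g \<in> GL n \<Longrightarrow> h \<in> GL n \<Longrightarrow> g * h \<in> GL n"
  by (auto simp: GL_def det_mult)

lemma diag_real_GL:
  assumes "\<And>i. i \<in> {1..n} \<Longrightarrow> 0 < t i"
  shows "diag_real n t \<in> GL n"
proof -
  have "(\<Prod>i=1..n. t i) > 0" using assms by (intro prod_pos) auto
  then have "Determinant.det (diag_real n t) \<noteq> 0"
    unfolding det_diag_real of_real_eq_0_iff by (rule less_imp_neq[symmetric])
  then show ?thesis by (simp add: GL_def)
qed

lemma mult_diag_real: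
  assumes "A \<in> carrier_mat n n"
  shows "A * diag_real n t = Matrix.mat n n (\<lambda>(i, j). A $$ (i, j) * complex_of_real (t (Suc j)))"
  unfolding diag_real_def by (subst mat_diag_mult_right[OF assms]) (auto intro!: eq_matI)

text \<open>Functions such as \<open>rtrans n h f\<close> are extended by zero, so identities
  between them are available on \<open>GL n\<close> only; differentiating one along a line requires
  a neighbourhood inside \<open>GL n\<close>.\<close>

lemma eventually_GL:
  assumes g: "g \<in> GL n" and D: "D \<in> carrier_mat n n"
  obtains S where "open S" "0 \<in> S" "\<And>s. s \<in> S \<Longrightarrow> g + complex_of_real s \<cdot>\<^sub>m D \<in> GL n"
proof
  let ?d = "\<lambda>s. \<Sum>p | p permutes {0..<n}. signof p * (\<Prod>i = 0..<n. g $$ (i, p i) + complex_of_real s * D $$ (i, p i))"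
  let ?S = "{s. ?d s \<noteq> 0}"
  have c: "g + complex_of_real s \<cdot>\<^sub>m D \<in> carrier_mat n n" for s using D by auto
  have det: "Determinant.det (g + complex_of_real s \<cdot>\<^sub>m D) = ?d s" for s
    unfolding det_def'[OF c]
    by (intro sum.cong prod.cong arg_cong2[where f="(*)"] refl)
      (use GLD(1)[OF g] D in \<open>auto simp: permutes_in_image\<close>)
  have "continuous_on UNIV ?d" by (intro continuous_intros)
  then show "open ?S" using open_Collect_neq[of ?d "\<lambda>_. 0"] by (simp add: continuous_on_const)
  have "g + complex_of_real 0 \<cdot>\<^sub>m D = g" using GLD(1)[OF g] D by (intro eq_matI) auto
  then show "0 \<in> ?S" using det[of 0] GLD(2)[OF g] by simp
  show "g + complex_of_real s \<cdot>\<^sub>m D \<in> GL n" if "s \<in> ?S" for s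
    using that c[of s] det[of s] by (simp add: GL_def)
qed

section \<open>Right translation by positive diagonal matrices and the central character\<close>

context
  fixes n :: nat and t :: "nat \<Rightarrow> real"
  assumes t: "\<And>i. i \<in> {1..n} \<Longrightarrow> 0 < t i"
begin

abbreviation "dt \<equiv> diag_real n t"

text \<open>A coordinate direction lives in a single column, hence is an eigenvector of right
  multiplication by a diagonal matrix.\<close>

lemma real_dirs_diag:
  assumes "D \<in> real_dirs n"
  obtains j where "D \<in> carrier_mat n n" "0 < t j" "D * dt = complex_of_real (t j) \<cdot>\<^sub>m D"
proof -
  from assms obtain i j c where D: "D = Matrix.mat n n (\<lambda>p. if p = (i, j) then c else 0)" "i < n" "j < n"
    by (auto simp: real_dirs_def)
  have "D * dt = complex_of_real (t (Suc j)) \<cdot>\<^sub>m D"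
    by (subst mult_diag_real) (auto simp: D intro!: eq_matI)
  moreover have "0 < t (Suc j)" using D by (intro t) auto
  ultimately show ?thesis using that[of "Suc j"] D by auto
qed

text \<open>Since (g + s D) dt = g dt + (t_j s) D, the chain rule contributes one factor t_j. The
  scalar \<open>a\<close> and the pair \<open>G\<close>, \<open>G'\<close> make this the induction
  step for iterated derivatives.\<close>

lemma scaled_derivative:
  assumes D: "D \<in> real_dirs n" and g: "g \<in> GL n"
    and G: "\<And>h. h \<in> GL n \<Longrightarrow> G h = a * G' (h * dt)"
    and diff: "(\<lambda>s::real. G' (g * dt + complex_of_real s \<cdot>\<^sub>m D)) differentiable (at 0)"
  obtains j where "0 < t j" "D * dt = complex_of_real (t j) \<cdot>\<^sub>m D"
    "((\<lambda>s::real. G (g + complex_of_real s \<cdot>\<^sub>m D)) has_vector_derivative (a * complex_of_real (t j)) * pderiv_mat D G' (g * dt)) (at 0)"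
proof -
  obtain j where Dc: "D \<in> carrier_mat n n" and tj: "0 < t j" and Dt: "D * dt = complex_of_real (t j) \<cdot>\<^sub>m D"
    using D by (rule real_dirs_diag)
  obtain S where S: "open S" "0 \<in> S" "\<And>s. s \<in> S \<Longrightarrow> g + complex_of_real s \<cdot>\<^sub>m D \<in> GL n"
    using eventually_GL[OF g Dc] by blast
  let ?H = "\<lambda>s::real. G' (g * dt + complex_of_real s \<cdot>\<^sub>m D)"
  have eq: "a * ?H (t j * s) = G (g + complex_of_real s \<cdot>\<^sub>m D)" if "s \<in> S" for s
  proof -
    have "(g + complex_of_real s \<cdot>\<^sub>m D) * dt = g * dt + (complex_of_real s \<cdot>\<^sub>m D) * dt"
      using GLD(1)[OF g] Dc by (intro add_mult_distrib_mat[of _ n n _ _ n]) auto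
    also have "(complex_of_real s \<cdot>\<^sub>m D) * dt = complex_of_real s \<cdot>\<^sub>m (D * dt)"
      using Dc by (intro mult_smult_assoc_mat[of _ n n _ n]) auto
    also have "\<dots> = complex_of_real (t j * s) \<cdot>\<^sub>m D"
      unfolding Dt using Dc by (intro eq_matI) auto
    finally show ?thesis using G[OF S(3)[OF that]] by simp
  qed
  have "(?H has_vector_derivative pderiv_mat D G' (g * dt)) (at 0)"
    using diff unfolding pderiv_mat_def vector_derivative_works .
  then have "(?H has_vector_derivative pderiv_mat D G' (g * dt)) (at (t j * 0))" by simp
  moreover have "((\<lambda>s. t j * s) has_vector_derivative t j) (at 0)"
    by (auto intro!: derivative_eq_intros simp flip: has_real_derivative_iff_has_vector_derivative)
  ultimately have "((?H \<circ> (\<lambda>s. t j * s)) has_vector_derivative t j *\<^sub>R pderiv_mat D G' (g * dt)) (at 0)"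
    by (intro vector_diff_chain_at) auto
  then have "((\<lambda>s. a * ?H (t j * s)) has_vector_derivative a * (t j *\<^sub>R pderiv_mat D G' (g * dt))) (at 0)"
    unfolding o_def by (rule has_vector_derivative_mult_right)
  then have "((\<lambda>s. G (g + complex_of_real s \<cdot>\<^sub>m D)) has_vector_derivative a * (t j *\<^sub>R pderiv_mat D G' (g * dt))) (at 0)"
    by (rule has_vector_derivative_transform_within_open[OF _ S(1,2) eq])
  then show ?thesis using that[OF tj Dt] by (simp add: scaleR_conv_of_real mult_ac)
qed

text \<open>The scalar is the product of the t_j over the columns of the directions in
  \<open>Ds\<close>. It exists because a diagonal translation does not mix coordinate
  directions.\<close>

lemma iter_pderiv_rtrans:
  assumes f: "f \<in> smooth_GL n" and Ds: "Ds \<in> lists (real_dirs n)"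
  shows "\<exists>a. \<forall>g\<in>GL n. iter_pderiv Ds (rtrans n dt f) g = a * iter_pderiv Ds f (g * dt)"
  using Ds
proof (induction Ds)
  case Nil
  then show ?case by (intro exI[of _ 1]) (simp add: iter_pderiv_def rtrans_def)
next
  case (Cons D Ds)
  then obtain a where a: "\<And>h. h \<in> GL n \<Longrightarrow> iter_pderiv Ds (rtrans n dt f) h = a * iter_pderiv Ds f (h * dt)"
    by blast
  obtain j where j: "0 < t j" "D * dt = complex_of_real (t j) \<cdot>\<^sub>m D" "D \<in> carrier_mat n n"
    using Cons.hyps by (metis real_dirs_diag)
  show ?case
  proof (intro exI[of _ "a * complex_of_real (t j)"] ballI)
    fix g assume g: "g \<in> GL n"
    have "(\<lambda>s::real. iter_pderiv Ds f (g * dt + complex_of_real s \<cdot>\<^sub>m D)) differentiable (at 0)"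
      using f Cons.hyps GL_mult[OF g diag_real_GL[OF t]] by (auto simp: smooth_GL_def)
    then obtain j' where j': "0 < t j'" "D * dt = complex_of_real (t j') \<cdot>\<^sub>m D"
      "((\<lambda>s::real. iter_pderiv Ds (rtrans n dt f) (g + complex_of_real s \<cdot>\<^sub>m D)) has_vector_derivative
         (a * complex_of_real (t j')) * pderiv_mat D (iter_pderiv Ds f) (g * dt)) (at 0)"
      using scaled_derivative[where G="iter_pderiv Ds (rtrans n dt f)" and G'="iter_pderiv Ds f", OF Cons.hyps(1) g a] by blast
    \<comment> \<open>Both numbers scale the same direction, so they could differ only for D = 0,
      where the derivative vanishes.\<close>
    have "t j' = t j \<or> D = 0\<^sub>m n n"
    proof (rule disjCI)
      assume "D \<noteq> 0\<^sub>m n n"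
      then obtain p q where pq: "p < n" "q < n" "D $$ (p, q) \<noteq> 0" using j(3) by (metis carrier_matD eq_matI index_zero_mat)
      have "(complex_of_real (t j) \<cdot>\<^sub>m D) $$ (p, q) = (complex_of_real (t j') \<cdot>\<^sub>m D) $$ (p, q)" using j j' by simp
      then show "t j' = t j" using pq j(3) by simp
    qed
    moreover have "pderiv_mat D (iter_pderiv Ds f) (g * dt) = 0" if "D = 0\<^sub>m n n"
    proof -
      have "A + complex_of_real s \<cdot>\<^sub>m D = A" if "A \<in> carrier_mat n n" for A s
        unfolding \<open>D = 0\<^sub>m n n\<close> using that by (intro eq_matI) auto
      from this[OF mult_carrier_mat[OF GLD(1)[OF g] diag_real_carrier]]
      have "g * dt + complex_of_real s \<cdot>\<^sub>m D = g * dt" for s .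
      then show ?thesis unfolding pderiv_mat_def by simp
    qed
    ultimately show "iter_pderiv (D # Ds) (rtrans n dt f) g = a * complex_of_real (t j) * iter_pderiv (D # Ds) f (g * dt)"
      using vector_derivative_at[OF j'(3)] unfolding iter_pderiv_def by (auto simp: pderiv_mat_def)
  qed
qed

lemma continuous_map_GL_mult_diag: "continuous_map (GL_top n) (GL_top n) (\<lambda>g. g * dt)"
proof -
  let ?e = "\<lambda>g (i, j). if i < n \<and> j < n then g $$ (i, j) else 0 :: complex"
  let ?\<phi> = "\<lambda>w (i::nat, j). w (i, j) * complex_of_real (t (Suc j))"
  have top: "topspace (GL_top n) = GL n"
    unfolding GL_top_def topspace_pullback_topology by simp
  have "continuous_on UNIV ?\<phi>"
  proof (intro continuous_on_coordinatewise_then_product)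
    fix p :: "nat \<times> nat"
    show "continuous_on UNIV (\<lambda>w. ?\<phi> w p)"
      by (cases p) (simp add: continuous_intros)
  qed
  then have "continuous_map (GL_top n) euclidean (?\<phi> \<circ> ?e)"
    unfolding GL_top_def by (intro continuous_map_pullback) simp
  then have "continuous_map (GL_top n) euclidean (?e \<circ> (\<lambda>g. g * dt))"
  proof (rule continuous_map_eq)
    fix g assume "g \<in> topspace (GL_top n)"
    then have "g \<in> carrier_mat n n" unfolding top by (rule GLD)
    then show "(?\<phi> \<circ> ?e) g = (?e \<circ> (\<lambda>g. g * dt)) g"
      by (auto simp: fun_eq_iff mult_diag_real)
  qed
  moreover have "topspace (GL_top n) \<subseteq> (\<lambda>g. g * dt) -` GL n"
    unfolding top using GL_mult[OF _ diag_real_GL[OF t]] by auto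
  ultimately show ?thesis
    unfolding GL_top_def[of n] by (intro continuous_map_pullback') auto
qed

lemma rtrans_smooth:
  assumes f: "f \<in> smooth_GL n"
  shows "rtrans n dt f \<in> smooth_GL n"
  unfolding smooth_GL_def
proof (intro CollectI conjI ballI allI impI)
  show "rtrans n dt f g = 0" if "g \<notin> GL n" for g using that by (simp add: rtrans_def)
next
  fix Ds assume Ds: "Ds \<in> lists (real_dirs n)"
  then obtain a where a: "\<And>g. g \<in> GL n \<Longrightarrow> iter_pderiv Ds (rtrans n dt f) g = a * iter_pderiv Ds f (g * dt)"
    using iter_pderiv_rtrans[OF f] by blast
  have c: "continuous_map (GL_top n) euclidean (iter_pderiv Ds f)" using f Ds by (auto simp: smooth_GL_def)
  have "continuous_map (GL_top n) euclidean (iter_pderiv Ds f \<circ> (\<lambda>g. g * dt))"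
    by (rule continuous_map_compose[OF continuous_map_GL_mult_diag c])
  then have "continuous_map (GL_top n) euclidean ((\<lambda>w. a * w) \<circ> (iter_pderiv Ds f \<circ> (\<lambda>g. g * dt)))"
    by (rule continuous_map_compose) (simp add: continuous_intros)
  then show "continuous_map (GL_top n) euclidean (iter_pderiv Ds (rtrans n dt f))"
  proof (rule continuous_map_eq)
    fix g assume "g \<in> topspace (GL_top n)"
    then have "g \<in> GL n" unfolding GL_top_def topspace_pullback_topology by simp
    then show "((\<lambda>w. a * w) \<circ> (iter_pderiv Ds f \<circ> (\<lambda>g. g * dt))) g = iter_pderiv Ds (rtrans n dt f) g"
      by (simp add: a)
  qed
  fix D g assume D: "D \<in> real_dirs n" and g: "g \<in> GL n"
  have "(\<lambda>s::real. iter_pderiv Ds f (g * dt + complex_of_real s \<cdot>\<^sub>m D)) differentiable (at 0)"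
    using f Ds D GL_mult[OF g diag_real_GL[OF t]] by (auto simp: smooth_GL_def)
  then show "(\<lambda>s::real. iter_pderiv Ds (rtrans n dt f) (g + complex_of_real s \<cdot>\<^sub>m D)) differentiable (at 0)"
    using scaled_derivative[where G="iter_pderiv Ds (rtrans n dt f)" and G'="iter_pderiv Ds f", OF D g a]
    by (metis differentiableI_vector)
qed

text \<open>A Whittaker functional is linear only on its space, so the translate must be shown to
  lie there before scalars can be taken out in \<open>whittaker_central\<close>.\<close>

lemma rtrans_principal_series:
  assumes f: "f \<in> principal_series n \<mu> k"
  shows "rtrans n dt f \<in> principal_series n \<mu> k"
  unfolding principal_series_def
proof (intro CollectI conjI ballI)
  show "rtrans n dt f \<in> smooth_GL n" using f by (intro rtrans_smooth) (auto simp: principal_series_def)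
  fix b g assume b: "b \<in> Borel n" and g: "g \<in> GL n"
  have bG: "b \<in> GL n" using b by (simp add: Borel_def)
  have gt: "g * dt \<in> GL n" by (rule GL_mult[OF g diag_real_GL[OF t]])
  have "b * g * dt = b * (g * dt)"
    using GLD(1)[OF bG] GLD(1)[OF g] by (intro assoc_mult_mat[of _ n n _ n _ n]) auto
  then show "rtrans n dt f (b * g) = (\<Prod>i=1..n. chi (\<mu> i) (k i) (b $$ (i - 1, i - 1))) *
      complex_of_real (sqrt (delta_B n b)) * rtrans n dt f g"
    using f b gt g GL_mult[OF bG g] by (simp add: principal_series_def rtrans_def)
qed

text \<open>The scalar matrix can be moved to the left of the argument, where the Borel equivariance
  applies. Its modulus is 1, and each character contributes z powr (2 mu_i) because
  \<open>absC\<close> squares.\<close>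

lemma whittaker_central:
  assumes W: "W \<in> whittaker_model n (principal_series n \<mu> (\<lambda>_. 0))" and z: "0 < z"
  shows "W (diag_real n (\<lambda>i. z * t i)) = complex_of_real z powr (2 * (\<Sum>i=1..n. \<mu> i)) * W dt"
proof -
  let ?V = "principal_series n \<mu> (\<lambda>_. 0)"
  obtain \<Lambda> f where L: "whittaker_functional n ?V \<Lambda>" and f: "f \<in> ?V" and Wf: "\<And>g. g \<in> GL n \<Longrightarrow> W g = \<Lambda> (rtrans n g f)"
    using W unfolding whittaker_model_def by blast
  let ?Z = "diag_real n (\<lambda>_. z)" and ?zt = "diag_real n (\<lambda>i. z * t i)"
  let ?c = "complex_of_real z powr (2 * (\<Sum>i=1..n. \<mu> i))"
  have ztG: "?zt \<in> GL n" by (rule diag_real_GL) (use t z in auto)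
  have ZG: "?Z \<in> GL n" by (rule diag_real_GL) (use z in auto)
  have Zii: "?Z $$ (i, i) = complex_of_real z" if "i < n" for i using that by (simp add: diag_real_def mat_diag_def)
  have ZB: "?Z \<in> Borel n" using ZG by (auto simp: Borel_def upper_triangular_def diag_real_def mat_diag_def)
  have chi: "chi (\<mu> i) 0 (complex_of_real z) = complex_of_real z powr (2 * \<mu> i)" for i
  proof -
    have "complex_of_real (z\<^sup>2) powr \<mu> i = complex_of_real z powr \<mu> i * complex_of_real z powr \<mu> i"
      unfolding power2_eq_square using z by (intro of_real_powr_mult) auto
    then show ?thesis using z by (simp add: chi_def absC_def powr_add[symmetric])
  qed
  have cprod: "(\<Prod>i=1..n. chi (\<mu> i) 0 (?Z $$ (i - 1, i - 1))) = ?c"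
  proof -
    have "(\<Prod>i=1..n. chi (\<mu> i) 0 (?Z $$ (i - 1, i - 1))) = (\<Prod>i=1..n. complex_of_real z powr (2 * \<mu> i))"
      by (rule prod.cong[OF refl]) (subst Zii, auto simp: chi)
    also have "\<dots> = complex_of_real z powr (\<Sum>i=1..n. 2 * \<mu> i)"
      using z by (intro powr_sum[symmetric]) auto
    finally show ?thesis by (simp add: sum_distrib_left)
  qed
  have dB: "delta_B n ?Z = 1"
    unfolding delta_B_def by (intro prod.neutral ballI) (use z in \<open>auto simp: Zii absC_def\<close>)
  have key: "rtrans n ?zt f = (\<lambda>g. ?c * rtrans n dt f g)"
  proof
    fix g
    show "rtrans n ?zt f g = ?c * rtrans n dt f g"
    proof (cases "g \<in> GL n")
      case True
      note gc = GLD(1)[OF True]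
      have "g * ?zt = ?Z * (g * dt)"
      proof (rule eq_matI)
        fix i j assume "i < dim_row (?Z * (g * dt))" "j < dim_col (?Z * (g * dt))"
        then have ij: "i < n" "j < n" by (auto simp: diag_real_def mat_diag_def)
        have "?Z * (g * dt) = Matrix.mat n n (\<lambda>(i, j). complex_of_real z * (g * dt) $$ (i, j))"
          using gc mult_carrier_mat[OF gc diag_real_carrier] unfolding diag_real_def by (intro mat_diag_mult_left) (simp add: diag_real_def)
        then show "(g * ?zt) $$ (i, j) = (?Z * (g * dt)) $$ (i, j)"
          using ij by (simp add: mult_diag_real[OF gc])
      qed (use gc in \<open>auto simp: diag_real_def mat_diag_def\<close>)
      moreover have "f (?Z * (g * dt)) = ?c * f (g * dt)"
        using f ZB GL_mult[OF True diag_real_GL[OF t]] cprod dB by (simp add: principal_series_def)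
      ultimately show ?thesis using True by (simp add: rtrans_def)
    qed (simp add: rtrans_def)
  qed
  let ?F = "rtrans n dt f"
  have F: "?F \<in> ?V" by (rule rtrans_principal_series[OF f])
  \<comment> \<open>Linearity is given in the combined form c f + h; writing c F as (c - 1) F + F
    extracts homogeneity.\<close>
  have "\<Lambda> (\<lambda>g. (?c - 1) * ?F g + ?F g) = (?c - 1) * \<Lambda> ?F + \<Lambda> ?F"
    using L F by (auto simp: whittaker_functional_def)
  then have "\<Lambda> (\<lambda>g. ?c * ?F g) = ?c * \<Lambda> ?F" by (simp add: algebra_simps)
  then show ?thesis using Wf[OF ztG] Wf[OF diag_real_GL[OF t]] key by simp
qed

end

lemma delta_B_diag_real:
  "delta_B m (diag_real m t) = (\<Prod>j<m. \<Prod>i<j. (t (Suc i) / t (Suc j))\<^sup>2)"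
  unfolding delta_B_def
  by (intro prod.cong refl) (auto simp: diag_real_def mat_diag_def absC_def norm_divide power_divide)

text \<open>A torus element is \<open>t\<^sub>m\<close> times an element of the form \<open>tmat\<close>; the former acts by the
  central character.\<close>

lemma spherical_whittaker_torus:
  assumes W: "spherical_whittaker m \<mu> W" and m: "1 \<le> m" and t: "\<And>i. i \<in> {1..m} \<Longrightarrow> 0 < t i"
  shows "W (diag_real m t) = complex_of_real (delta_B m (diag_real m t) powr (1/2)) *
    complex_of_real (t m) powr (2 * (\<Sum>i=1..m. \<mu> i)) * spherical_torus m \<mu> (\<lambda>j\<in>{1..m-1}. t j / t (Suc j))"
proof (cases "m = 1")
  case True
  have t1: "0 < t 1" using t m by auto
  have "W (diag_real m t) = complex_of_real (absC (Determinant.det (diag_real 1 t))) powr \<mu> 1"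
    using W diag_real_GL[of m t] t True by (simp add: spherical_whittaker_def)
  also have "absC (Determinant.det (diag_real 1 t)) = t 1 * t 1"
    by (simp add: det_diag_real absC_def power2_eq_square abs_mult_self)
  also have "complex_of_real (t 1 * t 1) powr \<mu> 1 = complex_of_real (t 1) powr (2 * \<mu> 1)"
    using t1 by (subst of_real_powr_mult) (auto simp flip: powr_add)
  finally show ?thesis using True by (simp add: delta_B_def)
next
  case False
  let ?b = "\<lambda>j\<in>{1..m-1}. t j / t (Suc j)"
  let ?t' = "\<lambda>i. \<Prod>j=i..<m. ?b j"
  have tm: "0 < t m" using t m by auto
  have b: "0 < ?b j" if "j \<in> {1..m-1}" for j using that t by auto
  have tele: "t m * ?t' i = t i" if "i \<in> {1..m}" for i
    using that
  proof (induction "m - i" arbitrary: i)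
    case 0
    then show ?case by simp
  next
    case (Suc k)
    then have i: "i \<in> {1..m-1}" "Suc i \<in> {1..m}" by auto
    have "?t' i = ?b i * ?t' (Suc i)" using i by (subst prod.atLeast_Suc_lessThan) auto
    then have "t m * ?t' i = ?b i * (t m * ?t' (Suc i))" by simp
    also have "t m * ?t' (Suc i) = t (Suc i)" using Suc i by (intro Suc.hyps(1)) auto
    also have "?b i * t (Suc i) = t i" using i t[of "Suc i"] by simp
    finally show ?case .
  qed
  have t': "0 < ?t' i" if "i \<in> {1..m}" for i
    using tele[OF that] t[OF that] tm by (metis zero_less_mult_pos)
  have dt: "diag_real m t = diag_real m (\<lambda>i. t m * ?t' i)"
  proof -
    have "complex_of_real (t (i + 1)) = complex_of_real (t m * ?t' (i + 1))" if "i < m" for i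
      using that by (subst tele) auto
    then show ?thesis
      unfolding diag_real_def mat_diag_def by (intro cong_mat refl) (simp only: prod.case)
  qed
  have tmat: "tmat m ?b = diag_real m ?t'" unfolding tmat_def ..
  have W1: "W (diag_real m t) = complex_of_real (t m) powr (2 * (\<Sum>i=1..m. \<mu> i)) * W (tmat m ?b)"
    unfolding dt tmat
    by (rule whittaker_central[OF t' _ tm]) (use W in \<open>auto simp: spherical_whittaker_def\<close>)
  have d: "delta_B m (tmat m ?b) = delta_B m (diag_real m t)"
    unfolding tmat delta_B_diag_real
  proof (intro prod.cong refl)
    fix j i assume "j \<in> {..<m}" "i \<in> {..<j}"
    then have ij: "Suc i \<in> {1..m}" "Suc j \<in> {1..m}" by auto
    have "t (Suc i) / t (Suc j) = (t m * ?t' (Suc i)) / (t m * ?t' (Suc j))" by (simp only: tele ij)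
    also have "\<dots> = ?t' (Suc i) / ?t' (Suc j)" using tm by (intro mult_divide_mult_cancel_left) simp
    finally show "(?t' (Suc i) / ?t' (Suc j))\<^sup>2 = (t (Suc i) / t (Suc j))\<^sup>2" by (simp only:)
  qed
  have dpos: "0 < delta_B m (diag_real m t)"
    unfolding delta_B_diag_real
  proof (intro prod_pos ballI)
    fix j i assume "j \<in> {..<m}" "i \<in> {..<j}"
    then have "0 < t (Suc i)" "0 < t (Suc j)" by (auto intro!: t)
    then show "0 < (t (Suc i) / t (Suc j))\<^sup>2" by simp
  qed
  have "torus_part m W ?b = spherical_torus m \<mu> ?b"
  proof -
    have "\<forall>a. (\<forall>j\<in>{1..m-1}. 0 < a j) \<longrightarrow> torus_part m W a = spherical_torus m \<mu> a"
      by (rule conjunct2[OF conjunct2[OF W[unfolded spherical_whittaker_def if_not_P[OF False]]]])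
    then show ?thesis by (rule allE) (erule mp, intro ballI b)
  qed
  then have "complex_of_real (delta_B m (diag_real m t) powr (- 1/2)) * W (tmat m ?b) = spherical_torus m \<mu> ?b"
    unfolding torus_part_def d .
  moreover have "complex_of_real (delta_B m (diag_real m t) powr (1/2)) * complex_of_real (delta_B m (diag_real m t) powr (- 1/2)) = 1"
    using dpos by (simp flip: of_real_mult powr_add)
  moreover have "q = a * s" if "b * q = s" "a * b = 1" for a b q s :: complex
    unfolding that(1)[symmetric] mult.assoc[symmetric] that(2) by simp
  ultimately have "W (tmat m ?b) = complex_of_real (delta_B m (diag_real m t) powr (1/2)) * spherical_torus m \<mu> ?b"
    by blast
  then show ?thesis unfolding W1 by (simp only: mult_ac)
qed

section \<open>Comparison of the two torus integrals\<close>

text \<open>Here x is the diagonal of t and y that of g. The left side is the unipotent Jacobian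
  times |det g|^((n-1)/2); the right side is |det t|^(n/2) times the square roots of both moduli.
  Solved for the last factor, it shows that exactly the square root of \<open>delta_B\<close> at g
  survives.\<close>

lemma modulus_identity:
  fixes x y :: "nat \<Rightarrow> real"
  assumes "\<And>i. i < m \<Longrightarrow> 0 < x i" "\<And>i. i < Suc m \<Longrightarrow> 0 < y i"
  shows "(\<Prod>i<m. \<Prod>j\<in>{i<..<Suc m}. (x i / y j)\<^sup>2) * (\<Prod>i<Suc m. y i) ^ m =
    (\<Prod>i<m. x i) ^ Suc m * (\<Prod>j<m. \<Prod>i<j. x i / x j) * (\<Prod>j<Suc m. \<Prod>i<j. y i / y j)"
  using assms
proof (induction m)
  case (Suc m)
  define A where "A = (\<Prod>i<m. \<Prod>j\<in>{i<..<Suc m}. (x i / y j)\<^sup>2)"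
  define X Y Dx Dy where "X = (\<Prod>i<m. x i)" and "Y = (\<Prod>i<Suc m. y i)"
    and "Dx = (\<Prod>j<m. \<Prod>i<j. x i / x j)" and "Dy = (\<Prod>j<Suc m. \<Prod>i<j. y i / y j)"
  have IH: "A * Y ^ m = X ^ Suc m * Dx * Dy"
    unfolding A_def X_def Y_def Dx_def Dy_def by (rule Suc.IH) (use Suc.prems in auto)
  define u w where "u = x m" and "w = y (Suc m)"
  have pos: "u > 0" "w > 0" using Suc.prems by (auto simp: u_def w_def)
  have X': "(\<Prod>i<Suc m. x i) = X * u" by (simp add: X_def u_def)
  have A': "(\<Prod>i<Suc m. \<Prod>j\<in>{i<..<Suc (Suc m)}. (x i / y j)\<^sup>2) = A * ((X * u) / w ^ Suc m)\<^sup>2"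
  proof -
    have "(\<Prod>j\<in>{i<..<Suc (Suc m)}. (x i / y j)\<^sup>2) = (x i / w)\<^sup>2 * (\<Prod>j\<in>{i<..<Suc m}. (x i / y j)\<^sup>2)" if "i < Suc m" for i
    proof -
      have "{i<..<Suc (Suc m)} = insert (Suc m) {i<..<Suc m}" using that by auto
      then show ?thesis by (simp add: w_def)
    qed
    then have "(\<Prod>i<Suc m. \<Prod>j\<in>{i<..<Suc (Suc m)}. (x i / y j)\<^sup>2) =
        (\<Prod>i<Suc m. (x i / w)\<^sup>2 * (\<Prod>j\<in>{i<..<Suc m}. (x i / y j)\<^sup>2))"
      by (intro prod.cong) auto
    also have "\<dots> = (\<Prod>i<Suc m. x i / w)\<^sup>2 * (\<Prod>i<Suc m. \<Prod>j\<in>{i<..<Suc m}. (x i / y j)\<^sup>2)"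
      by (simp only: prod.distrib prod_power_distrib)
    also have "(\<Prod>i<Suc m. x i / w) = (X * u) / w ^ Suc m"
      unfolding prod_dividef X' by simp
    also have "(\<Prod>i<Suc m. \<Prod>j\<in>{i<..<Suc m}. (x i / y j)\<^sup>2) = A"
    proof -
      have "{m<..<Suc m} = {}" by auto
      then show ?thesis by (simp add: A_def)
    qed
    finally show ?thesis by (simp only: mult.commute)
  qed
  have Y': "(\<Prod>i<Suc (Suc m). y i) = Y * w" by (simp add: Y_def w_def)
  have Dx': "(\<Prod>j<Suc m. \<Prod>i<j. x i / x j) = Dx * (X / u ^ m)"
    by (simp add: Dx_def X_def u_def prod_dividef)
  have Dy': "(\<Prod>j<Suc (Suc m). \<Prod>i<j. y i / y j) = Dy * (Y / w ^ Suc m)"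
    by (simp add: Dy_def Y_def w_def prod_dividef)
  have "A * ((X * u) / w ^ Suc m)\<^sup>2 * (Y * w) ^ Suc m = (A * Y ^ m) * (Y * (X * u)\<^sup>2 / w ^ Suc m)"
    using pos by (simp add: power_divide power_mult_distrib power2_eq_square)
  also have "\<dots> = (X * u) ^ Suc (Suc m) * (Dx * (X / u ^ m)) * (Dy * (Y / w ^ Suc m))"
    unfolding IH using pos by (simp add: power_mult_distrib power2_eq_square)
  finally show ?case unfolding A' X' Y' Dx' Dy' .
qed simp

lemma of_real_powr_prod:
  assumes "\<And>i. i \<in> I \<Longrightarrow> 0 < x i"
  shows "complex_of_real (\<Prod>i\<in>I. x i) powr z = (\<Prod>i\<in>I. complex_of_real (x i) powr z)"
  using assms
proof (induction I rule: infinite_finite_induct)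
  case (insert i I)
  then have p: "0 < x i" "0 < prod x I" by (auto intro: prod_pos)
  show ?case
    unfolding prod.insert[OF insert(1,2)] of_real_powr_mult[OF p] using insert by simp
qed auto

lemma of_real_power_powr:
  assumes "x > 0"
  shows "complex_of_real (x ^ k) powr z = complex_of_real x powr (of_nat k * z)"
proof -
  have "complex_of_real (x ^ k) powr z = (\<Prod>i<k. complex_of_real x powr z)"
    using of_real_powr_prod[of "{..<k}" "\<lambda>_. x" z] assms by simp
  also have "\<dots> = complex_of_real x powr (of_nat k * z)"
    using assms by (simp add: powr_def flip: exp_of_nat_mult)  (simp add: mult.assoc)
  finally show ?thesis .
qed

text \<open>Multiplicative summation by parts: weights j on the ratios g_j / g_(j+1) amount to
  weight 1 on every entry. This turns the shifts \<open>j * \<nu> 1\<close> into a power of the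
  determinant.\<close>

lemma prod_ratio_powers:
  fixes g :: "nat \<Rightarrow> real"
  assumes "\<And>j. 0 < g j"
  shows "(\<Prod>i<k. (g (Suc i) / g (Suc (Suc i))) ^ Suc i) * g (Suc k) ^ k = (\<Prod>i<k. g (Suc i))"
proof (induction k)
  case (Suc k)
  have "g (Suc (Suc k)) \<noteq> 0" using assms[of "Suc (Suc k)"] by simp
  then have "(g (Suc k) / g (Suc (Suc k))) ^ Suc k * g (Suc (Suc k)) ^ Suc k = g (Suc k) ^ k * g (Suc k)"
    by (simp add: power_divide)
  then have "(\<Prod>i<Suc k. (g (Suc i) / g (Suc (Suc i))) ^ Suc i) * g (Suc (Suc k)) ^ Suc k =
      ((\<Prod>i<k. (g (Suc i) / g (Suc (Suc i))) ^ Suc i) * g (Suc k) ^ k) * g (Suc k)"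
    by (simp only: prod.lessThan_Suc mult.assoc)
  then show ?case unfolding Suc.IH by simp
qed simp

text \<open>Since (a / x)(x / b) = a / b, the common exponent w no longer involves x. The constant
  16 is 4 times 4, one of the factors 2^4 in \<open>phi\<close>.\<close>

lemma gker_pair:
  assumes "0 < x" "0 < a" "0 < b" and L: "L \<le> \<kappa>"
  shows "gker (of_nat L / 2 + w + \<eta>) (x / b) * gker ((of_nat \<kappa> - of_nat L) / 2 + w) (a / x) =
    complex_of_real (16 * ((a / x) ^ (\<kappa> - L) * (x / b) ^ L) * (exp (- 2 * pi * (a / x)\<^sup>2) * exp (- 2 * pi * (x / b)\<^sup>2))) *
    complex_of_real (a / b) powr (2 * w) * complex_of_real (x / b) powr (2 * \<eta>)"
proof -
  define p q where "p = x / b" and "q = a / x"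
  have pq: "0 < p" "0 < q" "a / b = q * p" using assms by (auto simp: p_def q_def)
  have P: "complex_of_real p powr (2 * (of_nat L / 2 + w + \<eta>)) = complex_of_real p ^ L * complex_of_real p powr (2 * w) * complex_of_real p powr (2 * \<eta>)"
  proof -
    have "2 * (of_nat L / 2 + w + \<eta>) = of_nat L + 2 * w + 2 * \<eta>" by (simp add: algebra_simps)
    then show ?thesis using pq by (simp add: powr_add powr_nat)
  qed
  have Q: "complex_of_real q powr (2 * ((of_nat \<kappa> - of_nat L) / 2 + w)) = complex_of_real q ^ (\<kappa> - L) * complex_of_real q powr (2 * w)"
  proof -
    have "2 * ((of_nat \<kappa> - of_nat L) / 2 + w) = of_nat (\<kappa> - L) + 2 * w" by (simp add: of_nat_diff[OF L] distrib_left)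
    then show ?thesis using pq by (simp add: powr_add powr_nat)
  qed
  have R: "complex_of_real (q * p) powr (2 * w) = complex_of_real q powr (2 * w) * complex_of_real p powr (2 * w)"
    using pq by (intro of_real_powr_mult)
  show ?thesis
    unfolding p_def[symmetric] q_def[symmetric] pq(3) gker_def P Q R
    by (simp only: of_real_mult of_real_power mult_ac) simp
qed

context
  fixes r \<kappa> :: nat and \<nu> :: "nat \<Rightarrow> complex" and l :: "nat \<Rightarrow> nat" and W :: "complex mat \<Rightarrow> complex"
    and g :: "nat \<Rightarrow> real"
  assumes W: "spherical_whittaker (Suc r) (tilde \<nu>) W" and l: "(\<Sum>i=1..Suc (Suc r). l i) = \<kappa>"
    and g: "\<And>j. 0 < g j" and gend: "g (Suc (Suc r)) = 1"
begin

definition kernel_alpha :: "nat \<Rightarrow> complex" where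
  "kernel_alpha j = (of_nat \<kappa> - of_nat (partial_sum l j)) / 2 + of_nat j * \<nu> 1"

text \<open>The extra term at the last index matches the central character of \<open>W\<close>: with
  g_n = 1 it yields the power of t_(n-1) with exponent twice the sum of the
  \<open>tilde \<nu> j\<close>.\<close>

definition kernel_beta :: "nat \<Rightarrow> complex" where
  "kernel_beta j = of_nat (partial_sum l j) / 2 + of_nat j * \<nu> 1 + (if j = Suc r then \<Sum>j=1..Suc r. tilde \<nu> j else 0)"

text \<open>The normalizing factor by which \<open>W_component\<close> divides.\<close>

definition component_coeff :: complex where
  "component_coeff = fact \<kappa> / (\<Prod>i=1..Suc (Suc r). fact (l i)) * \<i> ^ (\<Sum>i=1..Suc r. partial_sum l i)"

text \<open>Recovers the outcome of \<open>unipotent_integral\<close> without its Jacobian, together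
  with the two powers that account for the character of det g and the central character of
  \<open>W\<close>.\<close>

lemma torus_kernel_prod:
  assumes t: "\<And>i. i \<in> {1..Suc r} \<Longrightarrow> 0 < t i"
  shows "(\<Prod>j=1..Suc r. torus_kernel g kernel_alpha kernel_beta t j) =
    complex_of_real (2 ^ (4 * Suc r) * (\<Prod>i<Suc r. (g (Suc i) / t (Suc i)) ^ (\<kappa> - partial_sum l (Suc i)) * (t (Suc i) / g (Suc (Suc i))) ^ partial_sum l (Suc i)) *
      (exp (- 2 * pi * (\<Sum>i<Suc r. (g (Suc i) / t (Suc i))\<^sup>2)) * exp (- 2 * pi * (\<Sum>i<Suc r. (t (Suc i) / g (Suc (Suc i)))\<^sup>2)))) *
    complex_of_real (\<Prod>i=1..Suc (Suc r). g i) powr (2 * \<nu> 1) *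
    complex_of_real (t (Suc r)) powr (2 * (\<Sum>j=1..Suc r. tilde \<nu> j))"
proof -
  let ?s = "\<Sum>j=1..Suc r. tilde \<nu> j"
  let ?\<eta> = "\<lambda>j. if j = Suc r then ?s else 0"
  let ?A = "\<lambda>i. g (Suc i) / t (Suc i)" and ?B = "\<lambda>i. t (Suc i) / g (Suc (Suc i))"
  let ?L = "\<lambda>i. partial_sum l (Suc i)"
  have one: "torus_kernel g kernel_alpha kernel_beta t (Suc i) =
      complex_of_real (16 * (?A i ^ (\<kappa> - ?L i) * ?B i ^ ?L i) * (exp (- 2 * pi * (?A i)\<^sup>2) * exp (- 2 * pi * (?B i)\<^sup>2))) *
      complex_of_real (g (Suc i) / g (Suc (Suc i))) powr (2 * (of_nat (Suc i) * \<nu> 1)) *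
      complex_of_real (?B i) powr (2 * ?\<eta> (Suc i))" if "i < Suc r" for i
  proof -
    have "?L i \<le> \<kappa>" using partial_sum_le[of "Suc i" "Suc (Suc r)" l] l that by simp
    then show ?thesis
      unfolding torus_kernel_def[OF g] kernel_alpha_def kernel_beta_def using that by (intro gker_pair t g) auto
  qed
  have "(\<Prod>j=1..Suc r. torus_kernel g kernel_alpha kernel_beta t j) = (\<Prod>i<Suc r. torus_kernel g kernel_alpha kernel_beta t (Suc i))"
    by (simp only: One_nat_def prod.atLeast1_atMost_eq)
  also have "\<dots> = (\<Prod>i<Suc r. complex_of_real (16 * (?A i ^ (\<kappa> - ?L i) * ?B i ^ ?L i) * (exp (- 2 * pi * (?A i)\<^sup>2) * exp (- 2 * pi * (?B i)\<^sup>2))) *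
      complex_of_real (g (Suc i) / g (Suc (Suc i))) powr (2 * (of_nat (Suc i) * \<nu> 1)) *
      complex_of_real (?B i) powr (2 * ?\<eta> (Suc i)))"
    by (rule prod.cong[OF refl one]) simp
  also have "\<dots> = complex_of_real (\<Prod>i<Suc r. 16 * (?A i ^ (\<kappa> - ?L i) * ?B i ^ ?L i) * (exp (- 2 * pi * (?A i)\<^sup>2) * exp (- 2 * pi * (?B i)\<^sup>2))) *
      (\<Prod>i<Suc r. complex_of_real (g (Suc i) / g (Suc (Suc i))) powr (2 * (of_nat (Suc i) * \<nu> 1))) *
      (\<Prod>i<Suc r. complex_of_real (?B i) powr (2 * ?\<eta> (Suc i)))"
    unfolding of_real_prod by (simp only: prod.distrib)
  also have "(\<Prod>i<Suc r. 16 * (?A i ^ (\<kappa> - ?L i) * ?B i ^ ?L i) * (exp (- 2 * pi * (?A i)\<^sup>2) * exp (- 2 * pi * (?B i)\<^sup>2))) =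
      2 ^ (4 * Suc r) * (\<Prod>i<Suc r. ?A i ^ (\<kappa> - ?L i) * ?B i ^ ?L i) *
      (exp (- 2 * pi * (\<Sum>i<Suc r. (?A i)\<^sup>2)) * exp (- 2 * pi * (\<Sum>i<Suc r. (?B i)\<^sup>2)))"
  proof -
    have "(\<Prod>i<Suc r. 16 * (?A i ^ (\<kappa> - ?L i) * ?B i ^ ?L i) * (exp (- 2 * pi * (?A i)\<^sup>2) * exp (- 2 * pi * (?B i)\<^sup>2))) =
       (\<Prod>i<Suc r. 16) * (\<Prod>i<Suc r. ?A i ^ (\<kappa> - ?L i) * ?B i ^ ?L i) *
       ((\<Prod>i<Suc r. exp (- 2 * pi * (?A i)\<^sup>2)) * (\<Prod>i<Suc r. exp (- 2 * pi * (?B i)\<^sup>2)))"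
      by (simp only: prod.distrib)
    moreover have "(\<Prod>i<Suc r. 16) = (2 ^ (4 * Suc r) :: real)"
    proof -
      have "(16 :: real) = 2 ^ 4" by simp
      then show ?thesis by (simp only: power_mult prod_constant card_lessThan)
    qed
    moreover have "(\<Prod>i<Suc r. exp (- 2 * pi * (?A i)\<^sup>2)) = exp (- 2 * pi * (\<Sum>i<Suc r. (?A i)\<^sup>2))"
      "(\<Prod>i<Suc r. exp (- 2 * pi * (?B i)\<^sup>2)) = exp (- 2 * pi * (\<Sum>i<Suc r. (?B i)\<^sup>2))"
      by (simp_all only: sum_distrib_left exp_sum[OF finite_lessThan])
    ultimately show ?thesis by (simp only:)
  qed
  also have "(\<Prod>i<Suc r. complex_of_real (g (Suc i) / g (Suc (Suc i))) powr (2 * (of_nat (Suc i) * \<nu> 1))) =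
      complex_of_real (\<Prod>i=1..Suc (Suc r). g i) powr (2 * \<nu> 1)"
  proof -
    have "(\<Prod>i=1..Suc (Suc r). g i) = (\<Prod>i<Suc (Suc r). g (Suc i))"
      by (simp only: One_nat_def prod.atLeast1_atMost_eq)
    also have "\<dots> = (\<Prod>i<Suc r. g (Suc i))" using gend by simp
    also have "\<dots> = (\<Prod>i<Suc r. (g (Suc i) / g (Suc (Suc i))) ^ Suc i)"
      using prod_ratio_powers[of g "Suc r", OF g] unfolding gend power_one mult_1_right by (rule sym)
    finally have "complex_of_real (\<Prod>i=1..Suc (Suc r). g i) powr (2 * \<nu> 1) =
       (\<Prod>i<Suc r. complex_of_real ((g (Suc i) / g (Suc (Suc i))) ^ Suc i) powr (2 * \<nu> 1))"
      using g by (simp only:) (intro of_real_powr_prod zero_less_power divide_pos_pos)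
    also have "\<dots> = (\<Prod>i<Suc r. complex_of_real (g (Suc i) / g (Suc (Suc i))) powr (2 * (of_nat (Suc i) * \<nu> 1)))"
      using g by (intro prod.cong refl) (subst of_real_power_powr, auto intro!: divide_pos_pos simp: mult_ac)
    finally show ?thesis by (rule sym)
  qed
  also have "(\<Prod>i<Suc r. complex_of_real (?B i) powr (2 * ?\<eta> (Suc i))) = complex_of_real (t (Suc r)) powr (2 * ?s)"
  proof -
    have "complex_of_real (?B i) powr (2 * ?\<eta> (Suc i)) = 1" if "i < r" for i
    proof -
      have "0 < t (Suc i)" "0 < g (Suc (Suc i))" using that by (auto intro!: t g)
      then have "?B i \<noteq> 0" by simp
      then show ?thesis using that by (simp del: of_real_divide)
    qed
    then have "(\<Prod>i<r. complex_of_real (?B i) powr (2 * ?\<eta> (Suc i))) = 1" by (intro prod.neutral) auto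
    then show ?thesis unfolding prod.lessThan_Suc using gend by simp
  qed
  finally show ?thesis .
qed

text \<open>The integrand behind \<open>W_Pi\<close> at diag t times k, taken for all real t because
  the space of \<open>mult_haar\<close> is the whole line.\<close>

definition wpi_integrand :: "(nat \<Rightarrow> real) \<Rightarrow> complex mat \<Rightarrow> complex" where
  "wpi_integrand t k = complex_of_real (1 / delta_B (Suc r) (diag_real (Suc r) t)) *
     (LINT v|unip_measure (Suc (Suc r)).
       Poly_Mapping.lookup (omega (Suc (Suc r)) (diag_real (Suc r) t * k) (unip_mat (Suc (Suc r)) v * diag_real (Suc (Suc r)) g)
         (phi (Suc (Suc r)) \<kappa>) (eps_mat (Suc (Suc r)))) (monomial_exp (Suc (Suc r)) l)
       * (W (diag_real (Suc r) t * k) * chi 0 (- int \<kappa>) (Determinant.det (diag_real (Suc r) t * k)))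
       * inverse (psi_N (Suc (Suc r)) (unip_mat (Suc (Suc r)) v)))"

lemma wpi_integrand_pos:
  assumes t: "\<And>i. i \<in> {1..Suc r} \<Longrightarrow> 0 < t i" and k: "k \<in> Ugrp (Suc r)"
  shows "complex_of_real (\<Prod>i=1..Suc (Suc r). g i) powr (2 * \<nu> 1) * wpi_integrand t k =
    component_coeff * complex_of_real (delta_B (Suc (Suc r)) (diag_real (Suc (Suc r)) g) powr (1/2)) *
    torus_integrand g kernel_alpha kernel_beta r (spherical_torus (Suc r) (tilde \<nu>)) t"
proof -
  let ?m = "Suc r" and ?n = "Suc (Suc r)"
  let ?e = "monomial_exp ?n l"
  let ?Y = "\<lambda>v. Matrix.mat ?m ?n (\<lambda>(i, j). (unip_mat ?n v * diag_real ?n g) $$ (i, j) / complex_of_real (t (i + 1)))"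
  let ?f = "spherical_torus ?m (tilde \<nu>) (\<lambda>j\<in>{1..r}. t j / t (Suc j))"
  define T D where "T = (\<Prod>i=1..?m. t i)" and "D = (\<Prod>i=1..?n. g i)"
  define Dx Dy where "Dx = (\<Prod>j<?m. \<Prod>i<j. t (Suc i) / t (Suc j))" and "Dy = (\<Prod>j<?n. \<Prod>i<j. g (Suc i) / g (Suc j))"
  define A where "A = (\<Prod>i<?m. \<Prod>j\<in>{i<..<?n}. (t (Suc i) / g (Suc j))\<^sup>2)"
  define U where "U = 2 ^ (4 * ?m) * (\<Prod>i<?m. (g (Suc i) / t (Suc i)) ^ (\<kappa> - partial_sum l (Suc i)) * (t (Suc i) / g (Suc (Suc i))) ^ partial_sum l (Suc i)) *
      (exp (- 2 * pi * (\<Sum>i<?m. (g (Suc i) / t (Suc i))\<^sup>2)) * exp (- 2 * pi * (\<Sum>i<?m. (t (Suc i) / g (Suc (Suc i)))\<^sup>2)))"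
  have tp: "0 < t (Suc i)" if "i < ?m" for i using that by (intro t) auto
  have pos: "T > 0" "D > 0" "Dx > 0" "Dy > 0"
    unfolding T_def D_def Dx_def Dy_def by (intro prod_pos divide_pos_pos g t tp; simp)+
  have dt: "delta_B ?m (diag_real ?m t) = Dx\<^sup>2" "delta_B ?n (diag_real ?n g) = Dy\<^sup>2"
    unfolding delta_B_diag_real Dx_def Dy_def prod_power_distrib by (rule refl)+
  have half: "(x\<^sup>2) powr (1/2) = x" if "x > 0" for x :: real
    using that by (simp add: powr_half_sqrt)
  have ident: "A * D ^ ?m = T ^ ?n * Dx * Dy"
  proof -
    have "T = (\<Prod>i<?m. t (Suc i))" "D = (\<Prod>i<?n. g (Suc i))"
      unfolding T_def D_def by (simp_all only: One_nat_def prod.atLeast1_atMost_eq)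
    then show ?thesis unfolding A_def Dx_def Dy_def by (simp only:) (rule modulus_identity, auto intro: tp g)
  qed
  have Wt: "W (diag_real ?m t * k) = complex_of_real Dx * complex_of_real (t ?m) powr (2 * (\<Sum>i=1..?m. tilde \<nu> i)) * ?f"
  proof -
    have "W (diag_real ?m t * k) = W (diag_real ?m t)"
      using W k diag_real_GL[of ?m t] t by (simp add: spherical_whittaker_def)
    then show ?thesis
      using spherical_whittaker_torus[OF W _ t] pos(3) by (simp add: dt half)
  qed
  have c1: "absC (complex_of_real T) powr (- real ?n / 2) * absC (complex_of_real D) powr (real ?m / 2) = D ^ ?m / T ^ ?n"
  proof -
    have "absC (complex_of_real T) powr (- real ?n / 2) = (T powr 2) powr (- real ?n / 2)"
      using pos by (simp add: absC_def)
    also have "\<dots> = 1 / T ^ ?n"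
    proof -
      have "2 * (- real ?n / 2) = - real ?n" by (simp del: of_nat_Suc)
      then show ?thesis unfolding powr_powr by (simp only: powr_minus powr_realpow[OF pos(1)] inverse_eq_divide)
    qed
    finally have a: "absC (complex_of_real T) powr (- real ?n / 2) = 1 / T ^ ?n" .
    have "absC (complex_of_real D) powr (real ?m / 2) = (D powr 2) powr (real ?m / 2)"
      using pos by (simp add: absC_def)
    also have "\<dots> = D ^ ?m"
    proof -
      have "2 * (real ?m / 2) = real ?m" by (simp del: of_nat_Suc)
      then show ?thesis unfolding powr_powr by (simp only: powr_realpow[OF pos(2)])
    qed
    finally show ?thesis unfolding a by simp
  qed
  have om: "Poly_Mapping.lookup (omega ?n (diag_real ?m t * k) (unip_mat ?n v * diag_real ?n g) (phi ?n \<kappa>) (eps_mat ?n)) ?e =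
     complex_of_real (D ^ ?m / T ^ ?n) * Determinant.det k ^ \<kappa> * Poly_Mapping.lookup (phi ?n \<kappa> (?Y v)) ?e" for v
  proof -
    have G: "unip_mat ?n v * diag_real ?n g \<in> carrier_mat ?n ?n"
      by (rule mult_carrier_mat[of _ _ ?n]) (simp_all add: unip_mat_def)
    have tn: "t i \<noteq> 0" if "i \<in> {1..?m}" for i using t[OF that] by simp
    have "omega ?n (diag_real ?m t * k) (unip_mat ?n v * diag_real ?n g) (phi ?n \<kappa>) (eps_mat ?n) =
        Cst (complex_of_real (D ^ ?m / T ^ ?n) * Determinant.det k ^ \<kappa>) * phi ?n \<kappa> (?Y v)"
      unfolding c1[symmetric] unfolding T_def D_def det_unip_mat_diag[of ?n v g, symmetric] by (rule omega_unitary[OF k tn G])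
    then show ?thesis by (simp only: lookup_Cst_times)
  qed
  have chi1: "Determinant.det k ^ \<kappa> * chi 0 (- int \<kappa>) (Determinant.det (diag_real ?m t * k)) = 1"
    by (rule chi_unitary[OF k t])
  have uni: "(LINT v|unip_measure ?n. Poly_Mapping.lookup (phi ?n \<kappa> (?Y v)) ?e * inverse (psi_N ?n (unip_mat ?n v))) =
      component_coeff * complex_of_real (U * A)"
    unfolding component_coeff_def U_def A_def by (rule unipotent_integral[OF g t l])
  have "wpi_integrand t k = complex_of_real (1 / Dx\<^sup>2) *
     (LINT v|unip_measure ?n. complex_of_real (D ^ ?m / T ^ ?n) *
       (Determinant.det k ^ \<kappa> * chi 0 (- int \<kappa>) (Determinant.det (diag_real ?m t * k))) * W (diag_real ?m t * k) *
       (Poly_Mapping.lookup (phi ?n \<kappa> (?Y v)) ?e * inverse (psi_N ?n (unip_mat ?n v))))"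
    unfolding wpi_integrand_def om dt by (simp only: mult_ac)
  also have "\<dots> = complex_of_real (1 / Dx\<^sup>2) * (complex_of_real (D ^ ?m / T ^ ?n) * W (diag_real ?m t * k) *
      (component_coeff * complex_of_real (U * A)))"
    unfolding chi1 integral_mult_right_zero uni by (simp only: mult_1_right)
  also have "\<dots> = complex_of_real (1 / Dx\<^sup>2 * (D ^ ?m / T ^ ?n) * Dx * A) * (component_coeff * complex_of_real U *
      (complex_of_real (t ?m) powr (2 * (\<Sum>i=1..?m. tilde \<nu> i)) * ?f))"
    unfolding Wt by (simp only: of_real_mult mult_ac)
  \<comment> \<open>The factors are, in order: the inverse modulus in dh, the determinants in
    \<open>omega\<close>, the square root of the modulus in \<open>W\<close>, and the unipotent
    Jacobian.\<close>
  also have "1 / Dx\<^sup>2 * (D ^ ?m / T ^ ?n) * Dx * A = Dy"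
  proof -
    have "1 / Dx\<^sup>2 * (D ^ ?m / T ^ ?n) * Dx * A = (A * D ^ ?m) / (T ^ ?n * Dx)"
      using pos by (simp add: power2_eq_square field_simps del: power_Suc)
    also have "\<dots> = Dy" unfolding ident using pos by (simp del: power_Suc)
    finally show ?thesis .
  qed
  finally have *: "wpi_integrand t k = complex_of_real Dy * (component_coeff * complex_of_real U *
      (complex_of_real (t ?m) powr (2 * (\<Sum>i=1..?m. tilde \<nu> i)) * ?f))" .
  have "torus_integrand g kernel_alpha kernel_beta r (spherical_torus ?m (tilde \<nu>)) t = ?f * (\<Prod>j=1..?m. torus_kernel g kernel_alpha kernel_beta t j)"
    unfolding torus_integrand_def[OF g] using t by (subst if_P) auto
  also have "(\<Prod>j=1..?m. torus_kernel g kernel_alpha kernel_beta t j) = complex_of_real U * complex_of_real D powr (2 * \<nu> 1) *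
      complex_of_real (t ?m) powr (2 * (\<Sum>i=1..?m. tilde \<nu> i))"
    unfolding U_def D_def by (rule torus_kernel_prod[OF t])
  finally show ?thesis
    unfolding * dt half[OF pos(4)] D_def[symmetric] by (simp only: mult_ac)
qed

text \<open>Extends \<open>wpi_integrand_pos\<close> to every real t, so that the two integrals can
  be compared pointwise. Signs of the t_i form a unitary diagonal matrix, which is moved into k, and
  the value does not depend on k. If some t_i is 0, both sides vanish.\<close>

lemma wpi_integrand_abs:
  assumes k: "k \<in> Ugrp (Suc r)"
  shows "complex_of_real (\<Prod>i=1..Suc (Suc r). g i) powr (2 * \<nu> 1) * wpi_integrand t k =
    component_coeff * complex_of_real (delta_B (Suc (Suc r)) (diag_real (Suc (Suc r)) g) powr (1/2)) *
    torus_integrand g kernel_alpha kernel_beta r (spherical_torus (Suc r) (tilde \<nu>)) (\<lambda>j\<in>{1..Suc r}. \<bar>t j\<bar>)"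
proof (cases "\<forall>i\<in>{1..Suc r}. t i \<noteq> 0")
  case True
  let ?m = "Suc r"
  let ?a = "\<lambda>j\<in>{1..?m}. \<bar>t j\<bar>"
  let ?s = "diag_real ?m (\<lambda>i. sgn (t i))"
  note kU = UgrpD[OF k]
  have sk: "?s * k \<in> Ugrp ?m"
  proof -
    have c: "?s * k \<in> carrier_mat ?m ?m" by (rule mult_carrier_mat[OF diag_real_carrier kU(1)])
    have ss: "?s * ?s = 1\<^sub>m ?m"
      unfolding diag_real_def mat_diag_diag using True
      by (auto simp: mat_diag_def sgn_if intro!: eq_matI)
    have "mat_adjoint (?s * k) = mat_adjoint k * ?s"
    proof (rule eq_matI)
      fix i j assume "i < dim_row (mat_adjoint k * ?s)" "j < dim_col (mat_adjoint k * ?s)"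
      then have ij: "i < ?m" "j < ?m" using kU(2) by (auto simp: diag_real_def mat_diag_def)
      have "mat_adjoint (?s * k) $$ (i, j) = cnj ((?s * k) $$ (j, i))"
        using ij c by (simp only: mat_adjoint_eq carrier_matD[OF c] index_mat prod.case)
      also have "(?s * k) $$ (j, i) = complex_of_real (sgn (t (Suc j))) * k $$ (j, i)"
        unfolding diag_real_def using ij by (subst mat_diag_mult_left[OF kU(1)]) simp
      also have "cnj (complex_of_real (sgn (t (Suc j))) * k $$ (j, i)) = mat_adjoint k $$ (i, j) * complex_of_real (sgn (t (Suc j)))"
        using ij kU(1) by (simp add: mat_adjoint_eq)
      also have "\<dots> = (mat_adjoint k * ?s) $$ (i, j)"
        using ij by (simp add: mult_diag_real[OF kU(2)])
      finally show "mat_adjoint (?s * k) $$ (i, j) = (mat_adjoint k * ?s) $$ (i, j)" .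
    qed (use kU(1,2) c in \<open>auto simp: mat_adjoint_eq diag_real_def mat_diag_def\<close>)
    then have "(?s * k) * mat_adjoint (?s * k) = (?s * k) * (mat_adjoint k * ?s)" by simp
    also have "\<dots> = ?s * (k * (mat_adjoint k * ?s))"
      using kU by (intro assoc_mult_mat[of _ ?m ?m _ ?m _ ?m]) auto
    also have "k * (mat_adjoint k * ?s) = (k * mat_adjoint k) * ?s"
      using kU by (intro assoc_mult_mat[of _ ?m ?m _ ?m _ ?m, symmetric]) auto
    finally have "(?s * k) * mat_adjoint (?s * k) = 1\<^sub>m ?m"
      unfolding kU(3) left_mult_one_mat[OF diag_real_carrier] ss .
    then show ?thesis using c by (simp add: Ugrp_def)
  qed
  have "diag_real ?m t = diag_real ?m ?a * ?s"
    unfolding diag_real_def mat_diag_diag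
    unfolding mat_diag_def
    by (intro cong_mat refl) (auto simp: abs_mult_sgn simp flip: of_real_mult)
  then have dk: "diag_real ?m t * k = diag_real ?m ?a * (?s * k)"
    using kU(1) by (simp only:) (intro assoc_mult_mat[of _ ?m ?m _ ?m _ ?m], auto)
  have dB: "delta_B ?m (diag_real ?m t) = delta_B ?m (diag_real ?m ?a)"
    unfolding delta_B_diag_real by (intro prod.cong refl) (auto simp: power_divide)
  have "wpi_integrand t k = wpi_integrand ?a (?s * k)"
    unfolding wpi_integrand_def dk dB ..
  then show ?thesis
    using wpi_integrand_pos[OF _ sk, of ?a] True by simp
next
  case False
  let ?m = "Suc r"
  note kU = UgrpD[OF k]
  have "(\<Prod>i=1..?m. t i) = 0" using False by (intro prod_zero) auto
  then have "Determinant.det (diag_real ?m t * k) = 0"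
    by (simp only: det_mult[OF diag_real_carrier kU(1)] det_diag_real) simp
  \<comment> \<open>In HOL 0 powr x is 0 for every real x, so the determinant factor of
    \<open>omega\<close> vanishes even with a negative exponent.\<close>
  then have "omega (Suc ?m) (diag_real ?m t * k) G \<phi> x = 0" for G \<phi> x
    by (simp add: omega_def absC_def)
  then have "wpi_integrand t k = 0" unfolding wpi_integrand_def by simp
  moreover have "torus_integrand g kernel_alpha kernel_beta r (spherical_torus (Suc r) (tilde \<nu>)) (\<lambda>j\<in>{1..Suc r}. \<bar>t j\<bar>) = 0"
    unfolding torus_integrand_def[OF g] using False by (subst if_not_P) auto
  ultimately show ?thesis by simp
qed

end

section \<open>Assembly of the two sides\<close>

theorem theorem5p7:
  fixes n \<kappa> :: nat
    and \<nu> :: "nat \<Rightarrow> complex"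
    and l :: "nat \<Rightarrow> nat"
    and dk :: "complex mat measure"
    and W :: "complex mat \<Rightarrow> complex"
    and a c d :: "nat \<Rightarrow> real"
  assumes "n \<ge> 2"
    and "irreducible_rep n (principal_series n \<nu> (\<lambda>i. if i = 1 then int \<kappa> else 0))"
    and "haar_prob_U (n - 1) dk"
    and "spherical_whittaker (n - 1) (tilde \<nu>) W"
    and "(\<Sum>i=1..n. l i) = \<kappa>"
    and "\<forall>j\<in>{1..n-1}. 0 < a j"
    and "admissible_lines n \<nu> \<kappa> (partial_sum l) (spherical_torus (n - 1) (tilde \<nu>)) c d"
  shows "torus_part n (W_component n \<nu> \<kappa> dk W l) a =
    vline_integral (n - 2) c (\<lambda>z. mellin (n - 2) (spherical_torus (n - 1) (tilde \<nu>)) z *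
      vline_integral (n - 1) d (\<lambda>s.
        (\<Prod>j=1..n-2. complex_of_real (a j) powr (- s j)
           * Gamma_C ((s j + of_nat \<kappa> - of_nat (partial_sum l j) - z (j - 1)) / 2 + of_nat j * \<nu> 1)
           * Gamma_C ((s j + of_nat (partial_sum l j) - z j) / 2 + of_nat j * \<nu> 1))
        * complex_of_real (a (n - 1)) powr (- s (n - 1))
        * Gamma_C ((s (n - 1) + of_nat \<kappa> - of_nat (partial_sum l (n - 1)) - z (n - 2)) / 2
                     + of_nat (n - 1) * \<nu> 1)
        * Gamma_C ((s (n - 1) + of_nat (partial_sum l (n - 1))) / 2
                     + (\<Sum>j=1..n-1. tilde \<nu> j) + of_nat (n - 1) * \<nu> 1)))"
proof -
  \<comment> \<open>\<open>r\<close> counts the z-variables. For n = 2 it is 0, and the z-integral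
    is over a one-point space with a Mellin transform equal to 1.\<close>
  obtain r where n: "n = Suc (Suc r)"
    using assms(1) by (metis Suc_le_D numeral_2_eq_2 Suc_le_mono)
  \<comment> \<open>The default 1 makes \<open>g j\<close> positive for every j, as the auxiliary
    results require; at j = n the empty product gives g_n = 1.\<close>
  define g where "g j = (if j \<in> {1..n} then \<Prod>i=j..<n. a i else 1)" for j
  define \<alpha> \<beta> where "\<alpha> = kernel_alpha \<kappa> \<nu> l" and "\<beta> = kernel_beta r \<nu> l"
  define f where "f = spherical_torus (Suc r) (tilde \<nu>)"
  have a: "0 < a j" if "j \<in> {1..Suc r}" for j using assms(6) that n by auto
  have g: "0 < g j" for j
  proof (cases "j \<in> {1..n}")
    case True
    then show ?thesis unfolding g_def if_P[OF True] by (intro prod_pos ballI a) (auto simp: n)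
  qed (simp only: g_def if_False zero_less_one)
  have gend: "g (Suc (Suc r)) = 1" by (simp add: g_def n)
  have W: "spherical_whittaker (Suc r) (tilde \<nu>) W" and l: "(\<Sum>i=1..Suc (Suc r). l i) = \<kappa>"
    using assms(4,5) by (simp_all add: n)
  have adm: "admissible_lines (Suc (Suc r)) \<nu> \<kappa> (partial_sum l) f c d"
    using assms(7) by (simp add: n f_def)
  have ratio: "g j / g (Suc j) = a j" if "j \<in> {1..Suc r}" for j
  proof -
    have "j \<in> {1..n}" "Suc j \<in> {1..n}" "j < n" using that n by auto
    then have "g j = a j * g (Suc j)" unfolding g_def by (simp only: if_True prod.atLeast_Suc_lessThan)
    then show ?thesis using g[of "Suc j"] by simp
  qed
  have tm: "tmat n a = diag_real n g"
    unfolding tmat_def diag_real_def mat_diag_def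
    by (intro cong_mat refl) (simp add: g_def)

  have posa: "0 < Re (\<alpha> j) + (d j - (if j = 1 then 0 else c (j - 1))) / 2" if "j \<in> {1..Suc r}" for j
  proof -
    have "0 < (d j + real \<kappa> - real (partial_sum l j) - (if j = 1 then 0 else c (j - 1))) / 2 + real j * Re (\<nu> 1)"
      using adm that unfolding admissible_lines_def diff_Suc_1 by blast
    moreover have "Re (\<alpha> j) = (real \<kappa> - real (partial_sum l j)) / 2 + real j * Re (\<nu> 1)"
      unfolding \<alpha>_def kernel_alpha_def[where g=g, OF W l g gend] by simp
    ultimately show ?thesis by argo
  qed
  have posb: "0 < Re (\<beta> j) + (d j - c j) / 2" if "j \<in> {1..r}" for j
  proof -
    have "0 < (d j + real (partial_sum l j) - c j) / 2 + real j * Re (\<nu> 1)"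
      using adm that unfolding admissible_lines_def diff_Suc_Suc numeral_2_eq_2 minus_nat.diff_0 by blast
    moreover have "Re (\<beta> j) = real (partial_sum l j) / 2 + real j * Re (\<nu> 1)"
      using that unfolding \<beta>_def kernel_beta_def[where g=g, OF W l g gend] by simp
    ultimately show ?thesis by argo
  qed
  have posb': "0 < Re (\<beta> (Suc r)) + d (Suc r) / 2"
  proof -
    have "0 < (d (Suc r) + real (partial_sum l (Suc r))) / 2 + Re (\<Sum>j=1..Suc r. tilde \<nu> j) + real (Suc r) * Re (\<nu> 1)"
      using adm unfolding admissible_lines_def diff_Suc_1 by blast
    moreover have "Re (\<beta> (Suc r)) = real (partial_sum l (Suc r)) / 2 + real (Suc r) * Re (\<nu> 1) + Re (\<Sum>j=1..Suc r. tilde \<nu> j)"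
      unfolding \<beta>_def kernel_beta_def[where g=g, OF W l g gend] by (simp del: sum.cl_ivl_Suc of_nat_Suc)
    ultimately show ?thesis by argo
  qed
  have fint: "integrable (mult_haar_pow r) (mellin_integrand r f (vpt c y))" for y
    using adm by (simp add: admissible_lines_def Re_vpt)
  have ok: "chain_ok c d \<alpha> \<beta> r"
    unfolding chain_ok_def[where g=g, OF g] using posa posb by auto

  have inner: "vline_integral (Suc r) d (\<lambda>s.
        (\<Prod>j=1..r. complex_of_real (a j) powr (- s j)
           * Gamma_C ((s j + of_nat \<kappa> - of_nat (partial_sum l j) - z (j - 1)) / 2 + of_nat j * \<nu> 1)
           * Gamma_C ((s j + of_nat (partial_sum l j) - z j) / 2 + of_nat j * \<nu> 1))
        * complex_of_real (a (Suc r)) powr (- s (Suc r))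
        * Gamma_C ((s (Suc r) + of_nat \<kappa> - of_nat (partial_sum l (Suc r)) - z r) / 2 + of_nat (Suc r) * \<nu> 1)
        * Gamma_C ((s (Suc r) + of_nat (partial_sum l (Suc r))) / 2
                     + (\<Sum>j=1..Suc r. tilde \<nu> j) + of_nat (Suc r) * \<nu> 1)) =
      (\<Prod>j=1..r. chain_factor d g \<alpha> \<beta> j z) * barnes (g (Suc r)) (\<alpha> (Suc r)) (\<beta> (Suc r)) (d (Suc r)) (z r) 0"
    (is "vline_integral _ _ ?F = _") if z: "z = vpt c y" for z y
  proof -
    \<comment> \<open>The last Gamma factor contains no z; reading this as z_(n-1) = 0 gives all
      factors the same form, so that the s-integral splits into \<open>barnes\<close>
      functions.\<close>
    define z' where "z' j = (if j = Suc r then 0 else z j)" for j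
    define h where "h j x = complex_of_real (a j) powr (- Complex (d j) x) *
       Gamma_C (\<alpha> j + (Complex (d j) x - z (j - 1)) / 2) * Gamma_C (\<beta> j + (Complex (d j) x - z' j) / 2)" for j x
    have Fh: "?F (vpt d x) = (\<Prod>j=1..Suc r. h j (x j))" for x
    proof -
      have 1: "h j (x j) = complex_of_real (a j) powr (- vpt d x j)
           * Gamma_C ((vpt d x j + of_nat \<kappa> - of_nat (partial_sum l j) - z (j - 1)) / 2 + of_nat j * \<nu> 1)
           * Gamma_C ((vpt d x j + of_nat (partial_sum l j) - z j) / 2 + of_nat j * \<nu> 1)" if "j \<in> {1..r}" for j
      proof -
        have "\<alpha> j + (w - z (j - 1)) / 2 = (w + of_nat \<kappa> - of_nat (partial_sum l j) - z (j - 1)) / 2 + of_nat j * \<nu> 1" for w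
          by (simp add: \<alpha>_def kernel_alpha_def[where g=g, OF W l g gend] field_simps)
        moreover have "\<beta> j + (w - z j) / 2 = (w + of_nat (partial_sum l j) - z j) / 2 + of_nat j * \<nu> 1" for w
          using that by (simp add: \<beta>_def kernel_beta_def[where g=g, OF W l g gend] field_simps)
        ultimately show ?thesis using that by (simp add: h_def vpt_def z'_def)
      qed
      have 2: "h (Suc r) (x (Suc r)) = complex_of_real (a (Suc r)) powr (- vpt d x (Suc r))
        * Gamma_C ((vpt d x (Suc r) + of_nat \<kappa> - of_nat (partial_sum l (Suc r)) - z r) / 2 + of_nat (Suc r) * \<nu> 1)
        * Gamma_C ((vpt d x (Suc r) + of_nat (partial_sum l (Suc r))) / 2
                     + (\<Sum>j=1..Suc r. tilde \<nu> j) + of_nat (Suc r) * \<nu> 1)"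
      proof -
        have "\<alpha> (Suc r) + (w - z r) / 2 = (w + of_nat \<kappa> - of_nat (partial_sum l (Suc r)) - z r) / 2 + of_nat (Suc r) * \<nu> 1" for w
          by (simp add: \<alpha>_def kernel_alpha_def[where g=g, OF W l g gend] field_simps)
        moreover have "\<beta> (Suc r) + w / 2 = (w + of_nat (partial_sum l (Suc r))) / 2
                     + (\<Sum>j=1..Suc r. tilde \<nu> j) + of_nat (Suc r) * \<nu> 1" for w
          unfolding \<beta>_def kernel_beta_def[where g=g, OF W l g gend] by (simp only: if_True refl add_divide_distrib add_ac)
        ultimately show ?thesis by (simp add: h_def vpt_def z'_def del: of_nat_Suc sum.cl_ivl_Suc)
      qed
      have "(\<Prod>j=1..r. h j (x j)) = (\<Prod>j=1..r. complex_of_real (a j) powr (- vpt d x j)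
           * Gamma_C ((vpt d x j + of_nat \<kappa> - of_nat (partial_sum l j) - z (j - 1)) / 2 + of_nat j * \<nu> 1)
           * Gamma_C ((vpt d x j + of_nat (partial_sum l j) - z j) / 2 + of_nat j * \<nu> 1))"
        by (rule prod.cong[OF refl 1])
      then show ?thesis unfolding prod_atLeast1_Suc 2 by (simp only: mult.assoc)
    qed
    have hint: "integrable lborel (h j)" if j: "j \<in> {1..Suc r}" for j
    proof -
      have "Re (z (j - 1)) = (if j = 1 then 0 else c (j - 1))" using j by (auto simp: z Re_vpt)
      then have p1: "0 < Re (\<alpha> j) + (d j - Re (z (j - 1))) / 2" using posa[OF j] by simp
      have p2: "0 < Re (\<beta> j) + (d j - Re (z' j)) / 2"
        using posb[of j] posb' j by (cases "j = Suc r") (auto simp: z'_def z Re_vpt)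
      show ?thesis unfolding h_def by (rule barnes_integrand_integrable[OF a[OF j] p1 p2])
    qed
    have "vline_integral (Suc r) d ?F = (\<Prod>j=1..Suc r. LINT x|lborel. h j x) / complex_of_real ((2 * pi) ^ Suc r)"
      unfolding vline_integral_vpt Fh
      by (subst LB.product_integral_prod[OF _ hint]) auto
    also have "\<dots> = (\<Prod>j=1..Suc r. (LINT x|lborel. h j x) / (2 * pi))"
      by (simp add: prod_dividef)
    also have "\<dots> = (\<Prod>j=1..Suc r. barnes (a j) (\<alpha> j) (\<beta> j) (d j) (z (j - 1)) (z' j))"
      unfolding barnes_def h_def ..
    also have "\<dots> = (\<Prod>j=1..r. chain_factor d g \<alpha> \<beta> j z) * barnes (g (Suc r)) (\<alpha> (Suc r)) (\<beta> (Suc r)) (d (Suc r)) (z r) 0"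
    proof -
      have "barnes (a j) (\<alpha> j) (\<beta> j) (d j) (z (j - 1)) (z' j) = chain_factor d g \<alpha> \<beta> j z" if "j \<in> {1..r}" for j
        using that ratio[of j] by (simp add: chain_factor_def[where g=g, OF g] z'_def)
      moreover have "a (Suc r) = g (Suc r)" using ratio[of "Suc r"] gend by simp
      ultimately show ?thesis unfolding prod_atLeast1_Suc by (simp add: z'_def)
    qed
    finally show ?thesis .
  qed

  have rhs: "vline_integral r c (\<lambda>z. mellin r f z * vline_integral (Suc r) d (\<lambda>s.
        (\<Prod>j=1..r. complex_of_real (a j) powr (- s j)
           * Gamma_C ((s j + of_nat \<kappa> - of_nat (partial_sum l j) - z (j - 1)) / 2 + of_nat j * \<nu> 1)
           * Gamma_C ((s j + of_nat (partial_sum l j) - z j) / 2 + of_nat j * \<nu> 1))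
        * complex_of_real (a (Suc r)) powr (- s (Suc r))
        * Gamma_C ((s (Suc r) + of_nat \<kappa> - of_nat (partial_sum l (Suc r)) - z r) / 2 + of_nat (Suc r) * \<nu> 1)
        * Gamma_C ((s (Suc r) + of_nat (partial_sum l (Suc r))) / 2
                     + (\<Sum>j=1..Suc r. tilde \<nu> j) + of_nat (Suc r) * \<nu> 1))) =
      (LINT t|mult_haar_pow (Suc r). torus_integrand g \<alpha> \<beta> r f t)"
  proof -
    have p: "0 < Re (\<alpha> (Suc r)) + (d (Suc r) - (if r = 0 then 0 else c r)) / 2"
      using posa[of "Suc r"] by auto
    show ?thesis
      unfolding vline_integral_chain[where g=g, OF g ok gend p posb' fint, symmetric]
      unfolding vline_integral_vpt[of r] inner[OF refl] ..
  qed

  interpret K: prob_space dk using assms(3) by (simp add: haar_prob_U_def)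
  have dk: "space dk = Ugrp (Suc r)" using assms(3) by (simp add: haar_prob_U_def n)
  let ?n = "Suc (Suc r)" and ?m = "Suc r"
  let ?e = "monomial_exp ?n l"
  let ?w = "wpi_integrand r \<kappa> l W g"
  let ?C = "component_coeff r \<kappa> l"
  let ?chi = "complex_of_real (\<Prod>i=1..?n. g i) powr (2 * \<nu> 1)"
  let ?H = "torus_integrand g \<alpha> \<beta> r f"
  define \<delta> where "\<delta> = delta_B ?n (diag_real ?n g)"
  have \<delta>: "\<delta> > 0"
    unfolding \<delta>_def delta_B_diag_real by (intro prod_pos ballI zero_less_power divide_pos_pos g)
  have chi: "chi (\<nu> 1) (int \<kappa>) (Determinant.det (diag_real ?n g)) = ?chi"
  proof -
    define D where "D = (\<Prod>i=1..?n. g i)"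
    have D: "D > 0" unfolding D_def by (intro prod_pos g)
    have "absC (complex_of_real D) = D * D" by (simp add: absC_def power2_eq_square)
    moreover have "complex_of_real (D * D) powr \<nu> 1 = complex_of_real D powr (2 * \<nu> 1)"
      using D by (subst of_real_powr_mult) (auto simp flip: powr_add)
    ultimately show ?thesis
      using D unfolding det_diag_real D_def[symmetric] chi_def by simp
  qed
  have Hm: "?H \<in> borel_measurable (mult_haar_pow ?m)"
    by (rule torus_integrand_measurable[where g=g, OF g borel_measurable_integrable[OF fint[of "\<lambda>_. 0"]]])
  have absm: "(\<lambda>t. \<lambda>j\<in>{1..?m}. \<bar>t j\<bar>) \<in> mult_haar_pow ?m \<rightarrow>\<^sub>M mult_haar_pow ?m"
    unfolding mult_haar_pow_def
  proof (rule measurable_restrict)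
    fix j assume "j \<in> {1..?m}"
    then have [measurable]: "(\<lambda>t. t j) \<in> borel_measurable (PiM {1..?m} (\<lambda>_. mult_haar))"
      by (rule mult_haar_component_measurable)
    have "(\<lambda>t. \<bar>t j\<bar>) \<in> borel_measurable (PiM {1..?m} (\<lambda>_. mult_haar))" by measurable
    then show "(\<lambda>t. \<bar>t j\<bar>) \<in> PiM {1..?m} (\<lambda>_. mult_haar) \<rightarrow>\<^sub>M mult_haar"
      by (simp only: measurable_cong_sets[OF refl sets_mult_haar])
  qed
  have "?chi * W_Pi ?n \<kappa> dk W (diag_real ?n g) ?e = (LINT p|(mult_haar_pow ?m \<Otimes>\<^sub>M dk). ?chi * ?w (fst p) (snd p))"
    unfolding W_Pi_def quot_integral_def wpi_integrand_def[where g=g, OF W l g gend] integral_mult_right_zero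
    by (simp only: diff_Suc_1 case_prod_unfold)
  also have "\<dots> = (LINT p|(mult_haar_pow ?m \<Otimes>\<^sub>M dk).
      ?C * complex_of_real (\<delta> powr (1/2)) * ?H (\<lambda>j\<in>{1..?m}. \<bar>fst p j\<bar>))"
  \<comment> \<open>The identity holds at every point of the space, so the integrals agree without
    reference to measurability of the integrand of \<open>W_Pi\<close>.\<close>
  proof (rule Bochner_Integration.integral_cong[OF refl])
    fix p assume "p \<in> space (mult_haar_pow ?m \<Otimes>\<^sub>M dk)"
    then have "snd p \<in> Ugrp ?m" by (auto simp: space_pair_measure dk)
    then show "?chi * ?w (fst p) (snd p) = ?C * complex_of_real (\<delta> powr (1/2)) * ?H (\<lambda>j\<in>{1..?m}. \<bar>fst p j\<bar>)"
      unfolding \<alpha>_def \<beta>_def f_def \<delta>_def by (rule wpi_integrand_abs[where g=g, OF W l g gend])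
  qed
  also have "\<dots> = ?C * complex_of_real (\<delta> powr (1/2)) *
      (LINT p|(mult_haar_pow ?m \<Otimes>\<^sub>M dk). ?H (\<lambda>j\<in>{1..?m}. \<bar>fst p j\<bar>))"
    by (rule integral_mult_right_zero)
  \<comment> \<open>The integrand no longer involves k, and \<open>dk\<close> has total mass 1, so
    projecting to the torus coordinates removes the unitary variable.\<close>
  also have "(LINT p|(mult_haar_pow ?m \<Otimes>\<^sub>M dk). ?H (\<lambda>j\<in>{1..?m}. \<bar>fst p j\<bar>)) =
      (LINT t|distr (mult_haar_pow ?m \<Otimes>\<^sub>M dk) (mult_haar_pow ?m) fst. ?H (\<lambda>j\<in>{1..?m}. \<bar>t j\<bar>))"
    by (rule integral_distr[symmetric, OF measurable_fst measurable_compose[OF absm Hm]])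
  also have "\<dots> = (LINT t|mult_haar_pow ?m. ?H (\<lambda>j\<in>{1..?m}. \<bar>t j\<bar>))"
    unfolding K.distr_pair_fst ..
  also have "\<dots> = (LINT t|mult_haar_pow ?m. ?H t)"
  proof (rule integral_cong_AE[OF measurable_compose[OF absm Hm] Hm])
    show "AE t in mult_haar_pow ?m. ?H (\<lambda>j\<in>{1..?m}. \<bar>t j\<bar>) = ?H t"
      using AE_mult_haar_pow_pos[of ?m] AE_space
    proof eventually_elim
      case (elim t)
      have "(\<lambda>j\<in>{1..?m}. \<bar>t j\<bar>) = t"
        using elim by (auto simp: fun_eq_iff mult_haar_pow_def space_PiM PiE_def extensional_def intro!: abs_of_pos)
      then show ?case by (simp only:)
    qed
  qed
  finally have main: "?chi * W_Pi ?n \<kappa> dk W (diag_real ?n g) ?e =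
      ?C * complex_of_real (\<delta> powr (1/2)) * (LINT t|mult_haar_pow ?m. ?H t)" .
  have C0: "?C \<noteq> 0"
    by (simp add: component_coeff_def[where g=g, OF W l g gend])
  have \<delta>1: "complex_of_real (\<delta> powr (- 1/2)) * complex_of_real (\<delta> powr (1/2)) = 1"
    using \<delta> by (simp flip: of_real_mult powr_add)
  have "torus_part ?n (W_component ?n \<nu> \<kappa> dk W l) a =
      complex_of_real (\<delta> powr (- 1/2)) * (?chi * W_Pi ?n \<kappa> dk W (diag_real ?n g) ?e / ?C)"
    unfolding torus_part_def W_component_def W_nu_kappa_def tm[unfolded n] chi \<delta>_def
    by (simp only: component_coeff_def[where g=g, OF W l g gend] diff_Suc_1)
  also have "\<dots> = (complex_of_real (\<delta> powr (- 1/2)) * complex_of_real (\<delta> powr (1/2))) * (LINT t|mult_haar_pow ?m. ?H t)"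
    unfolding main using C0 by simp
  also have "\<dots> = (LINT t|mult_haar_pow ?m. ?H t)" unfolding \<delta>1 by simp
  finally have lhs: "torus_part ?n (W_component ?n \<nu> \<kappa> dk W l) a = (LINT t|mult_haar_pow ?m. ?H t)" .
  have "n - 2 = r" "n - 1 = Suc r" using n by simp_all
  then show ?thesis using lhs[folded n] rhs by (simp only: f_def)
qed

end
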